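(* Let $\Delta$ and $\Gamma$ be atomic graphs. Then $\mathbb{G}(\Delta)$ embeds as a subgroup in $\mathbb{G}(\Gamma)$ and $\mathbb{G}(\Gamma)$ embeds as a subgroup in $\mathbb{G}(\Delta)$ if and only if $\Delta$ and $\Gamma$ are isomorphic.
   Context: A finite simplicial graph is atomic if it is connected, has no vertices of valence $1$, has no cycles of length less than $5$, and the closed star of no vertex separates it. $\mathbb{G}(\Gamma)$ is the pc group (right-angled Artin group) with generators $V(\Gamma)$ and relations $[u,v]=1$ for each edge of $\Gamma$. *)

theory Defs
  imports "HOL-Algebra.Group"
begin

text \<open>Finite simplicial graphs: a finite vertex set V and a symmetric,
irreflexive edge relation E on V.\<close>

definition simple_graph :: "'a set \<Rightarrow> ('a \<times> 'a) set \<Rightarrow> bool" where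
  "simple_graph V E \<longleftrightarrow> finite V \<and> E \<subseteq> V \<times> V \<and> sym E \<and> irrefl E"

definition neighbours :: "('a \<times> 'a) set \<Rightarrow> 'a \<Rightarrow> 'a set" where
  "neighbours E v = {w. (v, w) \<in> E}"

definition closed_star :: "('a \<times> 'a) set \<Rightarrow> 'a \<Rightarrow> 'a set" where
  "closed_star E v = insert v (neighbours E v)"

text \<open>Any two vertices of S are joined by a path in the subgraph induced on S.\<close>
definition connected_on :: "'a set \<Rightarrow> ('a \<times> 'a) set \<Rightarrow> bool" where
  "connected_on S E \<longleftrightarrow> (\<forall>x\<in>S. \<forall>y\<in>S. (x, y) \<in> (E \<inter> (S \<times> S))\<^sup>*)"

definition connected_graph :: "'a set \<Rightarrow> ('a \<times> 'a) set \<Rightarrow> bool" where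
  "connected_graph V E \<longleftrightarrow> V \<noteq> {} \<and> connected_on V E"

text \<open>A (simple) cycle of length n \<ge> 3: n distinct vertices, cyclically adjacent.\<close>
definition has_cycle_of_length :: "'a set \<Rightarrow> ('a \<times> 'a) set \<Rightarrow> nat \<Rightarrow> bool" where
  "has_cycle_of_length V E n \<longleftrightarrow> 3 \<le> n \<and>
     (\<exists>cs. length cs = n \<and> distinct cs \<and> set cs \<subseteq> V \<and>
        (\<forall>i < n. (cs ! i, cs ! ((i + 1) mod n)) \<in> E))"

definition atomic :: "'a set \<Rightarrow> ('a \<times> 'a) set \<Rightarrow> bool" where
  "atomic V E \<longleftrightarrow> simple_graph V E \<and> connected_graph V E
     \<and> (\<forall>v\<in>V. card (neighbours E v) \<noteq> 1)
     \<and> (\<forall>n < 5. \<not> has_cycle_of_length V E n)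
     \<and> (\<forall>v\<in>V. connected_on (V - closed_star E v) E)"

definition graph_iso :: "'a set \<Rightarrow> ('a \<times> 'a) set \<Rightarrow> 'b set \<Rightarrow> ('b \<times> 'b) set \<Rightarrow> bool" where
  "graph_iso V E W F \<longleftrightarrow> (\<exists>f. bij_betw f V W \<and>
      (\<forall>x\<in>V. \<forall>y\<in>V. (x, y) \<in> E \<longleftrightarrow> (f x, f y) \<in> F))"

text \<open>Right-angled Artin group G(V,E): words over letters (v, True) = v and
(v, False) = v inverse, modulo the congruence generated by free cancellation and
commutation of adjacent generators.\<close>

definition words :: "'a set \<Rightarrow> ('a \<times> bool) list set" where
  "words V = {w. set w \<subseteq> V \<times> UNIV}"

inductive raag_eq :: "'a set \<Rightarrow> ('a \<times> 'a) set \<Rightarrow> ('a \<times> bool) list \<Rightarrow> ('a \<times> bool) list \<Rightarrow> bool"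
  for V E where
  refl: "w \<in> words V \<Longrightarrow> raag_eq V E w w"
| sym: "raag_eq V E w w' \<Longrightarrow> raag_eq V E w' w"
| trans: "raag_eq V E u v \<Longrightarrow> raag_eq V E v w \<Longrightarrow> raag_eq V E u w"
| cancel: "xs \<in> words V \<Longrightarrow> ys \<in> words V \<Longrightarrow> x \<in> V \<Longrightarrow>
     raag_eq V E (xs @ [(x, b), (x, \<not> b)] @ ys) (xs @ ys)"
| commute: "xs \<in> words V \<Longrightarrow> ys \<in> words V \<Longrightarrow> (u, v) \<in> E \<Longrightarrow>
     raag_eq V E (xs @ [(u, True), (v, True)] @ ys) (xs @ [(v, True), (u, True)] @ ys)"

definition raag_class :: "'a set \<Rightarrow> ('a \<times> 'a) set \<Rightarrow> ('a \<times> bool) list \<Rightarrow> ('a \<times> bool) list set" where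
  "raag_class V E w = {w'. raag_eq V E w w'}"

definition raag :: "'a set \<Rightarrow> ('a \<times> 'a) set \<Rightarrow> ('a \<times> bool) list set monoid" where
  "raag V E = \<lparr> carrier = raag_class V E ` words V,
      mult = (\<lambda>A B. {w. \<exists>a\<in>A. \<exists>b\<in>B. raag_eq V E (a @ b) w}),
      one = raag_class V E [] \<rparr>"

text \<open>G embeds as a subgroup of H: there is an injective homomorphism.\<close>
definition embeds :: "('a, 'c) monoid_scheme \<Rightarrow> ('b, 'd) monoid_scheme \<Rightarrow> bool" where
  "embeds G H \<longleftrightarrow> mon G H \<noteq> {}"

end

theory Submission
  imports Defs
begin

text \<open>
  The extension graph of \<open>\<Gamma>\<close> has as vertices the cosets of the subgroups generated by the stars of
  vertices \<open>u\<close>, that is, the conjugates of generators; two are adjacent if they commute.  It is tiled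
  by the translates (copies) of \<open>\<Gamma>\<close>, has girth at least five, and a finite set of vertices that is not
  separated by the star of any vertex lies in one copy.

  Since \<open>\<Gamma>\<close> has girth at least five, an element commuting with two elements without commuting powers
  is conjugate to a power of a generator: a commutator of elements centralizing \<open>c\<close> fixes, up to
  taking powers, two consecutive hyperplanes on the axis of \<open>c\<close>, and the common link of two vertices is
  at most one vertex.  In an atomic graph with more than one vertex all valences are at least two, so an
  embedding of groups induces an induced embedding of extension graphs.

  Given embeddings in both directions, let \<open>\<phi>\<close> be the composite self-embedding of the extension graph.
  Some copy \<open>C\<close> has an unseparated image under \<open>\<phi>\<close>: choose \<open>C\<close> around a largest set all of whose iterated
  images are unseparated; otherwise cutting along stars yields a larger such set.  As a vertex outside
  a copy has at most one neighbour in it and an atomic graph has no cut vertex, the image of \<open>C\<close>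
  under the first embedding already lies in one copy.  Hence each graph is an induced subgraph of the
  other one.
\<close>

section \<open>Separation in graphs of girth at least five\<close>

text \<open>The obstacle is that an embedding of extension graphs need not send a copy into a copy.
  Stars centred in the image of a copy never separate it, because the star condition of an atomic
  graph is inherited, but stars centred elsewhere may. Cutting at such a star adds its centre
  \<open>v\<close>, so termination has to be earned: the discarded side has at least two vertices,
  since a single one would close a square with \<open>v\<close>. A centre outside the set being cut
  has two neighbours in it, so every set produced stays in the \<open>hull\<close> of the image of
  the copy, and centres inside that image remain harmless throughout. Since stability concerns all
  iterates of the self-embedding, sizes are compared over all iterates at once. The graph with one
  vertex is atomic too; its vertex has no neighbours to supply non-commuting elements, so it is
  treated apart.\<close>

locale girth5_graph =
  fixes X :: "'x set" and R :: "('x \<times> 'x) set"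
  assumes R_sub: "R \<subseteq> X \<times> X" and R_sym: "sym R" and R_irrefl: "irrefl R"
    and no_triangle: "\<And>a b c. (a, b) \<in> R \<Longrightarrow> (b, c) \<in> R \<Longrightarrow> (a, c) \<notin> R"
    and no_square: "\<And>a b c d. (a, b) \<in> R \<Longrightarrow> (b, c) \<in> R \<Longrightarrow> (c, d) \<in> R \<Longrightarrow> (d, a) \<in> R \<Longrightarrow>
      a = c \<or> b = d"
begin

definition off_star :: "'x \<Rightarrow> ('x \<times> 'x) set" where
  "off_star v = R \<inter> ((X - closed_star R v) \<times> (X - closed_star R v))"

text \<open>Separation is measured in the whole graph: a path between two vertices of
  \<open>P\<close> may leave \<open>P\<close>. In the extension graph this suffices to keep both on
  one side of a hyperplane.\<close>

definition unsep :: "'x set \<Rightarrow> bool" where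
  "unsep P \<longleftrightarrow> (\<forall>v\<in>X. \<forall>y\<in>P - closed_star R v. \<forall>z\<in>P - closed_star R v. (y, z) \<in> (off_star v)\<^sup>*)"

text \<open>A single edge qualifies; it is the seed from which a largest stable set is
  sought.\<close>

definition biconn :: "'x set \<Rightarrow> bool" where
  "biconn P \<longleftrightarrow> finite P \<and> 2 \<le> card P \<and> connected_on P R \<and> (\<forall>x. connected_on (P - {x}) R)"

text \<open>Bounds what repeated cutting can create: the centre of a cut lies in the set being cut
  or has two neighbours in it.\<close>

inductive_set hull :: "'x set \<Rightarrow> 'x set" for Y where
  base: "y \<in> Y \<Longrightarrow> y \<in> hull Y"
| step: "d \<in> X \<Longrightarrow> l \<in> hull Y \<Longrightarrow> m \<in> hull Y \<Longrightarrow> l \<noteq> m \<Longrightarrow> (d, l) \<in> R \<Longrightarrow> (d, m) \<in> R \<Longrightarrow> d \<in> hull Y"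

lemma Rsym: "(a, b) \<in> R \<Longrightarrow> (b, a) \<in> R"
  using R_sym by (meson symD)

lemma Rirr: "(a, a) \<notin> R"
  using R_irrefl by (simp add: irrefl_def)

lemma in_star: "w \<in> closed_star R v \<longleftrightarrow> w = v \<or> (v, w) \<in> R"
  by (auto simp: closed_star_def neighbours_def)

lemma sym_off_star: "sym (off_star v)"
  using R_sym by (auto simp: off_star_def sym_def)

lemma off_star_sym: "(a, b) \<in> (off_star v)\<^sup>* \<Longrightarrow> (b, a) \<in> (off_star v)\<^sup>*"
  using sym_rtrancl[OF sym_off_star] by (meson symD)

lemma off_star_edge:
  "(a, b) \<in> R \<Longrightarrow> a \<notin> closed_star R v \<Longrightarrow> b \<notin> closed_star R v \<Longrightarrow> (a, b) \<in> off_star v"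
  using R_sub by (auto simp: off_star_def)

lemma off_star_connected_on:
  assumes "connected_on (Y - closed_star R v) R" "Y \<subseteq> X"
    "y \<in> Y - closed_star R v" "z \<in> Y - closed_star R v"
  shows "(y, z) \<in> (off_star v)\<^sup>*"
proof -
  have "(y, z) \<in> (R \<inter> ((Y - closed_star R v) \<times> (Y - closed_star R v)))\<^sup>*"
    using assms unfolding connected_on_def by blast
  moreover have "R \<inter> ((Y - closed_star R v) \<times> (Y - closed_star R v)) \<subseteq> off_star v"
    using assms(2) unfolding off_star_def by blast
  ultimately show ?thesis by (meson rtrancl_mono subsetD)
qed

text \<open>A vertex outside a star has at most one neighbour in it, so a side of a star is closed
  under adding vertices with two neighbours.\<close>

lemma hull_off_star:
  assumes "h \<in> hull Y" "v \<in> X" "Y \<subseteq> X"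
  shows "h \<in> closed_star R v \<or> (\<exists>y\<in>Y - closed_star R v. (y, h) \<in> (off_star v)\<^sup>*)"
  using assms(1)
proof induction
  case (base y)
  then show ?case by blast
next
  case (step d l m)
  show ?case
  proof (cases "d \<in> closed_star R v")
    case False
    have one: ?thesis if k: "k \<notin> closed_star R v" "(d, k) \<in> R"
      and IH: "k \<in> closed_star R v \<or> (\<exists>y\<in>Y - closed_star R v. (y, k) \<in> (off_star v)\<^sup>*)" for k
    proof -
      obtain y where "y \<in> Y - closed_star R v" "(y, k) \<in> (off_star v)\<^sup>*" using k IH by blast
      moreover have "(k, d) \<in> off_star v" using k False Rsym off_star_edge by blast
      ultimately show ?thesis by (meson rtrancl.rtrancl_into_rtrancl)
    qed
    show ?thesis
    proof (cases "l \<in> closed_star R v \<and> m \<in> closed_star R v")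
      case True
      then have "(v, l) \<in> R" "(v, m) \<in> R"
        using False step Rsym unfolding in_star by blast+
      then have "d = v \<or> l = m" using no_square step Rsym by metis
      then show ?thesis using False step in_star by blast
    qed (use one step in blast)
  qed simp
qed

lemma hull_unsep_at:
  assumes "v \<in> X" "Y \<subseteq> X" "connected_on (Y - closed_star R v) R"
    "y \<in> hull Y - closed_star R v" "z \<in> hull Y - closed_star R v"
  shows "(y, z) \<in> (off_star v)\<^sup>*"
proof -
  obtain y' where y': "y' \<in> Y - closed_star R v" "(y', y) \<in> (off_star v)\<^sup>*"
    using hull_off_star[of y Y v] assms by blast
  obtain z' where z': "z' \<in> Y - closed_star R v" "(z', z) \<in> (off_star v)\<^sup>*"
    using hull_off_star[of z Y v] assms by blast
  have "(y', z') \<in> (off_star v)\<^sup>*" using off_star_connected_on assms y' z' by blast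
  then show ?thesis using y' z' off_star_sym by (meson rtrancl_trans)
qed

lemma rtrancl_leave:
  assumes "(a, b) \<in> S\<^sup>*" "a \<in> T" "b \<notin> T"
  obtains c d where "(c, d) \<in> S" "c \<in> T" "d \<notin> T"
  using assms by (induction) blast+

lemma connected_on_leave:
  assumes "connected_on S R" "a \<in> S" "b \<in> S" "a \<in> T" "b \<notin> T"
  obtains c d where "(c, d) \<in> R" "c \<in> S" "d \<in> S" "c \<in> T" "d \<notin> T"
proof -
  have "(a, b) \<in> (R \<inter> (S \<times> S))\<^sup>*" using assms unfolding connected_on_def by blast
  then show ?thesis using rtrancl_leave[OF _ assms(4,5)] that by blast
qed

lemma biconn_edge:
  assumes "biconn P" "x \<in> P"
  obtains y where "y \<in> P" "(x, y) \<in> R"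
proof -
  have "\<exists>z\<in>P. z \<noteq> x"
  proof (rule ccontr)
    assume "\<not> ?thesis"
    then have "P \<subseteq> {x}" by blast
    then have "card P \<le> card {x}" by (intro card_mono) auto
    then show False using assms unfolding biconn_def by simp
  qed
  then obtain z where z: "z \<in> P" "z \<noteq> x" by blast
  then show ?thesis
    using connected_on_leave[of P x z "{x}"] assms that unfolding biconn_def by auto
qed

text \<open>After deletion of a first neighbour \<open>a\<close>, the vertex \<open>x\<close> is
  still joined to a third vertex.\<close>

lemma biconn_two_edges:
  assumes "biconn P" "x \<in> P" "y \<in> P" "z \<in> P" "x \<noteq> y" "x \<noteq> z" "y \<noteq> z"
  obtains a b where "a \<in> P" "b \<in> P" "a \<noteq> b" "(x, a) \<in> R" "(x, b) \<in> R"
proof -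
  obtain a where a: "a \<in> P" "(x, a) \<in> R" using biconn_edge assms by blast
  have "a \<noteq> x" using a Rirr by blast
  obtain w where w: "w \<in> P" "w \<noteq> a" "w \<noteq> x" using assms by metis
  have "connected_on (P - {a}) R" using assms unfolding biconn_def by blast
  then obtain c d where "(c, d) \<in> R" "d \<in> P - {a}" "c = x"
    using connected_on_leave[of "P - {a}" x w "{x}"] w assms \<open>a \<noteq> x\<close>
    by (metis Diff_iff singletonD singletonI)
  then show ?thesis using that a by blast
qed

text \<open>\<open>Q'\<close> consists of the part of \<open>Q\<close> around \<open>P\<close>, up
  to the link of \<open>v\<close>, and of \<open>v\<close> itself. The centre \<open>v\<close>
  replaces the connections that ran through the discarded side, so no cut vertex appears.\<close>

lemma cut:
  assumes Q: "Q \<subseteq> X" "biconn Q" and P: "P \<subseteq> Q" "biconn P" "unsep P"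
    and v: "v \<in> X" "v \<notin> P"
    and sep: "y \<in> Q - closed_star R v" "z \<in> Q - closed_star R v" "(y, z) \<notin> (off_star v)\<^sup>*"
  shows "\<exists>Q'. biconn Q' \<and> P \<subseteq> Q' \<and> v \<in> Q' \<and> Q' \<subseteq> insert v Q \<and> card Q' < card Q \<and> v \<in> hull Q"
proof -
  let ?S = "closed_star R v"
  have finQ: "finite Q" using Q unfolding biconn_def by blast
  have L_indep: "(a, b) \<notin> R" if "(v, a) \<in> R" "(v, b) \<in> R" for a b
    using no_triangle[of a v b] that Rsym by blast
  \<comment> \<open>The link of \<open>v\<close> is independent and \<open>v\<close> is not in
    \<open>P\<close>, so an edge of \<open>P\<close> cannot lie inside the star.\<close>
  obtain p0 where p0: "p0 \<in> P" "p0 \<notin> ?S"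
  proof -
    have "P \<noteq> {}" using P unfolding biconn_def by auto
    then obtain a where a: "a \<in> P" by blast
    obtain b where "b \<in> P" "(a, b) \<in> R" using biconn_edge[OF P(2) a] by blast
    then show ?thesis using that a L_indep v unfolding in_star by blast
  qed
  define D where "D = {t. (p0, t) \<in> (off_star v)\<^sup>*}"
  have p0D: "p0 \<in> D" unfolding D_def by blast
  have D_closed: "b \<in> D" if "a \<in> D" "(a, b) \<in> R" "a \<notin> ?S" "b \<notin> ?S" for a b
    using that off_star_edge[of a b v] unfolding D_def by (auto intro: rtrancl_into_rtrancl)
  have D_off: "a \<notin> ?S" if "a \<in> D" for a
  proof -
    have "(p0, a) \<in> (off_star v)\<^sup>*" using that D_def by simp
    then show ?thesis by (cases rule: rtranclE) (use p0 in \<open>auto simp: off_star_def\<close>)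
  qed
  have PD: "P - ?S \<subseteq> D" using P(3) p0 v(1) unfolding unsep_def D_def by blast
  \<comment> \<open>The far side, to be discarded. Inside \<open>Q\<close> its edges lead only to
    itself or into the link of \<open>v\<close>.\<close>
  define Qp where "Qp = Q - D - ?S"
  have Qp_ne: "Qp \<noteq> {}"
  proof
    assume "Qp = {}"
    then have "y \<in> D" "z \<in> D" using sep unfolding Qp_def by blast+
    then show False using sep(3) off_star_sym unfolding D_def by (meson mem_Collect_eq rtrancl_trans)
  qed
  have Qp_nb: "b \<in> Qp \<or> (v, b) \<in> R" if "a \<in> Qp" "(a, b) \<in> R" "b \<in> Q" for a b
  proof -
    have "a \<notin> ?S" "a \<notin> D" using that unfolding Qp_def by auto
    then have "b \<noteq> v" using that Rsym in_star by blast
    moreover have "b \<notin> D" using D_closed[of b a] D_off that \<open>a \<notin> ?S\<close> \<open>a \<notin> D\<close> Rsym by blast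
    ultimately show ?thesis using that by (auto simp: Qp_def in_star)
  qed
  obtain q where q: "q \<in> Qp" using Qp_ne by blast
  have qQ: "q \<in> Q" "q \<notin> ?S" "q \<notin> D" using q unfolding Qp_def by auto
  obtain p1 where p1: "p1 \<in> P" "(p0, p1) \<in> R" using biconn_edge[OF P(2) p0(1)] by blast
  have p1q: "p1 \<noteq> q" using PD p1 qQ by blast
  have p01: "p0 \<noteq> p1" using p1 Rirr by blast
  have p0q: "p0 \<noteq> q" using p0D qQ by blast
  \<comment> \<open>A lone far vertex \<open>q\<close> would have two neighbours in
    \<open>Q\<close>, both in the link of \<open>v\<close>: a square through \<open>q\<close> and
    \<open>v\<close>.\<close>
  have card_Qp: "2 \<le> card Qp"
  proof (rule ccontr)
    assume "\<not> ?thesis"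
    moreover have "card Qp \<noteq> 0" using Qp_ne finQ unfolding Qp_def by auto
    ultimately have "card Qp = 1" by linarith
    then have Qpq: "Qp = {q}" using q by (metis card_1_singletonE singletonD)
    obtain a b where ab: "a \<in> Q" "b \<in> Q" "a \<noteq> b" "(q, a) \<in> R" "(q, b) \<in> R"
      using biconn_two_edges[OF Q(2) qQ(1), of p0 p1] p0 p1 P(1) p0q p1q p01 by blast
    then have "(v, a) \<in> R" "(v, b) \<in> R" using Qp_nb[of q] q Qpq Rirr by blast+
    then have "q = v \<or> a = b" using no_square[of q a v b] ab Rsym by blast
    then show False using ab qQ in_star by blast
  qed
  \<comment> \<open>Some boundary vertices in \<open>M\<close> may be attached to \<open>P\<close>
    only through the far side; passing to the component \<open>B\<close> of \<open>p0\<close> drops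
    them.\<close>
  define M where "M = Q \<inter> (D \<union> ?S) - {v}"
  define B where "B = {t. (p0, t) \<in> (R \<inter> M \<times> M)\<^sup>*}"
  have p0M: "p0 \<in> M" using p0 p0D P v unfolding M_def by blast
  have BM: "B \<subseteq> M"
  proof
    fix t assume "t \<in> B"
    then have "(p0, t) \<in> (R \<inter> M \<times> M)\<^sup>*" unfolding B_def by simp
    then show "t \<in> M" by (cases rule: rtranclE) (use p0M in auto)
  qed
  have B_closed: "b \<in> B" if "a \<in> B" "(a, b) \<in> R" "b \<in> M" for a b
    using that BM unfolding B_def by (auto intro: rtrancl_into_rtrancl)
  have symM: "(b, a) \<in> (R \<inter> S \<times> S)\<^sup>*" if "(a, b) \<in> (R \<inter> S \<times> S)\<^sup>*" for a b S
  proof -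
    have "sym (R \<inter> S \<times> S)" using R_sym by (auto simp: sym_def)
    then show ?thesis using that sym_rtrancl by (meson symD)
  qed
  have mono_path: "(a, b) \<in> (R \<inter> T \<times> T)\<^sup>*" if "(a, b) \<in> (R \<inter> S \<times> S)\<^sup>*" "S \<subseteq> T" for a b S T
    using that(1) rtrancl_mono[of "R \<inter> S \<times> S" "R \<inter> T \<times> T"] that(2) by blast
  have B_path: "(p0, t) \<in> (R \<inter> B \<times> B)\<^sup>*" if "t \<in> B" for t
  proof -
    have "(p0, t) \<in> (R \<inter> M \<times> M)\<^sup>*" using that unfolding B_def by simp
    then show ?thesis
    proof induction
      case (step y z)
      then have "y \<in> B" "z \<in> B" unfolding B_def by (auto intro: rtrancl_into_rtrancl)
      then show ?case using step by (meson IntD1 IntI SigmaI rtrancl.rtrancl_into_rtrancl)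
    qed simp
  qed
  have B_conn: "connected_on B R"
    unfolding connected_on_def using B_path symM by (meson rtrancl_trans)
  have PB: "P \<subseteq> B"
  proof
    fix p assume "p \<in> P"
    have "P \<subseteq> M" using PD P(1) v unfolding M_def by blast
    moreover have "(p0, p) \<in> (R \<inter> P \<times> P)\<^sup>*"
      using P(2) p0 \<open>p \<in> P\<close> unfolding biconn_def connected_on_def by blast
    ultimately show "p \<in> B" unfolding B_def using mono_path by blast
  qed
  let ?Q' = "insert v B"
  have vB: "v \<notin> B" using BM unfolding M_def by blast
  have B_disj: "B \<inter> Qp = {}" using BM unfolding M_def Qp_def by blast
  \<comment> \<open>In \<open>Q - {x}\<close> a piece \<open>T\<close> of \<open>B\<close> is still
    joined to the far vertex \<open>q\<close>. An edge leaving \<open>T\<close> from a vertex off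
    the star would end in \<open>M\<close>, hence in \<open>T\<close> again, so it starts at a
    neighbour of \<open>v\<close>.\<close>
  have key: "\<exists>b\<in>T. (b, v) \<in> R" if T: "T \<subseteq> B" "t \<in> T" "x \<notin> Qp" "x \<notin> T"
      and Tc: "\<And>a b. a \<in> T \<Longrightarrow> (a, b) \<in> R \<Longrightarrow> b \<in> B \<Longrightarrow> b \<noteq> x \<Longrightarrow> b \<in> T" for T t x
  proof (rule ccontr)
    assume n: "\<not> ?thesis"
    have "t \<in> Q - {x}" using T BM unfolding M_def by blast
    moreover have "q \<in> Q - {x}" "q \<notin> T" using q qQ T B_disj by blast+
    moreover have "connected_on (Q - {x}) R" using Q(2) unfolding biconn_def by blast
    ultimately obtain c d where cd: "(c, d) \<in> R" "d \<in> Q - {x}" "c \<in> T" "d \<notin> T"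
      using connected_on_leave[of "Q - {x}" t q T] T by blast
    have cS: "c \<notin> ?S" using n cd vB T Rsym unfolding in_star by blast
    then have cD: "c \<in> D" using cd T BM unfolding M_def by blast
    have "d \<noteq> v" using cS cd Rsym in_star by blast
    then have "d \<in> M" using cd D_closed[OF cD cd(1) cS] unfolding M_def by blast
    then show False using cd Tc B_closed T by blast
  qed
  have conn': "connected_on (?Q' - {x}) R" for x
  proof (cases "x = v")
    case True
    then show ?thesis using B_conn vB by simp
  next
    case xv: False
    have to_v: "(t, v) \<in> (R \<inter> (?Q' - {x}) \<times> (?Q' - {x}))\<^sup>*" if t: "t \<in> ?Q' - {x}" for t
    proof (cases "t = v")
      case False
      define T where "T = {s \<in> B. s \<noteq> x \<and> (t, s) \<in> (R \<inter> (?Q' - {x}) \<times> (?Q' - {x}))\<^sup>*}"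
      have "\<exists>b\<in>T. (b, v) \<in> R"
      proof (cases "x \<in> Qp")
        case True
        then have "x \<notin> B" using B_disj by blast
        have "\<exists>b\<in>B. (b, v) \<in> R"
        proof (rule ccontr)
          assume "\<not> ?thesis"
          moreover have "v \<notin> Qp" unfolding Qp_def in_star by (simp add: in_star)
          ultimately show False using key[of B p0 v] p0 PB vB by blast
        qed
        then obtain b where b: "b \<in> B" "(b, v) \<in> R" by blast
        have "(t, b) \<in> (R \<inter> B \<times> B)\<^sup>*" using B_conn b t False unfolding connected_on_def by blast
        moreover have "B \<subseteq> ?Q' - {x}" using \<open>x \<notin> B\<close> by blast
        ultimately have "(t, b) \<in> (R \<inter> (?Q' - {x}) \<times> (?Q' - {x}))\<^sup>*"
          using mono_path by blast
        then show ?thesis using b \<open>x \<notin> B\<close> unfolding T_def by blast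
      next
        case x: False
        show ?thesis
        proof (rule key[of T t x])
          fix a b assume "a \<in> T" "(a, b) \<in> R" "b \<in> B" "b \<noteq> x"
          then show "b \<in> T" unfolding T_def by (auto intro: rtrancl_into_rtrancl)
        qed (use x t False in \<open>auto simp: T_def\<close>)
      qed
      then obtain b where b: "b \<in> B" "b \<noteq> x" "(t, b) \<in> (R \<inter> (?Q' - {x}) \<times> (?Q' - {x}))\<^sup>*" "(b, v) \<in> R"
        unfolding T_def by blast
      then have "(b, v) \<in> R \<inter> (?Q' - {x}) \<times> (?Q' - {x})" using xv by blast
      then show ?thesis using b(3) by (meson rtrancl.rtrancl_into_rtrancl)
    qed simp
    show ?thesis unfolding connected_on_def
    proof (intro ballI)
      fix a b assume ab: "a \<in> ?Q' - {x}" "b \<in> ?Q' - {x}"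
      show "(a, b) \<in> (R \<inter> (?Q' - {x}) \<times> (?Q' - {x}))\<^sup>*"
        using rtrancl_trans[OF to_v[OF ab(1)] symM[OF to_v[OF ab(2)]]] .
    qed
  qed
  have "connected_on ?Q' R"
  proof -
    have "q \<notin> ?Q'" using q B_disj qQ in_star by blast
    then show ?thesis using conn'[of q] by simp
  qed
  moreover have BQ: "B \<subseteq> Q" using BM unfolding M_def by blast
  then have finB: "finite B" using finQ finite_subset by blast
  moreover have "2 \<le> card ?Q'" 
  proof -
    have "card {v, p0} \<le> card ?Q'" using finB p0 PB by (intro card_mono) auto
    moreover have "v \<noteq> p0" using p0 v by blast
    ultimately show ?thesis by simp
  qed
  ultimately have "biconn ?Q'" unfolding biconn_def using conn' by blast
  moreover have "card ?Q' < card Q"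
  proof -
    have "card B + card Qp \<le> card Q"
    proof -
      have fp: "finite Qp" "Qp \<subseteq> Q" using finQ unfolding Qp_def by auto
      have "card B + card Qp = card (B \<union> Qp)" using card_Un_disjoint finB fp B_disj by metis
      also have "\<dots> \<le> card Q" using fp BQ finQ by (intro card_mono) auto
      finally show ?thesis .
    qed
    then show ?thesis using card_Qp finB vB by simp
  qed
  moreover have "v \<in> hull Q"
  proof (cases "v \<in> Q")
    case True then show ?thesis by (rule hull.base)
  next
    case vQ: False
    \<comment> \<open>The far side can be left only through the link of \<open>v\<close>. Taking
      first \<open>x = v\<close> and then the neighbour just found gives two neighbours of
      \<open>v\<close> in \<open>Q\<close>.\<close>
    have exit: "\<exists>d\<in>Q. d \<noteq> x \<and> (v, d) \<in> R" if "x \<notin> Qp" "x \<noteq> p0" for x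
    proof -
      have "connected_on (Q - {x}) R" using Q(2) unfolding biconn_def by blast
      moreover have "q \<in> Q - {x}" "p0 \<in> Q - {x}" "p0 \<notin> Qp"
        using q qQ that p0 P(1) p0D unfolding Qp_def by auto
      ultimately obtain c d where cd: "(c, d) \<in> R" "d \<in> Q - {x}" "c \<in> Qp" "d \<notin> Qp"
        using connected_on_leave[of "Q - {x}" q p0 Qp] q by blast
      then show ?thesis using Qp_nb[of c d] by blast
    qed
    have vp: "v \<notin> Qp" "v \<noteq> p0" using v p0 by (auto simp: Qp_def in_star)
    obtain a where a: "a \<in> Q" "(v, a) \<in> R" using exit[OF vp] by blast
    have "a \<notin> Qp" "a \<noteq> p0" using a p0 by (auto simp: Qp_def in_star)
    then obtain b where b: "b \<in> Q" "b \<noteq> a" "(v, b) \<in> R" using exit by blast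
    show ?thesis using hull.step[of v a Q b] a b v hull.base[of a Q] hull.base[of b Q] by blast
  qed
  ultimately show ?thesis using PB BQ by blast
qed

end

section \<open>Rigidity of tiled graphs\<close>

definition induced_emb :: "'x set \<Rightarrow> ('x \<times> 'x) set \<Rightarrow> 'y set \<Rightarrow> ('y \<times> 'y) set \<Rightarrow> ('x \<Rightarrow> 'y) \<Rightarrow> bool" where
  "induced_emb X R Y S f \<longleftrightarrow> f ` X \<subseteq> Y \<and> inj_on f X \<and> (\<forall>x\<in>X. \<forall>y\<in>X. (x, y) \<in> R \<longleftrightarrow> (f x, f y) \<in> S)"

lemma induced_emb_comp:
  "induced_emb X R Y S f \<Longrightarrow> induced_emb Y S Z T g \<Longrightarrow> induced_emb X R Z T (g \<circ> f)"
  unfolding induced_emb_def by (auto intro!: comp_inj_on intro: inj_on_subset) blast+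

lemma induced_emb_funpow: "induced_emb X R X R f \<Longrightarrow> induced_emb X R X R (f ^^ k)"
proof (induction k)
  case 0
  then show ?case by (auto simp: induced_emb_def)
next
  case (Suc k)
  then show ?case using induced_emb_comp[of X R X R "f ^^ k" X R f] by (simp add: comp_def)
qed

lemma induced_emb_connected_on:
  assumes "induced_emb X R Y S f" "A \<subseteq> X" "connected_on A R"
  shows "connected_on (f ` A) S"
  unfolding connected_on_def
proof (intro ballI)
  fix x y assume "x \<in> f ` A" "y \<in> f ` A"
  then obtain a b where ab: "x = f a" "y = f b" "a \<in> A" "b \<in> A" by blast
  then have "(a, b) \<in> (R \<inter> A \<times> A)\<^sup>*" using assms(3) unfolding connected_on_def by blast
  then have "(f a, f b) \<in> (S \<inter> f ` A \<times> f ` A)\<^sup>*"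
  proof induction
    case (step y z)
    then have "(f y, f z) \<in> S \<inter> f ` A \<times> f ` A"
      using assms(1,2) unfolding induced_emb_def by blast
    then show ?case using step by (meson rtrancl.rtrancl_into_rtrancl)
  qed simp
  then show "(x, y) \<in> (S \<inter> f ` A \<times> f ` A)\<^sup>*" using ab by simp
qed

lemma induced_emb_star:
  assumes "induced_emb X R Y S f" "A \<subseteq> X" "v \<in> X"
  shows "f ` A - closed_star S (f v) = f ` (A - closed_star R v)"
  using assms unfolding induced_emb_def closed_star_def neighbours_def inj_on_def by blast

text \<open>Transfers the star condition of atomic graphs, so a star that separates the image of a
  copy must be centred outside that image.\<close>

lemma induced_emb_star_connected:
  assumes "induced_emb X R Y S f" "A \<subseteq> X" "v \<in> A" "connected_on (A - closed_star R v) R"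
  shows "connected_on (f ` A - closed_star S (f v)) S"
proof -
  have "A - closed_star R v \<subseteq> X" "v \<in> X" using assms by blast+
  then show ?thesis
    using induced_emb_connected_on[OF assms(1) _ assms(4)] induced_emb_star[OF assms(1,2)] by simp
qed

lemma induced_emb_biconn:
  assumes "induced_emb X R Y S f" "A \<subseteq> X" "girth5_graph.biconn R A"
    "girth5_graph X R" "girth5_graph Y S"
  shows "girth5_graph.biconn S (f ` A)"
proof -
  interpret X: girth5_graph X R by fact
  interpret Y: girth5_graph Y S by fact
  have inj: "inj_on f A" using assms unfolding induced_emb_def by (meson inj_on_subset)
  have A: "finite A" "2 \<le> card A" "connected_on A R" "\<And>x. connected_on (A - {x}) R"
    using assms(3) unfolding X.biconn_def by auto
  have "connected_on (f ` A - {x}) S" for x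
  proof (cases "x \<in> f ` A")
    case True
    then obtain a where a: "a \<in> A" "x = f a" by blast
    then have "f ` A - {x} = f ` (A - {a})" using inj by (auto simp: inj_on_def)
    then show ?thesis using induced_emb_connected_on[OF assms(1) _ A(4)[of a]] assms(2) by auto
  next
    case False
    then have "f ` A - {x} = f ` A" by simp
    then show ?thesis using induced_emb_connected_on[OF assms(1,2) A(3)] by simp
  qed
  then show ?thesis
    unfolding Y.biconn_def using A inj induced_emb_connected_on[OF assms(1,2) A(3)]
    by (auto simp: card_image)
qed

lemma induced_emb_hull:
  assumes "induced_emb X R Y S f" "A \<subseteq> X" "girth5_graph X R" "girth5_graph Y S"
  shows "f ` girth5_graph.hull X R A \<subseteq> girth5_graph.hull Y S (f ` A)"
proof -
  interpret X: girth5_graph X R by fact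
  interpret Y: girth5_graph Y S by fact
  have "f h \<in> Y.hull (f ` A)" if "h \<in> X.hull A" for h
    using that
  proof induction
    case (base y)
    then show ?case by (blast intro: Y.hull.base)
  next
    case (step d l m)
    have "l \<in> X" "m \<in> X" using step X.R_sub by blast+
    then have "f d \<in> Y" "(f d, f l) \<in> S" "(f d, f m) \<in> S" "f l \<noteq> f m"
      using step assms(1) unfolding induced_emb_def inj_on_def by blast+
    then show ?case using step Y.hull.step by blast
  qed
  then show ?thesis by blast
qed

text \<open>The interface between rigidity and the extension graph. \<open>n\<close> is the common
  size of the copies and, by \<open>helly\<close>, a bound for all unseparated sets;
  \<open>copy_link\<close> says that no outside vertex sees two vertices of a copy.\<close>

locale tiled_graph = girth5_graph X R for X :: "'x set" and R +
  fixes copies :: "'x set set" and n :: nat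
  assumes copies_ne: "copies \<noteq> {}"
    and copy_sub: "\<And>C. C \<in> copies \<Longrightarrow> C \<subseteq> X"
    and copy_card: "\<And>C. C \<in> copies \<Longrightarrow> card C = n"
    and copy_biconn: "\<And>C. C \<in> copies \<Longrightarrow> biconn C"
    and copy_star: "\<And>C v. C \<in> copies \<Longrightarrow> v \<in> C \<Longrightarrow> connected_on (C - closed_star R v) R"
    and helly: "\<And>P. finite P \<Longrightarrow> P \<subseteq> X \<Longrightarrow> unsep P \<Longrightarrow> \<exists>C\<in>copies. P \<subseteq> C"
    and copy_link: "\<And>C d l m. C \<in> copies \<Longrightarrow> d \<in> X - C \<Longrightarrow> l \<in> C \<Longrightarrow> m \<in> C \<Longrightarrow>
      (d, l) \<in> R \<Longrightarrow> (d, m) \<in> R \<Longrightarrow> l = m"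
begin

lemma copy_finite: "C \<in> copies \<Longrightarrow> finite C"
  using copy_biconn unfolding biconn_def by blast

lemma unsep_card:
  assumes "finite P" "P \<subseteq> X" "unsep P"
  shows "card P \<le> n"
  using helly[OF assms] copy_card copy_finite by (metis card_mono)

lemma unsep_edge:
  assumes "(a, b) \<in> R"
  shows "unsep {a, b}"
  unfolding unsep_def
proof (intro ballI)
  fix v y z assume "y \<in> {a, b} - closed_star R v" "z \<in> {a, b} - closed_star R v"
  then have "y = z \<or> (y, z) \<in> off_star v" using assms Rsym off_star_edge by blast
  then show "(y, z) \<in> (off_star v)\<^sup>*" by blast
qed

lemma biconn_pair:
  assumes "(a, b) \<in> R"
  shows "biconn {a, b}"
proof -
  have "a \<noteq> b" using assms Rirr by blast
  moreover have "connected_on {a, b} R"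
    unfolding connected_on_def using assms Rsym by auto
  moreover have "connected_on ({a, b} - {x}) R" for x
  proof (cases "x = a \<or> x = b")
    case True
    then have "{a, b} - {x} = {b} \<or> {a, b} - {x} = {a}" using \<open>a \<noteq> b\<close> by auto
    moreover have "connected_on {c} R" for c by (simp add: connected_on_def)
    ultimately show ?thesis by metis
  next
    case False
    then have "{a, b} - {x} = {a, b}" by auto
    then show ?thesis using calculation(2) by metis
  qed
  ultimately show ?thesis unfolding biconn_def by simp
qed

text \<open>Call a set stable if all its iterated images are unseparated.  A largest stable set
  \<open>P\<close> lies in a copy \<open>C\<close>.  If the image of \<open>C\<close> were separated, cutting it along stars of
  vertices outside the image and keeping the part around \<open>P\<close> would produce a larger stable set.\<close>

theorem some_copy_image_unsep:
  assumes phi: "induced_emb X R X R \<phi>"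
  shows "\<exists>C\<in>copies. unsep (\<phi> ` C)"
proof -
  define stable where "stable P \<longleftrightarrow> P \<subseteq> X \<and> biconn P \<and> (\<forall>k. unsep ((\<phi> ^^ k) ` P))" for P
  note pk = induced_emb_funpow[OF phi]
  have pkX: "(\<phi> ^^ k) ` A \<subseteq> X" if "A \<subseteq> X" for k A
    using pk[of k] that unfolding induced_emb_def by blast
  have pk_inj: "inj_on (\<phi> ^^ k) A" if "A \<subseteq> X" for k A
    using pk[of k] that unfolding induced_emb_def by (meson inj_on_subset)
  have gX: "girth5_graph X R" by unfold_locales
  obtain C1 where C1: "C1 \<in> copies" using copies_ne by blast
  then have "C1 \<noteq> {}" using copy_biconn unfolding biconn_def by fastforce
  then obtain a where a: "a \<in> C1" by blast
  then obtain b where ab: "(a, b) \<in> R" using biconn_edge[OF copy_biconn[OF C1]] by blast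
  have "stable {a, b}"
    unfolding stable_def
  proof (intro conjI allI)
    show "{a, b} \<subseteq> X" using ab R_sub by blast
    show "biconn {a, b}" using biconn_pair[OF ab] .
    fix k
    have "((\<phi> ^^ k) a, (\<phi> ^^ k) b) \<in> R" using pk[of k] ab R_sub unfolding induced_emb_def by blast
    then show "unsep ((\<phi> ^^ k) ` {a, b})" using unsep_edge by simp
  qed
  moreover have st_fin: "finite P" if "stable P" for P
    using that unfolding stable_def biconn_def by blast
  have bound: "card P \<le> n" if "stable P" for P
  proof -
    have "unsep ((\<phi> ^^ 0) ` P)" "P \<subseteq> X" using that unfolding stable_def by blast+
    then show ?thesis using unsep_card[of P] st_fin[OF that] by simp
  qed
  ultimately have "\<exists>P. stable P \<and> (\<forall>P'. stable P' \<longrightarrow> card P' \<le> card P)"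
    by (intro ex_has_greatest_nat[of stable "{a, b}" card "Suc n"]) (auto simp: less_Suc_eq_le)
  then obtain P where P: "stable P" "\<And>P'. stable P' \<Longrightarrow> card P' \<le> card P" by blast
  have PX: "P \<subseteq> X" and Pb: "biconn P" and Pu: "\<And>k. unsep ((\<phi> ^^ k) ` P)"
    using P(1) unfolding stable_def by auto
  obtain C where C: "C \<in> copies" "P \<subseteq> C"
    using helly[of P] st_fin[OF P(1)] PX Pu[of 0] by auto
  note CX = copy_sub[OF C(1)]
  have "unsep (\<phi> ` C)"
  proof (rule ccontr)
    assume nu: "\<not> unsep (\<phi> ` C)"
    \<comment> \<open>\<open>tight\<close> places \<open>Q\<close> between the \<open>k\<close>-th
      image of \<open>P\<close> and the hull of the \<open>k\<close>-th image of \<open>C\<close>. A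
      \<open>good\<close> set moreover leaves the image of \<open>C\<close>, hence is strictly
      larger than the image of \<open>P\<close>.\<close>
    define tight where "tight k Q \<longleftrightarrow> Q \<subseteq> X \<and> biconn Q \<and> (\<phi> ^^ k) ` P \<subseteq> Q \<and> Q \<subseteq> hull ((\<phi> ^^ k) ` C)" for k Q
    define good where "good k Q \<longleftrightarrow> tight k Q \<and> \<not> Q \<subseteq> (\<phi> ^^ k) ` C" for k Q
    have Pkb: "biconn ((\<phi> ^^ k) ` P)" for k using induced_emb_biconn[OF pk PX Pb gX gX] .
    have cut_step: "\<exists>Q'. good k Q' \<and> card Q' < card Q" if Q: "tight k Q" "\<not> unsep Q" for k Q
    proof -
      obtain v y z where v: "v \<in> X" "y \<in> Q - closed_star R v" "z \<in> Q - closed_star R v"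
        "(y, z) \<notin> (off_star v)\<^sup>*" using Q(2) unfolding unsep_def by blast
      \<comment> \<open>A centre in the image of \<open>C\<close> separates neither that image nor
        its hull, which contains \<open>Q\<close>.\<close>
      have vY: "v \<notin> (\<phi> ^^ k) ` C"
      proof
        assume "v \<in> (\<phi> ^^ k) ` C"
        then obtain c where c: "c \<in> C" "v = (\<phi> ^^ k) c" by blast
        have "connected_on ((\<phi> ^^ k) ` C - closed_star R v) R"
          using induced_emb_star_connected[OF pk CX c(1) copy_star[OF C(1) c(1)]] c(2) by simp
        moreover have "y \<in> hull ((\<phi> ^^ k) ` C) - closed_star R v" "z \<in> hull ((\<phi> ^^ k) ` C) - closed_star R v"
          using v Q(1) unfolding tight_def by blast+
        ultimately show False using hull_unsep_at[OF v(1) pkX[OF CX]] v by blast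
      qed
      then have "v \<notin> (\<phi> ^^ k) ` P" using C by blast
      then obtain Q' where Q': "biconn Q'" "(\<phi> ^^ k) ` P \<subseteq> Q'" "v \<in> Q'" "Q' \<subseteq> insert v Q"
        "card Q' < card Q" "v \<in> hull Q"
        using cut[OF _ _ _ Pkb Pu v(1) _ v(2-4), of k] Q(1) unfolding tight_def by metis
      have hh: "hull Q \<subseteq> hull ((\<phi> ^^ k) ` C)"
      proof
        fix h assume "h \<in> hull Q"
        then show "h \<in> hull ((\<phi> ^^ k) ` C)"
        proof induction
          case (base y)
          then show ?case using Q(1) unfolding tight_def by blast
        next
          case (step d l m)
          then show ?case using hull.step by blast
        qed
      qed
      have "good k Q'"
        unfolding good_def tight_def
      proof (intro conjI)
        have Q2: "Q \<subseteq> X" "Q \<subseteq> hull ((\<phi> ^^ k) ` C)" using Q(1) unfolding tight_def by auto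
        show "Q' \<subseteq> X" using Q'(4) v(1) Q2(1) by blast
        show "Q' \<subseteq> hull ((\<phi> ^^ k) ` C)" using Q'(4,6) Q2(2) hh by blast
        show "\<not> Q' \<subseteq> (\<phi> ^^ k) ` C" using Q'(3) vY by blast
      qed (use Q' in auto)
      then show ?thesis using Q' by blast
    qed
    have "tight 1 (\<phi> ` C)"
      unfolding tight_def using pkX[OF CX, of 1] induced_emb_biconn[OF phi CX copy_biconn[OF C(1)] gX gX] C
      by (auto intro: hull.base)
    then obtain Q1 where "good 1 Q1" using cut_step nu by blast
    \<comment> \<open>Minimal over all levels at once: applying \<open>\<phi>\<close> raises the
      level, and a cut made there must still be compared with \<open>Q\<close>.\<close>
    then obtain k Q where kQ: "good k Q" and min: "\<And>k' Q'. good k' Q' \<Longrightarrow> card Q \<le> card Q'"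
      using ex_has_least_nat[of "\<lambda>(k, Q). good k Q" "(1, Q1)" "\<lambda>(k, Q). card Q"] by auto
    have QX: "Q \<subseteq> X" and Qb: "biconn Q" using kQ unfolding good_def tight_def by auto
    have g: "good (j + k) ((\<phi> ^^ j) ` Q)" for j
    proof -
      have eq: "(\<phi> ^^ (j + k)) ` A = (\<phi> ^^ j) ` (\<phi> ^^ k) ` A" for A
        by (simp add: funpow_add image_comp)
      have "(\<phi> ^^ j) ` Q \<subseteq> hull ((\<phi> ^^ (j + k)) ` C)"
        using induced_emb_hull[OF pk[of j] pkX[OF CX, of k] gX gX] kQ
        unfolding good_def tight_def eq by blast
      moreover have "\<not> (\<phi> ^^ j) ` Q \<subseteq> (\<phi> ^^ (j + k)) ` C"
      proof
        assume "(\<phi> ^^ j) ` Q \<subseteq> (\<phi> ^^ (j + k)) ` C"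
        then have sub: "(\<phi> ^^ j) ` Q \<subseteq> (\<phi> ^^ j) ` (\<phi> ^^ k) ` C" unfolding eq .
        have "q \<in> (\<phi> ^^ k) ` C" if "q \<in> Q" for q
          using inj_on_image_mem_iff[OF pk_inj[of X j] _ pkX[OF CX, of k], of q] that QX sub by blast
        then have "Q \<subseteq> (\<phi> ^^ k) ` C" by blast
        then show False using kQ unfolding good_def by blast
      qed
      moreover have "(\<phi> ^^ (j + k)) ` P \<subseteq> (\<phi> ^^ j) ` Q"
        using kQ unfolding good_def tight_def eq by (intro image_mono) auto
      ultimately show ?thesis
        using pkX[OF QX, of j] induced_emb_biconn[OF pk QX Qb gX gX, of j]
        unfolding good_def tight_def by simp
    qed
    \<comment> \<open>A separated iterated image could be cut to a good set smaller than
      \<open>Q\<close>, as injective images keep their size.\<close>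
    have "unsep ((\<phi> ^^ j) ` Q)" for j
    proof (rule ccontr)
      assume "\<not> ?thesis"
      moreover have "tight (j + k) ((\<phi> ^^ j) ` Q)" using g[of j] unfolding good_def by simp
      ultimately obtain Q' where "good (j + k) Q'" "card Q' < card ((\<phi> ^^ j) ` Q)"
        using cut_step by blast
      then show False using min[of "j + k" Q'] card_image[OF pk_inj[OF QX, of j]] by simp
    qed
    then have "stable Q" unfolding stable_def using QX Qb by blast
    then have le: "card Q \<le> card P" using P by blast
    have "(\<phi> ^^ k) ` P \<subset> Q" using kQ C unfolding good_def tight_def by blast
    then have "card ((\<phi> ^^ k) ` P) < card Q"
      using Qb unfolding biconn_def by (metis psubset_card_mono)
    then show False using le card_image[OF pk_inj[OF PX, of k]] by simp
  qed
  then show ?thesis using C by blast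
qed

end

text \<open>\<open>C\<close> is chosen for the composite, which maps it onto a whole copy
  \<open>C'\<close> by counting. If a star separated the image of \<open>C\<close> under
  \<open>f\<close>, its centre \<open>d\<close> would lie outside and have two neighbours in it;
  then \<open>g d\<close>, outside \<open>C'\<close>, would see two vertices of \<open>C'\<close>,
  against \<open>copy_link\<close>.\<close>

lemma tiled_graph_copy_into_copy:
  assumes X: "tiled_graph X R \<C> n" and Y: "tiled_graph Y S \<D> m"
    and f: "induced_emb X R Y S f" and g: "induced_emb Y S X R g"
  shows "\<exists>C\<in>\<C>. \<exists>D\<in>\<D>. f ` C \<subseteq> D"
proof -
  interpret X: tiled_graph X R \<C> n by fact
  interpret Y: tiled_graph Y S \<D> m by fact
  have gX: "girth5_graph X R" and gY: "girth5_graph Y S" by unfold_locales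
  obtain C where C: "C \<in> \<C>" "X.unsep ((g \<circ> f) ` C)"
    using X.some_copy_image_unsep[OF induced_emb_comp[OF f g]] by blast
  note CX = X.copy_sub[OF C(1)]
  have fC: "f ` C \<subseteq> Y" using f CX unfolding induced_emb_def by blast
  have finC: "finite C" using X.copy_finite[OF C(1)] .
  have b: "Y.biconn (f ` C)" using induced_emb_biconn[OF f CX X.copy_biconn[OF C(1)] gX gY] .
  have "(g \<circ> f) ` C \<subseteq> X" using CX induced_emb_comp[OF f g] unfolding induced_emb_def by blast
  then obtain C' where C': "C' \<in> \<C>" "(g \<circ> f) ` C \<subseteq> C'" using X.helly[OF _ _ C(2)] finC by blast
  have "inj_on (g \<circ> f) C" using induced_emb_comp[OF f g] CX unfolding induced_emb_def by (meson inj_on_subset)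
  then have "card ((g \<circ> f) ` C) = card C'" using C' C X.copy_card card_image by metis
  then have eq: "(g \<circ> f) ` C = C'" using C' X.copy_finite by (metis card_subset_eq)
  have "Y.unsep (f ` C)"
  proof (rule ccontr)
    assume "\<not> ?thesis"
    then obtain d y z where d: "d \<in> Y" "y \<in> f ` C - closed_star S d" "z \<in> f ` C - closed_star S d"
        "(y, z) \<notin> (Y.off_star d)\<^sup>*" unfolding Y.unsep_def by blast
    have dn: "d \<notin> f ` C"
    proof
      assume "d \<in> f ` C"
      then obtain c where c: "c \<in> C" "d = f c" by blast
      have "connected_on (f ` C - closed_star S d) S"
        using induced_emb_star_connected[OF f CX c(1) X.copy_star[OF C(1) c(1)]] c(2) by simp
      then show False using Y.off_star_connected_on[OF _ fC] d by blast
    qed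
    \<comment> \<open>Used with \<open>x = d\<close>, which deletes nothing, and then with the
      neighbour found, to get two neighbours of \<open>d\<close>.\<close>
    have exit: "\<exists>w\<in>f ` C. w \<noteq> x \<and> (d, w) \<in> S" if x: "x \<noteq> y" "x \<noteq> z" for x
    proof -
      define T where "T = {t. (y, t) \<in> (Y.off_star d)\<^sup>*}"
      have "connected_on (f ` C - {x}) S" using b unfolding Y.biconn_def by blast
      then obtain a w where aw: "(a, w) \<in> S" "a \<in> f ` C" "w \<in> f ` C - {x}" "a \<in> T" "w \<notin> T"
        using Y.connected_on_leave[of "f ` C - {x}" y z T] d x unfolding T_def by blast
      have "a \<notin> closed_star S d"
      proof -
        have "(y, a) \<in> (Y.off_star d)\<^sup>*" using aw T_def by simp
        then show ?thesis by (cases rule: rtranclE) (use d in \<open>auto simp: Y.off_star_def\<close>)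
      qed
      then have "w \<in> closed_star S d"
        using aw Y.off_star_edge[of a w d] unfolding T_def by (auto intro: rtrancl_into_rtrancl)
      then show ?thesis using aw dn unfolding Y.in_star by blast
    qed
    have "y \<noteq> d" "z \<noteq> d" using d(2,3) by (auto simp: Y.in_star)
    then obtain a where a: "a \<in> f ` C" "(d, a) \<in> S" using exit[of d] by blast
    then have "a \<noteq> y" "a \<noteq> z" using d(2,3) by (auto simp: Y.in_star)
    then obtain w where w: "w \<in> f ` C" "w \<noteq> a" "(d, w) \<in> S" using exit[of a] by blast
    have "a \<in> Y" "w \<in> Y" using a w fC by blast+
    moreover have gi: "\<And>x y. x \<in> Y \<Longrightarrow> y \<in> Y \<Longrightarrow> (x, y) \<in> S \<longleftrightarrow> (g x, g y) \<in> R" "inj_on g Y"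
      using g unfolding induced_emb_def by auto
    ultimately have "(g d, g a) \<in> R" "(g d, g w) \<in> R" "g a \<noteq> g w"
      using a w d(1) gi(1)[of d a] gi(1)[of d w] inj_onD[OF gi(2), of a w] by auto
    moreover have "g a \<in> C'" "g w \<in> C'" using eq a w by (auto simp: image_comp[symmetric])
    moreover have "g d \<in> X - C'"
    proof -
      have "g d \<notin> g ` f ` C" using inj_on_image_mem_iff[OF gi(2) d(1) fC] dn by simp
      moreover have "g d \<in> X" using g d(1) unfolding induced_emb_def by blast
      ultimately show ?thesis using eq by (auto simp: image_comp)
    qed
    ultimately show False using X.copy_link[OF C'(1)] by blast
  qed
  then show ?thesis using Y.helly[of "f ` C"] finC fC C by blast
qed

section \<open>Words and right-angled Artin groups\<close>

type_synonym 'a word = "('a \<times> bool) list"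

lemma words_simps [simp]:
  "[] \<in> words V" "l # w \<in> words V \<longleftrightarrow> fst l \<in> V \<and> w \<in> words V"
  "u @ v \<in> words V \<longleftrightarrow> u \<in> words V \<and> v \<in> words V" "w \<in> words UNIV"
  by (auto simp: words_def mem_Times_iff)

lemma words_mono: "A \<subseteq> B \<Longrightarrow> w \<in> words A \<Longrightarrow> w \<in> words B"
  by (auto simp: words_def)

lemma raag_eq_words:
  assumes "raag_eq V E u v" "E \<subseteq> V \<times> V"
  shows "u \<in> words V \<and> v \<in> words V"
  using assms by induction auto

lemma raag_eq_context:
  assumes "raag_eq V E u v" "x \<in> words V" "y \<in> words V"
  shows "raag_eq V E (x @ u @ y) (x @ v @ y)"
  using assms
proof induction
  case (refl w)
  then show ?case by (intro raag_eq.refl) simp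
next
  case (sym w w')
  then show ?case by (blast intro: raag_eq.sym)
next
  case (trans u v w)
  then show ?case by (blast intro: raag_eq.trans)
next
  case (cancel xs ys z b)
  then show ?case using raag_eq.cancel[of "x @ xs" V "ys @ y" z E b] by simp
next
  case (commute xs ys u v)
  then show ?case using raag_eq.commute[of "x @ xs" V "ys @ y" u v E] by simp
qed

lemma raag_eq_append:
  assumes "raag_eq V E u u'" "raag_eq V E v v'" "E \<subseteq> V \<times> V"
  shows "raag_eq V E (u @ v) (u' @ v')"
proof -
  have w: "u \<in> words V" "v' \<in> words V" "u' \<in> words V"
    using assms raag_eq_words by metis+
  have "raag_eq V E (u @ v) (u @ v')" using raag_eq_context[OF assms(2) w(1), of "[]"] by simp
  moreover have "raag_eq V E (u @ v') (u' @ v')" using raag_eq_context[OF assms(1) _ w(2), of "[]"] by simp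
  ultimately show ?thesis by (rule raag_eq.trans)
qed

lemma raag_eq_mono:
  assumes "raag_eq V E u v" "V \<subseteq> V'" "E \<subseteq> E'"
  shows "raag_eq V' E' u v"
  using assms(1)
proof induction
  case (cancel xs ys x b)
  then show ?case using assms words_mono by (intro raag_eq.cancel) auto
next
  case (commute xs ys u v)
  then show ?case using assms words_mono by (intro raag_eq.commute) auto
qed (use assms words_mono in \<open>blast intro: raag_eq.refl raag_eq.sym raag_eq.trans\<close>)+

definition flip :: "'a \<times> bool \<Rightarrow> 'a \<times> bool" where
  "flip l = (fst l, \<not> snd l)"

definition winv :: "'a word \<Rightarrow> 'a word" where
  "winv w = rev (map flip w)"

lemma flip_simps [simp]: "fst (flip l) = fst l" "snd (flip l) = (\<not> snd l)" "flip (flip l) = l"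
  "flip l \<noteq> l" "l \<noteq> flip l"
  by (auto simp: flip_def prod_eq_iff)

lemma same_vertex_cases: "fst l = fst a \<Longrightarrow> l = a \<or> l = flip a"
  by (auto simp: flip_def prod_eq_iff)

lemma winv_simps [simp]: "winv [] = []" "winv (l # w) = winv w @ [flip l]"
  "winv (u @ v) = winv v @ winv u" "winv (winv w) = w" "length (winv w) = length w"
  by (auto simp: winv_def rev_map comp_def)

lemma winv_words [simp]: "winv w \<in> words V \<longleftrightarrow> w \<in> words V"
  by (induction w) auto

lemma raag_eq_winv: "w \<in> words V \<Longrightarrow> raag_eq V E (w @ winv w) []"
proof (induction w)
  case Nil
  then show ?case by (auto intro: raag_eq.refl)
next
  case (Cons l w)
  then have "raag_eq V E ([l] @ (w @ winv w) @ [flip l]) ([l] @ [] @ [flip l])"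
    by (intro raag_eq_context) auto
  moreover have "raag_eq V E ([] @ [(fst l, snd l), (fst l, \<not> snd l)] @ []) ([] @ [])"
    using Cons by (intro raag_eq.cancel) auto
  ultimately show ?case by (auto intro: raag_eq.trans simp: flip_def)
qed

lemma raag_class_eq_iff:
  assumes "u \<in> words V" "v \<in> words V"
  shows "raag_class V E u = raag_class V E v \<longleftrightarrow> raag_eq V E u v"
  using assms unfolding raag_class_def
  by (auto intro: raag_eq.refl raag_eq.sym raag_eq.trans)

lemma raag_carrier: "carrier (raag V E) = raag_class V E ` words V"
  by (simp add: raag_def)

lemma raag_one: "\<one>\<^bsub>raag V E\<^esub> = raag_class V E []"
  by (simp add: raag_def)

lemma raag_mult:
  assumes "u \<in> words V" "v \<in> words V" "E \<subseteq> V \<times> V"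
  shows "raag_class V E u \<otimes>\<^bsub>raag V E\<^esub> raag_class V E v = raag_class V E (u @ v)"
proof -
  have "raag_eq V E (u @ v) w"
    if "raag_eq V E u a" "raag_eq V E v b" "raag_eq V E (a @ b) w" for a b w
    using raag_eq_append[OF that(1,2) assms(3)] that(3) by (rule raag_eq.trans)
  moreover have "\<exists>a. raag_eq V E u a \<and> (\<exists>b. raag_eq V E v b \<and> raag_eq V E (a @ b) w)"
    if "raag_eq V E (u @ v) w" for w
    using that assms raag_eq.refl by blast
  ultimately show ?thesis unfolding raag_def raag_class_def by auto
qed

lemma raag_group:
  assumes "E \<subseteq> V \<times> V"
  shows "group (raag V E)"
proof (rule groupI)
  show "x \<otimes>\<^bsub>raag V E\<^esub> y \<in> carrier (raag V E)"
    if "x \<in> carrier (raag V E)" "y \<in> carrier (raag V E)" for x y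
    using that assms by (auto simp: raag_carrier raag_mult)
  show "\<one>\<^bsub>raag V E\<^esub> \<in> carrier (raag V E)" by (simp add: raag_carrier raag_one)
  show "x \<otimes>\<^bsub>raag V E\<^esub> y \<otimes>\<^bsub>raag V E\<^esub> z = x \<otimes>\<^bsub>raag V E\<^esub> (y \<otimes>\<^bsub>raag V E\<^esub> z)"
    if "x \<in> carrier (raag V E)" "y \<in> carrier (raag V E)" "z \<in> carrier (raag V E)" for x y z
    using that assms by (auto simp: raag_carrier raag_mult)
  show "\<one>\<^bsub>raag V E\<^esub> \<otimes>\<^bsub>raag V E\<^esub> x = x" if "x \<in> carrier (raag V E)" for x
    using that assms by (auto simp: raag_carrier raag_mult raag_one)
  show "\<exists>y\<in>carrier (raag V E). y \<otimes>\<^bsub>raag V E\<^esub> x = \<one>\<^bsub>raag V E\<^esub>" if x: "x \<in> carrier (raag V E)" for x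
  proof -
    obtain w where w: "w \<in> words V" "x = raag_class V E w" using x by (auto simp: raag_carrier)
    have "raag_eq V E (winv w @ w) []" using raag_eq_winv[of "winv w" V E] w by simp
    then have "raag_class V E (winv w) \<otimes>\<^bsub>raag V E\<^esub> x = \<one>\<^bsub>raag V E\<^esub>"
      using w assms by (simp add: raag_mult raag_one raag_class_eq_iff)
    then show ?thesis using w by (auto simp: raag_carrier)
  qed
qed

definition restrict_word :: "'a set \<Rightarrow> 'a word \<Rightarrow> 'a word" where
  "restrict_word S w = filter (\<lambda>l. fst l \<in> S) w"

lemma restrict_word_simps [simp]: "restrict_word S [] = []"
  "restrict_word S (u @ v) = restrict_word S u @ restrict_word S v"
  "restrict_word S (l # w) = (if fst l \<in> S then l # restrict_word S w else restrict_word S w)"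
  by (auto simp: restrict_word_def)

lemma restrict_word_words: "w \<in> words V \<Longrightarrow> restrict_word S w \<in> words (V \<inter> S)"
  by (auto simp: restrict_word_def words_def)

lemma restrict_word_id: "w \<in> words S \<Longrightarrow> restrict_word S w = w"
  by (induction w) auto

text \<open>Deleting the letters outside \<open>S\<close> keeps each relation or makes it trivial:
  this is the retraction onto the subgroup of an induced subgraph.\<close>

lemma raag_eq_restrict:
  assumes "raag_eq U E u v" "U \<inter> S \<subseteq> V" "E \<subseteq> U \<times> U"
  shows "raag_eq V (E \<inter> S \<times> S) (restrict_word S u) (restrict_word S v)"
  using assms
proof induction
  case (refl w)
  then show ?case using restrict_word_words words_mono by (blast intro: raag_eq.refl)
next
  case (sym w w')
  then show ?case by (blast intro: raag_eq.sym)
next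
  case (trans u v w)
  then show ?case by (blast intro: raag_eq.trans)
next
  case (cancel xs ys z b)
  have w: "restrict_word S xs \<in> words V" "restrict_word S ys \<in> words V"
    using cancel restrict_word_words words_mono by blast+
  then show ?case
    using cancel raag_eq.cancel[OF w, of z] by (auto intro: raag_eq.refl)
next
  case (commute xs ys u v)
  have w: "restrict_word S xs \<in> words V" "restrict_word S ys \<in> words V"
    using commute restrict_word_words words_mono by blast+
  show ?case
  proof (cases "u \<in> S \<and> v \<in> S")
    case True
    then show ?thesis using commute raag_eq.commute[OF w, of u v "E \<inter> S \<times> S"] by simp
  next
    case False
    have uv: "u \<in> U" "v \<in> U" using commute by blast+
    have "restrict_word S (xs @ [(u, True), (v, True)] @ ys) = restrict_word S (xs @ [(v, True), (u, True)] @ ys)"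
      using False by simp
    moreover have "restrict_word S (xs @ [(v, True), (u, True)] @ ys) \<in> words V"
      using w uv commute.prems by auto
    ultimately show ?thesis by (metis raag_eq.refl)
  qed
qed

section \<open>Half-spaces of the Cayley graph\<close>

definition exponent :: "'a \<Rightarrow> 'a word \<Rightarrow> int" where
  "exponent s w = (\<Sum>l\<leftarrow>w. if fst l = s then (if snd l then 1 else - 1) else 0)"

lemma exponent_simps [simp]: "exponent s [] = 0"
  "exponent s (l # w) = (if fst l = s then (if snd l then 1 else - 1) else 0) + exponent s w"
  "exponent s (u @ v) = exponent s u + exponent s v"
  by (auto simp: exponent_def)

lemma exponent_winv [simp]: "exponent s (winv w) = - exponent s w"
  by (induction w) auto

lemma exponent_notin: "w \<in> words S \<Longrightarrow> s \<notin> S \<Longrightarrow> exponent s w = 0"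
  by (induction w) auto

lemma exponent_replicate: "exponent s (replicate k (s, b)) = (if b then int k else - int k)"
  by (induction k) auto

lemma exponent_raag_eq: "raag_eq V E u v \<Longrightarrow> exponent s u = exponent s v"
  by (induction rule: raag_eq.induct) auto

text \<open>\<open>G\<close> has a generator for every element of the type of vertices, so that words need no side
  condition; the group of a graph on \<open>V\<close> is its subgroup \<open>sg V\<close>.\<close>

locale raag_geometry =
  fixes E :: "('a \<times> 'a) set" and G :: "'a word set monoid" (structure)
  assumes symE: "sym E" and irreflE: "irrefl E" and G_def: "G = raag UNIV E"
begin

sublocale group G
  unfolding G_def by (rule raag_group) simp

abbreviation Lk :: "'a \<Rightarrow> 'a set" where "Lk \<equiv> neighbours E"
abbreviation St :: "'a \<Rightarrow> 'a set" where "St \<equiv> closed_star E"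

lemma E_sym: "(a, b) \<in> E \<Longrightarrow> (b, a) \<in> E"
  using symE by (meson symD)

lemma E_irr: "(a, a) \<notin> E"
  using irreflE by (simp add: irrefl_def)

lemma Lk_iff: "b \<in> Lk a \<longleftrightarrow> (a, b) \<in> E"
  by (simp add: neighbours_def)

lemma St_iff: "b \<in> St a \<longleftrightarrow> b = a \<or> (a, b) \<in> E"
  by (simp add: closed_star_def Lk_iff)

definition cl :: "'a word \<Rightarrow> 'a word set" where
  "cl w = raag_class UNIV E w"

definition gen :: "'a \<times> bool \<Rightarrow> 'a word set" where
  "gen l = cl [l]"

definition sg :: "'a set \<Rightarrow> 'a word set set" where
  "sg S = cl ` words S"

lemma cl_carrier [simp]: "cl w \<in> carrier G"
  by (simp add: G_def cl_def raag_carrier)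

lemma gen_carrier [simp]: "gen l \<in> carrier G"
  by (simp add: gen_def)

lemma cl_eq_iff: "cl u = cl v \<longleftrightarrow> raag_eq UNIV E u v"
  by (simp add: cl_def raag_class_eq_iff)

lemma cl_append [simp]: "cl (u @ v) = cl u \<otimes> cl v"
  by (simp add: cl_def G_def raag_mult)

lemma cl_Nil [simp]: "cl [] = \<one>"
  by (simp add: cl_def G_def raag_one)

lemma cl_Cons [simp]: "cl (l # w) = gen l \<otimes> cl w"
  using cl_append[of "[l]" w] by (simp add: gen_def del: cl_append)

lemma cl_winv [simp]: "cl (winv w) = inv (cl w)"
proof -
  have "cl (winv w) \<otimes> cl w = \<one>"
    using raag_eq_winv[of "winv w" UNIV E] cl_append[of "winv w" w] cl_eq_iff[of "winv w @ w" "[]"] by simp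
  then show ?thesis by (simp add: inv_equality)
qed

lemma gen_flip [simp]: "gen (flip l) = inv (gen l)"
  using cl_winv[of "[l]"] by (simp del: cl_winv)

lemma carrier_cl: "x \<in> carrier G \<Longrightarrow> \<exists>w. x = cl w"
  by (auto simp: G_def cl_def raag_carrier)

lemma cancel1 [simp]: "x \<in> carrier G \<Longrightarrow> y \<in> carrier G \<Longrightarrow> inv x \<otimes> (x \<otimes> y) = y"
  by (simp add: m_assoc[symmetric])

lemma cancel2 [simp]: "x \<in> carrier G \<Longrightarrow> y \<in> carrier G \<Longrightarrow> x \<otimes> (inv x \<otimes> y) = y"
  by (simp add: m_assoc[symmetric])

lemma sg_sub: "sg S \<subseteq> carrier G"
  by (auto simp: sg_def)

lemma sg_carrier [simp]: "x \<in> sg S \<Longrightarrow> x \<in> carrier G"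
  using sg_sub by blast

lemma cl_sg: "w \<in> words S \<Longrightarrow> cl w \<in> sg S"
  by (auto simp: sg_def)

lemma gen_sg: "fst l \<in> S \<Longrightarrow> gen l \<in> sg S"
  unfolding gen_def by (rule cl_sg) simp

lemma sg_one [simp]: "\<one> \<in> sg S"
  using cl_sg[of "[]"] by simp

lemma sg_mult: "x \<in> sg S \<Longrightarrow> y \<in> sg S \<Longrightarrow> x \<otimes> y \<in> sg S"
proof -
  assume "x \<in> sg S" "y \<in> sg S"
  then obtain u v where "u \<in> words S" "v \<in> words S" "x = cl u" "y = cl v" unfolding sg_def by blast
  then show ?thesis using cl_sg[of "u @ v" S] by simp
qed

lemma sg_inv: "x \<in> sg S \<Longrightarrow> inv x \<in> sg S"
proof -
  assume "x \<in> sg S"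
  then obtain u where "u \<in> words S" "x = cl u" unfolding sg_def by blast
  then show ?thesis using cl_sg[of "winv u" S] by simp
qed

lemma sg_mult_cancel_right: "x \<in> carrier G \<Longrightarrow> y \<in> sg S \<Longrightarrow> x \<otimes> y \<in> sg S \<longleftrightarrow> x \<in> sg S"
  using sg_mult[of "x \<otimes> y" S "inv y"] sg_mult[of x S y] sg_inv[of y S] by (auto simp: m_assoc)

lemma sg_mult_cancel_left: "x \<in> sg S \<Longrightarrow> y \<in> carrier G \<Longrightarrow> x \<otimes> y \<in> sg S \<longleftrightarrow> y \<in> sg S"
  using sg_mult[of "inv x" S "x \<otimes> y"] sg_mult[of x S y] sg_inv[of x S] by auto

lemma sg_mono: "A \<subseteq> B \<Longrightarrow> sg A \<subseteq> sg B"
  unfolding sg_def using words_mono by blast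

lemma cl_restrict:
  assumes "cl u = cl v"
  shows "cl (restrict_word S u) = cl (restrict_word S v)"
proof -
  have "raag_eq UNIV (E \<inter> S \<times> S) (restrict_word S u) (restrict_word S v)"
    using raag_eq_restrict[of UNIV E u v S UNIV] assms cl_eq_iff by simp
  then have "raag_eq UNIV E (restrict_word S u) (restrict_word S v)" by (rule raag_eq_mono) auto
  then show ?thesis by (simp add: cl_eq_iff)
qed

lemma cl_in_sg_iff: "cl w \<in> sg S \<longleftrightarrow> cl w = cl (restrict_word S w)"
proof
  assume "cl w \<in> sg S"
  then obtain u where "u \<in> words S" "cl w = cl u" unfolding sg_def by blast
  then show "cl w = cl (restrict_word S w)" using cl_restrict[of w u S] restrict_word_id[of u S] by simp
next
  assume "cl w = cl (restrict_word S w)"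
  then show "cl w \<in> sg S" using cl_sg[of "restrict_word S w" S] restrict_word_words[of w UNIV S] by simp
qed

text \<open>The retraction onto \<open>B\<close> fixes \<open>x\<close> and turns a word over
  \<open>A\<close> into one over \<open>A \<inter> B\<close>.\<close>

lemma sg_inter:
  assumes "x \<in> sg A" "x \<in> sg B"
  shows "x \<in> sg (A \<inter> B)"
proof -
  obtain w where w: "w \<in> words A" "x = cl w" using assms unfolding sg_def by blast
  then have "x = cl (restrict_word B w)" using assms cl_in_sg_iff by blast
  then show ?thesis using cl_sg restrict_word_words w by metis
qed

text \<open>The exponent sum does not depend on the chosen word. It vanishes on commutators and on
  subgroups without \<open>s\<close>, and so recognises non-trivial powers of
  \<open>s\<close>.\<close>

definition expo :: "'a \<Rightarrow> 'a word set \<Rightarrow> int" where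
  "expo s x = exponent s (SOME w. cl w = x)"

lemma expo_cl [simp]: "expo s (cl w) = exponent s w"
proof -
  have "cl (SOME u. cl u = cl w) = cl w" by (rule someI[of "\<lambda>u. cl u = cl w" w]) simp
  then show ?thesis unfolding expo_def using cl_eq_iff exponent_raag_eq by metis
qed

lemma expo_mult [simp]: "x \<in> carrier G \<Longrightarrow> y \<in> carrier G \<Longrightarrow> expo s (x \<otimes> y) = expo s x + expo s y"
  using carrier_cl cl_append expo_cl exponent_simps(3) by metis

lemma expo_inv [simp]: "x \<in> carrier G \<Longrightarrow> expo s (inv x) = - expo s x"
  using carrier_cl cl_winv expo_cl exponent_winv by metis

lemma expo_notin: "x \<in> sg S \<Longrightarrow> s \<notin> S \<Longrightarrow> expo s x = 0"
  unfolding sg_def using exponent_notin by fastforce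

lemma commute_inv:
  assumes "x \<otimes> y = y \<otimes> x" "x \<in> carrier G" "y \<in> carrier G"
  shows "inv y \<otimes> x = x \<otimes> inv y"
proof -
  have "inv y \<otimes> x = inv y \<otimes> (x \<otimes> y) \<otimes> inv y" using assms(2,3) by (simp add: m_assoc)
  then show ?thesis unfolding assms(1) using assms(2,3) by (simp add: m_assoc)
qed

text \<open>The relation is imposed on positive letters only; mixed signs follow by
  \<open>commute_inv\<close>.\<close>

lemma gen_commute: "(fst l, fst m) \<in> E \<or> fst l = fst m \<Longrightarrow> gen l \<otimes> gen m = gen m \<otimes> gen l"
proof -
  assume a: "(fst l, fst m) \<in> E \<or> fst l = fst m"
  have pos: "gen (u, True) \<otimes> gen (v, True) = gen (v, True) \<otimes> gen (u, True)" if "(u, v) \<in> E" for u v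
    using raag_eq.commute[of "[]" UNIV "[]" u v E] that cl_eq_iff[of "[(u, True), (v, True)]" "[(v, True), (u, True)]"]
    by simp
  have gF: "gen (u, False) = inv (gen (u, True))" for u
    using gen_flip[of "(u, True)"] by (simp add: flip_def)
  obtain u b v c where [simp]: "l = (u, b)" "m = (v, c)" by (cases l, cases m)
  show ?thesis
  proof (cases "u = v")
    case True
    then show ?thesis by (cases b; cases c) (simp_all add: gF)
  next
    case False
    then have p: "gen (u, True) \<otimes> gen (v, True) = gen (v, True) \<otimes> gen (u, True)" using a pos by simp
    note q = commute_inv[OF p] commute_inv[OF p[symmetric]]
    show ?thesis
      using p q commute_inv[of "inv (gen (u, True))" "gen (v, True)"] by (cases b; cases c) (simp_all add: gF)
  qed
qed

lemma sg_commute: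
  assumes "x \<in> sg A" "y \<in> sg B" "\<And>a b. a \<in> A \<Longrightarrow> b \<in> B \<Longrightarrow> (a, b) \<in> E \<or> a = b"
  shows "x \<otimes> y = y \<otimes> x"
proof -
  obtain u v where uv: "u \<in> words A" "v \<in> words B" "x = cl u" "y = cl v"
    using assms(1,2) unfolding sg_def by blast
  have 1: "gen l \<otimes> cl v = cl v \<otimes> gen l" if "fst l \<in> A" for l
    using uv(2)
  proof (induction v)
    case (Cons m v)
    have "gen l \<otimes> cl (m # v) = (gen l \<otimes> gen m) \<otimes> cl v" by (simp add: m_assoc)
    also have "\<dots> = gen m \<otimes> (gen l \<otimes> cl v)" using gen_commute[of l m] assms(3) that Cons by (simp add: m_assoc)
    also have "\<dots> = gen m \<otimes> (cl v \<otimes> gen l)" using Cons by simp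
    finally show ?case by (simp add: m_assoc)
  qed simp
  have "cl u \<otimes> cl v = cl v \<otimes> cl u" using uv(1)
  proof (induction u)
    case (Cons m u)
    have "cl (m # u) \<otimes> cl v = gen m \<otimes> (cl u \<otimes> cl v)" by (simp add: m_assoc)
    also have "\<dots> = (gen m \<otimes> cl v) \<otimes> cl u" using Cons by (simp add: m_assoc)
    also have "\<dots> = cl v \<otimes> (gen m \<otimes> cl u)" using 1[of m] Cons by (simp add: m_assoc)
    finally show ?case by simp
  qed simp
  then show ?thesis using uv by simp
qed

lemma sg_Lk_commute: "t \<in> sg (Lk s) \<Longrightarrow> x \<in> sg {s} \<Longrightarrow> t \<otimes> x = x \<otimes> t"
  by (rule sg_commute[of _ "Lk s" _ "{s}"]) (auto simp: Lk_iff E_sym)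

lemma sg_Lk_gen_commute: "t \<in> sg (Lk (fst a)) \<Longrightarrow> t \<otimes> gen a = gen a \<otimes> t"
  by (rule sg_Lk_commute[OF _ gen_sg]) simp_all

text \<open>The link subgroup commutes with \<open>gen a\<close>, so conjugating back changes
  nothing. It serves to erase a letter together with a later inverse.\<close>

lemma conj_gen_Lk:
  assumes "y \<in> carrier G" "gen a \<otimes> y \<otimes> inv (gen a) \<in> sg (Lk (fst a))"
  shows "gen a \<otimes> y \<otimes> inv (gen a) = y"
proof -
  let ?t = "gen a \<otimes> y \<otimes> inv (gen a)"
  have "?t \<otimes> gen a = gen a \<otimes> ?t" using sg_Lk_gen_commute[OF assms(2)] .
  then have "gen a \<otimes> y = gen a \<otimes> ?t" using assms(1) by (simp add: m_assoc)
  then have "inv (gen a) \<otimes> (gen a \<otimes> y) = inv (gen a) \<otimes> (gen a \<otimes> ?t)" by (rule arg_cong)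
  then show ?thesis using assms(1) by simp
qed

text \<open>The edges from \<open>h\<close> to \<open>h a\<close> with \<open>h\<close> in the subgroup generated by the link of \<open>a\<close> form a
  hyperplane of the Cayley graph; \<open>crossings a x w\<close> counts with sign how often the path from \<open>x\<close> labelled
  \<open>w\<close> crosses it.  As a cocycle it is invariant under the defining relations, so no normal form is
  needed to see that the hyperplane separates.\<close>

fun crossings :: "'a \<times> bool \<Rightarrow> 'a word set \<Rightarrow> 'a word \<Rightarrow> int" where
  "crossings a x [] = 0"
| "crossings a x (l # w) =
    (if l = a \<and> x \<in> sg (Lk (fst a)) then 1
     else if l = flip a \<and> x \<otimes> gen l \<in> sg (Lk (fst a)) then - 1 else 0) + crossings a (x \<otimes> gen l) w"

lemma crossings_append:
  "x \<in> carrier G \<Longrightarrow> crossings a x (u @ v) = crossings a x u + crossings a (x \<otimes> cl u) v"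
  by (induction u arbitrary: x) (auto simp: m_assoc)

lemma crossings_mid:
  "x \<in> carrier G \<Longrightarrow> crossings a x (u @ m @ v) =
    crossings a x u + crossings a (x \<otimes> cl u) m + crossings a (x \<otimes> cl u \<otimes> cl m) v"
  by (simp add: crossings_append)

text \<open>A cancelling pair crosses the same edge back and forth. In a commuting square, the two
  parallel edges labelled by the letter of \<open>a\<close> differ by a link element on the right,
  so both or neither belong to the hyperplane.\<close>

lemma crossings_raag_eq:
  assumes "raag_eq UNIV E u v" "x \<in> carrier G"
  shows "crossings a x u = crossings a x v"
  using assms
proof (induction arbitrary: x)
  case (cancel xs ys z b)
  have f: "(z, \<not> b) = flip (z, b)" by (simp add: flip_def)
  have "crossings a y [l, flip l] = 0" if "y \<in> carrier G" for y l
  proof -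
    consider "l = a" | "l = flip a" | "l \<noteq> a" "l \<noteq> flip a" by blast
    then show ?thesis
    proof cases
      case 3
      then have "flip l \<noteq> a" "flip l \<noteq> flip a" by (metis flip_simps(3))+
      then show ?thesis using 3 by simp
    qed (use that in \<open>auto simp: m_assoc\<close>)
  qed
  then have "crossings a (x \<otimes> cl xs) [(z, b), flip (z, b)] = 0" using cancel.prems by simp
  moreover have "x \<otimes> cl xs \<otimes> cl [(z, b), flip (z, b)] = x \<otimes> cl xs" using cancel.prems by simp
  ultimately show ?case
    unfolding f using crossings_append[OF cancel.prems, of a xs ys]
      crossings_mid[OF cancel.prems, of a xs "[(z, b), flip (z, b)]" ys] by presburger
next
  case (commute xs ys u v)
  have g: "gen (u, True) \<otimes> gen (v, True) = gen (v, True) \<otimes> gen (u, True)"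
    using gen_commute[of "(u, True)" "(v, True)"] commute by simp
  have one: "crossings a y [(p, True), (q, True)] = crossings a y [(q, True), (p, True)]"
    if "y \<in> carrier G" "(p, q) \<in> E" "fst a = p" for y p q
  proof -
    have q: "gen (q, True) \<in> sg (Lk (fst a))" using that by (intro gen_sg) (simp add: Lk_iff)
    have pq: "gen (p, True) \<otimes> gen (q, True) = gen (q, True) \<otimes> gen (p, True)"
      using gen_commute[of "(p, True)" "(q, True)"] that by simp
    have "p \<noteq> q" using that E_irr by blast
    have 1: "y \<otimes> gen (q, True) \<in> sg (Lk (fst a)) \<longleftrightarrow> y \<in> sg (Lk (fst a))"
      using sg_mult_cancel_right[OF _ q] that by simp
    have 2: "y \<otimes> gen (q, True) \<otimes> gen (p, True) \<in> sg (Lk (fst a)) \<longleftrightarrow> y \<otimes> gen (p, True) \<in> sg (Lk (fst a))"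
      using sg_mult_cancel_right[OF _ q, of "y \<otimes> gen (p, True)"] that pq by (simp add: m_assoc)
    have 3: "(q, True) \<noteq> a" "(q, True) \<noteq> flip a" using \<open>p \<noteq> q\<close> that by (auto simp: flip_def)
    show ?thesis using 1 2 3 by auto
  qed
  have swap: "crossings a y [(u, True), (v, True)] = crossings a y [(v, True), (u, True)]" if "y \<in> carrier G" for y
  proof -
    consider "fst a = u" | "fst a = v" | "fst a \<noteq> u" "fst a \<noteq> v" by blast
    then show ?thesis
    proof cases
      case 1
      then show ?thesis using one[of y u v] that commute by blast
    next
      case 2
      then show ?thesis using one[of y v u] that commute E_sym by metis
    next
      case 3
      then show ?thesis by (auto simp: flip_def)
    qed
  qed
  have "crossings a (x \<otimes> cl xs) [(u, True), (v, True)] = crossings a (x \<otimes> cl xs) [(v, True), (u, True)]"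
    by (rule swap) (use commute.prems in simp)
  moreover have "cl [(u, True), (v, True)] = cl [(v, True), (u, True)]" using g by simp
  ultimately show ?case unfolding crossings_mid[OF commute.prems] by presburger
next
  case (sym w w')
  then show ?case by metis
next
  case (trans u v w)
  then show ?case by metis
next
  case (refl w)
  then show ?case by (intro HOL.refl)
qed

text \<open>The side, away from the identity, of the hyperplane through the edge from
  \<open>\<one>\<close> to \<open>gen a\<close>.\<close>

definition half :: "'a \<times> bool \<Rightarrow> 'a word set set" where
  "half a = cl ` {w. crossings a \<one> w = 1}"

lemma cl_half_iff: "cl w \<in> half a \<longleftrightarrow> crossings a \<one> w = 1"
proof
  assume "cl w \<in> half a"
  then obtain u where "cl w = cl u" "crossings a \<one> u = 1" unfolding half_def by blast
  then show "crossings a \<one> w = 1" using crossings_raag_eq[of w u \<one> a] cl_eq_iff by simp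
qed (auto simp: half_def)

lemma crossings_words: "w \<in> words S \<Longrightarrow> fst a \<notin> S \<Longrightarrow> crossings a x w = 0"
  by (induction w arbitrary: x) auto

lemma crossings_sg:
  assumes "cl w \<in> sg (Lk (fst a))"
  shows "crossings a \<one> w = 0"
proof -
  obtain u where u: "u \<in> words (Lk (fst a))" "cl w = cl u" using assms unfolding sg_def by blast
  then have "crossings a \<one> w = crossings a \<one> u" using crossings_raag_eq cl_eq_iff by simp
  then show ?thesis using crossings_words[OF u(1)] E_irr by (simp add: Lk_iff)
qed

lemma half_carrier: "x \<in> half a \<Longrightarrow> x \<in> carrier G"
  by (auto simp: half_def)

lemma sg_not_half: "x \<in> sg (Lk (fst a)) \<Longrightarrow> x \<notin> half a"
proof -
  assume x: "x \<in> sg (Lk (fst a))"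
  then obtain w where "x = cl w" unfolding sg_def by blast
  then show ?thesis using x crossings_sg[of w a] cl_half_iff[of w a] by simp
qed

lemma sg_gen_half:
  assumes "x \<in> sg (Lk (fst a))"
  shows "x \<otimes> gen a \<in> half a"
proof -
  obtain w where w: "x = cl w" using assms unfolding sg_def by blast
  have "crossings a \<one> (w @ [a]) = 1" using crossings_sg[of w a] assms w by (simp add: crossings_append)
  then show ?thesis using cl_half_iff[of "w @ [a]" a] w by simp
qed

lemma half_step:
  assumes "x \<in> carrier G" "(x \<otimes> gen l \<in> half a) \<noteq> (x \<in> half a)"
  shows "(l = a \<and> x \<in> sg (Lk (fst a))) \<or> (l = flip a \<and> x \<otimes> gen l \<in> sg (Lk (fst a)))"
proof -
  obtain w where w: "x = cl w" using carrier_cl assms by blast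
  have "crossings a \<one> (w @ [l]) \<noteq> crossings a \<one> w"
    using assms cl_half_iff[of "w @ [l]" a] cl_half_iff[of w a] w by (auto simp del: crossings.simps)
  then show ?thesis using w by (auto simp: crossings_append split: if_splits)
qed

text \<open>The last entrance is taken. It reads \<open>a\<close>, because a step reading
  \<open>flip a\<close> across the hyperplane ends in the link subgroup, outside
  \<open>half a\<close>.\<close>

lemma half_enter:
  assumes "x \<in> carrier G" "x \<notin> half a" "x \<otimes> cl u \<in> half a"
  obtains u1 u2 where "u = u1 @ a # u2" "x \<otimes> cl u1 \<in> sg (Lk (fst a))"
  using assms
proof (induction u arbitrary: thesis rule: rev_induct)
  case (snoc l u)
  show ?case
  proof (cases "x \<otimes> cl u \<in> half a")
    case True
    then obtain u1 u2 where "u = u1 @ a # u2" "x \<otimes> cl u1 \<in> sg (Lk (fst a))" using snoc by metis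
    then show ?thesis using snoc.prems(1)[of u1 "u2 @ [l]"] by simp
  next
    case False
    have "x \<otimes> cl u \<otimes> gen l \<in> half a" using snoc.prems by (simp add: m_assoc)
    then have "(l = a \<and> x \<otimes> cl u \<in> sg (Lk (fst a))) \<or> (x \<otimes> cl u \<otimes> gen l \<in> sg (Lk (fst a)))"
      using half_step[of "x \<otimes> cl u" l a] False snoc.prems by auto
    then have "l = a" "x \<otimes> cl u \<in> sg (Lk (fst a))"
      using sg_not_half \<open>x \<otimes> cl u \<otimes> gen l \<in> half a\<close> by blast+
    then show ?thesis using snoc.prems(1)[of u "[]"] by simp
  qed
qed simp

text \<open>The first exit is taken, so that all earlier points lie in \<open>half a\<close>;
  \<open>half_disjoint\<close> depends on this.\<close>

lemma half_exit:
  assumes "x \<in> half a" "x \<otimes> cl u \<notin> half a"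
  obtains u1 u2 where "u = u1 @ flip a # u2" "x \<otimes> cl u1 \<otimes> inv (gen a) \<in> sg (Lk (fst a))"
    "\<And>v1 v2. u1 = v1 @ v2 \<Longrightarrow> x \<otimes> cl v1 \<in> half a"
proof -
  have "\<exists>u1 u2. u = u1 @ flip a # u2 \<and> x \<otimes> cl u1 \<otimes> inv (gen a) \<in> sg (Lk (fst a)) \<and>
    (\<forall>v1 v2. u1 = v1 @ v2 \<longrightarrow> x \<otimes> cl v1 \<in> half a)"
    using assms
  proof (induction u arbitrary: x)
    case Nil
    then show ?case using half_carrier by simp
  next
    case (Cons l u)
    have xc: "x \<in> carrier G" using Cons.prems half_carrier by blast
    show ?case
    proof (cases "x \<otimes> gen l \<in> half a")
      case True
      moreover have "x \<otimes> gen l \<otimes> cl u \<notin> half a" using Cons.prems xc by (simp add: m_assoc)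
      ultimately obtain u1 u2 where u: "u = u1 @ flip a # u2"
        "x \<otimes> gen l \<otimes> cl u1 \<otimes> inv (gen a) \<in> sg (Lk (fst a))"
        "\<And>v1 v2. u1 = v1 @ v2 \<Longrightarrow> x \<otimes> gen l \<otimes> cl v1 \<in> half a" using Cons.IH by blast
      have "x \<otimes> cl v1 \<in> half a" if "l # u1 = v1 @ v2" for v1 v2
      proof (cases v1)
        case Nil
        then show ?thesis using Cons.prems xc by simp
      next
        case (Cons m v)
        then show ?thesis using u(3)[of v v2] that xc by (simp add: m_assoc)
      qed
      then show ?thesis using u(1,2) xc
        by (intro exI[of _ "l # u1"] exI[of _ u2]) (auto simp: m_assoc)
    next
      case False
      then have "l = flip a" "x \<otimes> gen l \<in> sg (Lk (fst a))"
        using half_step[of x l a] Cons.prems xc sg_not_half[of x a] by auto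
      then show ?thesis using Cons.prems xc by (intro exI[of _ "[]"] exI[of _ u]) auto
    qed
  qed
  then show ?thesis using that by blast
qed

lemma one_not_half [simp]: "\<one> \<notin> half a"
  using sg_not_half[of \<one>] by simp

lemma gen_half [simp]: "gen a \<in> half a"
  using sg_gen_half[of \<one> a] by simp

lemma half_enter_sg:
  assumes "x \<in> carrier G" "x \<notin> half a" "x \<otimes> y \<in> half a" "y \<in> sg S"
  shows "fst a \<in> S"
proof -
  obtain w where w: "w \<in> words S" "y = cl w" using assms(4) unfolding sg_def by blast
  then obtain w1 w2 where "w = w1 @ a # w2" using half_enter[OF assms(1,2), of w] assms(3) by metis
  then show ?thesis using w by simp
qed

end

section \<open>The extension graph\<close>

locale ext_graph = raag_geometry E G + base: girth5_graph V E
  for V :: "'a set" and E :: "('a \<times> 'a) set" and G :: "'a word set monoid" (structure)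
begin

text \<open>The star subgroup of \<open>u\<close> is the centralizer of \<open>u\<close>, so this
  coset together with the label \<open>u\<close> encodes the conjugate of \<open>u\<close> by
  \<open>g\<close>.\<close>

definition coset :: "'a \<Rightarrow> 'a word set \<Rightarrow> 'a word set set" where
  "coset u g = {q \<in> carrier G. inv g \<otimes> q \<in> sg (St u)}"

definition verts :: "('a \<times> 'a word set set) set" where
  "verts = {(u, coset u g) | u g. u \<in> V \<and> g \<in> sg V}"

text \<open>Meeting cosets share some \<open>g\<close>, so adjacent vertices lie in a common
  \<open>copy g\<close>. That this amounts to commuting conjugates is \<open>powers_commute\<close>
  and \<open>powers_commute_imp\<close>.\<close>

definition adj :: "(('a \<times> 'a word set set) \<times> ('a \<times> 'a word set set)) set" where
  "adj = {(x, y). x \<in> verts \<and> y \<in> verts \<and> (fst x, fst y) \<in> E \<and> snd x \<inter> snd y \<noteq> {}}"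

definition copy :: "'a word set \<Rightarrow> ('a \<times> 'a word set set) set" where
  "copy g = (\<lambda>u. (u, coset u g)) ` V"

lemma coset_self: "g \<in> carrier G \<Longrightarrow> g \<in> coset u g"
  by (simp add: coset_def)

lemma coset_eq:
  assumes "h \<in> coset u g" "g \<in> carrier G"
  shows "coset u h = coset u g"
proof -
  have h: "h \<in> carrier G" "inv g \<otimes> h \<in> sg (St u)" using assms by (auto simp: coset_def)
  have "inv h \<otimes> q \<in> sg (St u) \<longleftrightarrow> inv g \<otimes> q \<in> sg (St u)" if "q \<in> carrier G" for q
  proof -
    have "inv g \<otimes> q = (inv g \<otimes> h) \<otimes> (inv h \<otimes> q)" using that h assms(2) by (simp add: m_assoc)
    then show ?thesis using sg_mult_cancel_left[OF h(2), of "inv h \<otimes> q"] that h by simp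
  qed
  then show ?thesis unfolding coset_def by blast
qed

lemma St_sub: "u \<in> V \<Longrightarrow> St u \<subseteq> V"
  using base.R_sub by (auto simp: St_iff)

lemma vertex_rep:
  assumes "x \<in> verts" "h \<in> snd x"
  shows "fst x \<in> V" "snd x = coset (fst x) h" "h \<in> sg V" "x = (fst x, coset (fst x) h)"
proof -
  obtain u g where x: "x = (u, coset u g)" "u \<in> V" "g \<in> sg V" using assms unfolding verts_def by blast
  then have h: "h \<in> carrier G" "inv g \<otimes> h \<in> sg (St u)" using assms by (auto simp: coset_def)
  have "inv g \<otimes> h \<in> sg V" using h(2) sg_mono[OF St_sub[OF x(2)]] by blast
  then show "h \<in> sg V" using sg_mult_cancel_left[OF sg_inv[OF x(3)] h(1)] by simp
  show "fst x \<in> V" using x by simp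
  show "snd x = coset (fst x) h" using coset_eq[of h u g] assms x by simp
  then show "x = (fst x, coset (fst x) h)" by (metis prod.collapse)
qed

lemma vertex_nonempty: "x \<in> verts \<Longrightarrow> \<exists>h. h \<in> snd x"
proof -
  assume "x \<in> verts"
  then obtain u g where "x = (u, coset u g)" "g \<in> sg V" unfolding verts_def by blast
  then show ?thesis using coset_self[of g u] by auto
qed

lemma vertexI: "u \<in> V \<Longrightarrow> g \<in> sg V \<Longrightarrow> (u, coset u g) \<in> verts"
  unfolding verts_def by blast

lemma vertex_mult:
  assumes "x \<in> verts" "h \<in> snd x" "t \<in> sg (St (fst x))"
  shows "h \<otimes> t \<in> snd x"
  using vertex_rep[OF assms(1,2)] assms(3) by (simp add: coset_def)

lemma vertex_diff:
  assumes "x \<in> verts" "h \<in> snd x" "q \<in> snd x"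
  shows "inv h \<otimes> q \<in> sg (St (fst x))"
  using vertex_rep(2)[OF assms(1,2)] assms(3) by (simp add: coset_def)

lemma vertex_carrier: "x \<in> verts \<Longrightarrow> h \<in> snd x \<Longrightarrow> h \<in> carrier G"
  using vertex_rep(3) sg_carrier by blast

lemma vertex_memI:
  assumes "x \<in> verts" "h \<in> snd x" "q \<in> carrier G" "inv h \<otimes> q \<in> sg (St (fst x))"
  shows "q \<in> snd x"
  using vertex_rep(2)[OF assms(1,2)] assms(3,4) by (simp add: coset_def)

lemma vertex_eqI:
  assumes "x \<in> verts" "y \<in> verts" "fst x = fst y" "h \<in> snd x" "h \<in> snd y"
  shows "x = y"
  using vertex_rep(4)[OF assms(1,4)] vertex_rep(4)[OF assms(2,5)] assms(3) by metis

lemma adj_sym: "(x, y) \<in> adj \<Longrightarrow> (y, x) \<in> adj"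
  unfolding adj_def using E_sym by blast

lemma adj_star_iff: "x \<in> closed_star adj v \<longleftrightarrow> x = v \<or> (x, v) \<in> adj"
  unfolding closed_star_def neighbours_def using adj_sym by blast

lemma star_decomp:
  assumes "t \<in> sg (St v)"
  obtains h s where "h \<in> sg (Lk v)" "s \<in> sg {v}" "t = h \<otimes> s"
proof -
  obtain w where w: "w \<in> words (St v)" "t = cl w" using assms unfolding sg_def by blast
  have "\<exists>h s. h \<in> sg (Lk v) \<and> s \<in> sg {v} \<and> cl w = h \<otimes> s" using w(1)
  proof (induction w)
    case Nil
    then show ?case by (intro exI[of _ \<one>]) simp
  next
    case (Cons l w)
    then obtain h s where hs: "h \<in> sg (Lk v)" "s \<in> sg {v}" "cl w = h \<otimes> s" by auto
    have "fst l = v \<or> fst l \<in> Lk v" using Cons by (auto simp: St_iff Lk_iff)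
    then show ?case
    proof
      assume l: "fst l = v"
      have "cl (l # w) = (h \<otimes> gen l) \<otimes> s"
        using hs sg_Lk_commute[OF hs(1) gen_sg[of l "{v}"]] l by (simp add: m_assoc[symmetric])
      then have "cl (l # w) = h \<otimes> (gen l \<otimes> s)" using hs by (simp add: m_assoc)
      then show ?thesis using hs sg_mult[OF gen_sg[of l "{v}"] hs(2)] l by blast
    next
      assume l: "fst l \<in> Lk v"
      have "cl (l # w) = (gen l \<otimes> h) \<otimes> s" using hs by (simp add: m_assoc)
      then show ?thesis using hs sg_mult[OF gen_sg[OF l] hs(1)] by blast
    qed
  qed
  then show ?thesis using that w by blast
qed

lemma adj_link_rep:
  assumes "(x, (v, coset v g)) \<in> adj" "g \<in> carrier G"
  obtains h where "h \<in> sg (Lk v)" "g \<otimes> h \<in> snd x"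
proof -
  obtain p where p: "p \<in> snd x" "p \<in> coset v g" and x: "x \<in> verts" "(fst x, v) \<in> E"
    using assms unfolding adj_def by auto
  have "inv g \<otimes> p \<in> sg (St v)" and pc: "p \<in> carrier G" using p by (auto simp: coset_def)
  then obtain h s where hs: "h \<in> sg (Lk v)" "s \<in> sg {v}" "inv g \<otimes> p = h \<otimes> s" using star_decomp by blast
  have "p = g \<otimes> (h \<otimes> s)" using hs(3)[symmetric] pc assms(2) by simp
  then have "p \<otimes> inv s = g \<otimes> h" using hs assms(2) by (simp add: m_assoc)
  moreover have "{v} \<subseteq> St (fst x)" using x by (auto simp: St_iff)
  then have "inv s \<in> sg (St (fst x))" using sg_inv[OF hs(2)] sg_mono by blast
  ultimately show ?thesis using that hs vertex_mult[OF x(1) p(1)] by metis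
qed

section \<open>Distances to cosets and the hyperplanes that separate them\<close>

definition dist_to :: "'a word set \<Rightarrow> ('a \<times> 'a word set set) \<Rightarrow> nat" where
  "dist_to g x = (LEAST k. \<exists>u\<in>words V. length u = k \<and> g \<otimes> cl u \<in> snd x)"

lemma dist_to_word:
  assumes "x \<in> verts" "g \<in> sg V"
  obtains u where "u \<in> words V" "length u = dist_to g x" "g \<otimes> cl u \<in> snd x"
proof -
  obtain h where h: "h \<in> snd x" using vertex_nonempty assms by blast
  then have "inv g \<otimes> h \<in> sg V" using vertex_rep(3)[OF assms(1)] assms(2) sg_mult sg_inv by blast
  then obtain u where u: "u \<in> words V" "inv g \<otimes> h = cl u" unfolding sg_def by blast
  have "g \<otimes> cl u = h" using u(2)[symmetric] vertex_carrier[OF assms(1) h] assms(2) by simp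
  then have "\<exists>k. \<exists>u\<in>words V. length u = k \<and> g \<otimes> cl u \<in> snd x" using h u by blast
  from LeastI_ex[OF this] show ?thesis using that unfolding dist_to_def by blast
qed

lemma dist_to_le: "u \<in> words V \<Longrightarrow> g \<otimes> cl u \<in> snd x \<Longrightarrow> dist_to g x \<le> length u"
  unfolding dist_to_def by (rule Least_le) blast

lemma dist_to_0:
  assumes "x \<in> verts" "g \<in> sg V"
  shows "dist_to g x = 0 \<longleftrightarrow> g \<in> snd x"
  using dist_to_word[OF assms] dist_to_le[of "[]" g x] assms(2)
  by (metis cl_Nil le_zero_eq length_0_conv r_one sg_carrier words_simps(1))

definition beyond :: "'a word set \<Rightarrow> 'a \<times> bool \<Rightarrow> ('a \<times> 'a word set set) \<Rightarrow> bool" where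
  "beyond g a x \<longleftrightarrow> (\<forall>q\<in>snd x. inv g \<otimes> q \<in> half a)"

lemma inv_mult_shift:
  assumes "inv h \<otimes> a = a \<otimes> inv h" "g \<in> carrier G" "h \<in> carrier G" "a \<in> carrier G" "w \<in> carrier G"
  shows "inv (g \<otimes> h) \<otimes> (g \<otimes> (a \<otimes> w)) = a \<otimes> (inv h \<otimes> w)"
proof -
  have "inv (g \<otimes> h) \<otimes> (g \<otimes> (a \<otimes> w)) = (inv h \<otimes> a) \<otimes> w"
    using assms(2-) by (simp add: inv_mult_group m_assoc)
  then show ?thesis unfolding assms(1) using assms(2-) by (simp add: m_assoc)
qed

text \<open>A shortest path does not recross its first hyperplane, or two letters could be erased.
  If the coset itself crossed it, \<open>a\<close> would be in the star of its label and the first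
  letter could be dropped.\<close>

lemma first_step_beyond:
  assumes x: "x \<in> verts" and g: "g \<in> sg V" and w: "a # u \<in> words V"
    and e: "g \<otimes> cl (a # u) \<in> snd x" and d: "length (a # u) = dist_to g x"
  shows "beyond g a x"
  unfolding beyond_def
proof (rule ccontr)
  assume "\<not> (\<forall>q\<in>snd x. inv g \<otimes> q \<in> half a)"
  then obtain q where q: "q \<in> snd x" "inv g \<otimes> q \<notin> half a" by blast
  have gc: "g \<in> carrier G" and qc: "q \<in> carrier G" using g q vertex_carrier x by auto
  show False
  proof (cases "gen a \<otimes> cl u \<in> half a")
    case False
    obtain u1 u2 where u: "u = u1 @ flip a # u2" "gen a \<otimes> cl u1 \<otimes> inv (gen a) \<in> sg (Lk (fst a))"
      using half_exit[OF gen_half False] by metis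
    let ?t = "gen a \<otimes> cl u1 \<otimes> inv (gen a)"
    have "cl (a # u) = ?t \<otimes> cl u2" by (simp add: u(1) m_assoc)
    also have "\<dots> = cl (u1 @ u2)" using conj_gen_Lk[OF cl_carrier u(2)] by simp
    finally have "g \<otimes> cl (u1 @ u2) \<in> snd x" using e by simp
    then have "dist_to g x \<le> length (u1 @ u2)" using w u(1) by (intro dist_to_le) auto
    then show False using d u(1) by simp
  next
    case True
    let ?e = "g \<otimes> cl (a # u)"
    \<comment> \<open>A path from \<open>q\<close> to \<open>?e\<close> inside the coset crosses the
      hyperplane at \<open>?p\<close>, which differs from \<open>g\<close> by a link element and
      hence by something commuting with \<open>gen a\<close>.\<close>
    obtain v where v: "v \<in> words (St (fst x))" "inv q \<otimes> ?e = cl v"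
      using vertex_diff[OF x q(1) e] unfolding sg_def by blast
    have "(inv g \<otimes> q) \<otimes> cl v = gen a \<otimes> cl u"
      using v(2)[symmetric] gc qc by (simp add: m_assoc)
    then obtain v1 v2 where v12: "v = v1 @ a # v2" "inv g \<otimes> q \<otimes> cl v1 \<in> sg (Lk (fst a))"
      using half_enter[of "inv g \<otimes> q" a v] True q(2) gc qc by auto
    let ?h = "inv g \<otimes> q \<otimes> cl v1" and ?p = "q \<otimes> cl v1"
    have aSt: "gen a \<in> sg (St (fst x))" using v(1) v12(1) by (intro gen_sg) simp
    have p: "?p \<in> snd x" using vertex_mult[OF x q(1) cl_sg[of v1]] v(1) v12(1) by simp
    have ph: "?p = g \<otimes> ?h" using gc qc by (simp add: m_assoc)
    have hc: "?h \<in> carrier G" using v12(2) by simp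
    have "inv ?h \<otimes> gen a = gen a \<otimes> inv ?h" using sg_Lk_gen_commute[OF sg_inv[OF v12(2)]] .
    then have "inv ?p \<otimes> ?e = gen a \<otimes> (inv ?h \<otimes> cl u)"
      unfolding ph using inv_mult_shift[OF _ gc hc] by simp
    moreover have "inv ?p \<otimes> ?e \<in> sg (St (fst x))" using vertex_diff[OF x p e] .
    ultimately have "inv ?h \<otimes> cl u \<in> sg (St (fst x))"
      using sg_mult_cancel_left[OF aSt, of "inv ?h \<otimes> cl u"] hc by simp
    moreover have "inv ?p \<otimes> (g \<otimes> cl u) = inv ?h \<otimes> cl u"
      unfolding ph using gc hc by (simp add: inv_mult_group m_assoc)
    ultimately have "g \<otimes> cl u \<in> snd x" using vertex_memI[OF x p] gc by simp
    then have "dist_to g x \<le> length u" using w by (intro dist_to_le) auto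
    then show False using d by simp
  qed
qed

text \<open>A shortest path must enter \<open>half a\<close>; the entering letter commutes with the
  link element before it and moves to the front.\<close>

lemma beyond_closer:
  assumes x: "x \<in> verts" and g: "g \<in> sg V" and b: "beyond g a x"
  shows "dist_to (g \<otimes> gen a) x < dist_to g x"
proof -
  obtain w where w: "w \<in> words V" "length w = dist_to g x" "g \<otimes> cl w \<in> snd x"
    using dist_to_word[OF x g] by blast
  have gc: "g \<in> carrier G" using g by simp
  have "inv g \<otimes> (g \<otimes> cl w) \<in> half a" using b w(3) unfolding beyond_def by blast
  then have "cl w \<in> half a" using gc by simp
  then obtain w1 w2 where ww: "w = w1 @ a # w2" "cl w1 \<in> sg (Lk (fst a))"
    using half_enter[of \<one> a w] by auto
  have "gen a \<otimes> cl (w1 @ w2) = (cl w1 \<otimes> gen a) \<otimes> cl w2"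
    using sg_Lk_gen_commute[OF ww(2)] by (simp add: m_assoc)
  also have "\<dots> = cl w" using ww(1) by (simp add: m_assoc)
  finally have "g \<otimes> gen a \<otimes> cl (w1 @ w2) \<in> snd x" using w(3) gc by (simp add: m_assoc)
  then have "dist_to (g \<otimes> gen a) x \<le> length (w1 @ w2)" using w(1) ww(1) by (intro dist_to_le) auto
  then show ?thesis using w(2) ww(1) by simp
qed

text \<open>The conjugate of \<open>gen a\<close> by \<open>g\<close> stabilises the coset, so a
  path from \<open>g\<close> into the coset can be repeated from
  \<open>g \<otimes> gen a\<close>.\<close>

lemma adj_not_farther:
  assumes "(x, (fst a, coset (fst a) g)) \<in> adj" and g: "g \<in> sg V"
  shows "dist_to (g \<otimes> gen a) x \<le> dist_to g x"
proof -
  have x: "x \<in> verts" and a: "(fst x, fst a) \<in> E" using assms by (auto simp: adj_def)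
  have gc: "g \<in> carrier G" using g by simp
  obtain h where h: "h \<in> sg (Lk (fst a))" "g \<otimes> h \<in> snd x" using adj_link_rep[OF assms(1) gc] by blast
  obtain w where w: "w \<in> words V" "length w = dist_to g x" "g \<otimes> cl w \<in> snd x"
    using dist_to_word[OF x g] by blast
  have hc: "h \<in> carrier G" using h by simp
  have aSt: "gen a \<in> sg (St (fst x))" using a by (intro gen_sg) (simp add: St_iff)
  have "inv h \<otimes> gen a = gen a \<otimes> inv h" using sg_Lk_gen_commute[OF sg_inv[OF h(1)]] .
  then have "inv (g \<otimes> h) \<otimes> (g \<otimes> gen a \<otimes> cl w) = gen a \<otimes> (inv h \<otimes> cl w)"
    using inv_mult_shift[OF _ gc hc, of "gen a" "cl w"] gc by (simp add: m_assoc)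
  also have "\<dots> = gen a \<otimes> (inv (g \<otimes> h) \<otimes> (g \<otimes> cl w))" using gc hc by (simp add: inv_mult_group m_assoc)
  also have "\<dots> \<in> sg (St (fst x))" using sg_mult[OF aSt vertex_diff[OF x h(2) w(3)]] .
  finally have "g \<otimes> gen a \<otimes> cl w \<in> snd x" using vertex_memI[OF x h(2)] gc by simp
  then show ?thesis using dist_to_le[OF w(1)] w(2) by metis
qed

lemma beyond_off_star:
  assumes "x \<in> verts" "g \<in> sg V" "beyond g a x"
  shows "x \<notin> closed_star adj (fst a, coset (fst a) g)"
proof
  have gc: "g \<in> carrier G" using assms by simp
  assume "x \<in> closed_star adj (fst a, coset (fst a) g)"
  then consider "x = (fst a, coset (fst a) g)" | "(x, (fst a, coset (fst a) g)) \<in> adj"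
    unfolding adj_star_iff by blast
  then show False
  proof cases
    case 1
    then have "inv g \<otimes> g \<in> half a" using assms(3) coset_self[OF gc] unfolding beyond_def by auto
    then show False using gc by simp
  next
    case 2
    then obtain h where "h \<in> sg (Lk (fst a))" "g \<otimes> h \<in> snd x" using adj_link_rep gc by metis
    then have "inv g \<otimes> (g \<otimes> h) \<in> half a" using assms(3) unfolding beyond_def by blast
    then show False using sg_not_half[OF \<open>h \<in> sg (Lk (fst a))\<close>] gc \<open>h \<in> sg (Lk (fst a))\<close> by simp
  qed
qed

text \<open>A coset with elements on both sides contains an edge of the hyperplane. Then its label
  is \<open>fst a\<close> or adjacent to it, and it meets the coset of \<open>fst a\<close>, which
  puts it in the star.\<close>

lemma off_star_one_side:
  assumes x: "x \<in> verts" "x \<notin> closed_star adj (fst a, coset (fst a) g)"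
    and g: "g \<in> sg V" and a: "fst a \<in> V" and q: "q \<in> snd x" "inv g \<otimes> q \<in> half a"
  shows "beyond g a x"
  unfolding beyond_def
proof (rule ccontr)
  assume "\<not> (\<forall>q\<in>snd x. inv g \<otimes> q \<in> half a)"
  then obtain p where p: "p \<in> snd x" "inv g \<otimes> p \<notin> half a" by blast
  have c: "g \<in> carrier G" "p \<in> carrier G" "q \<in> carrier G" using g p q vertex_carrier x by auto
  obtain v where v: "v \<in> words (St (fst x))" "inv p \<otimes> q = cl v"
    using vertex_diff[OF x(1) p(1) q(1)] unfolding sg_def by blast
  have "(inv g \<otimes> p) \<otimes> cl v = inv g \<otimes> q" using v(2)[symmetric] c by (simp add: m_assoc)
  then obtain v1 v2 where v12: "v = v1 @ a # v2" "inv g \<otimes> p \<otimes> cl v1 \<in> sg (Lk (fst a))"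
    using half_enter[of "inv g \<otimes> p" a v] p(2) q(2) c by auto
  let ?p = "p \<otimes> cl v1"
  have p1: "?p \<in> snd x" using vertex_mult[OF x(1) p(1) cl_sg[of v1]] v(1) v12(1) by simp
  have "Lk (fst a) \<subseteq> St (fst a)" by (auto simp: closed_star_def)
  then have "inv g \<otimes> ?p \<in> sg (St (fst a))" using v12(2) sg_mono c by (auto simp: m_assoc)
  then have p2: "?p \<in> coset (fst a) g" using c by (simp add: coset_def)
  have vg: "(fst a, coset (fst a) g) \<in> verts" using vertexI[OF a g] .
  have "fst a \<in> St (fst x)" using v(1) v12(1) by simp
  then consider "fst a = fst x" | "(fst a, fst x) \<in> E" using E_sym by (auto simp: St_iff)
  then show False
  proof cases
    case 1
    then have "x = (fst a, coset (fst a) g)" using vertex_eqI[OF x(1) vg _ p1] p2 by simp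
    then show False using x(2) by (simp add: closed_star_def)
  next
    case 2
    then have "((fst a, coset (fst a) g), x) \<in> adj" using x(1) vg p1 p2 unfolding adj_def by auto
    then show False using x(2) by (simp add: closed_star_def neighbours_def)
  qed
qed

text \<open>Adjacent cosets share an element, so the side cannot change along a path off the star.
  This links separation by stars to hyperplanes.\<close>

lemma beyond_adj:
  assumes "(x, y) \<in> adj" "y \<notin> closed_star adj (fst a, coset (fst a) g)" "g \<in> sg V" "fst a \<in> V" "beyond g a x"
  shows "beyond g a y"
proof -
  obtain q where "q \<in> snd x" "q \<in> snd y" "y \<in> verts" using assms(1) unfolding adj_def by auto
  then show ?thesis using off_star_one_side[OF _ assms(2-4)] assms(5) unfolding beyond_def by blast
qed

text \<open>The coset \<open>x\<close> contains \<open>g\<close> times \<open>h\<close> over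
  \<open>Lk w\<close> and \<open>g\<close> times \<open>k\<close> over \<open>Lk v\<close>, with
  quotient over \<open>St (fst x)\<close>. Restricting to \<open>Lk w\<close> keeps
  \<open>h\<close>, while girth leaves only powers of \<open>fst x\<close> elsewhere. So
  \<open>h\<close> is such a power and \<open>g\<close> is in the coset.\<close>

lemma common_neighbour_in_copy:
  assumes g: "g \<in> sg V" and wv: "w \<noteq> v"
    and x: "(x, (w, coset w g)) \<in> adj" "(x, (v, coset v g)) \<in> adj"
  shows "x = (fst x, coset (fst x) g)" "Lk w \<inter> Lk v = {fst x}"
proof -
  let ?u = "fst x"
  have gc: "g \<in> carrier G" using g by simp
  have xv: "x \<in> verts" and uw: "(?u, w) \<in> E" and uv: "(?u, v) \<in> E" using x unfolding adj_def by auto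
  show L: "Lk w \<inter> Lk v = {?u}"
  proof
    show "{?u} \<subseteq> Lk w \<inter> Lk v" using uw uv E_sym by (auto simp: Lk_iff)
    show "Lk w \<inter> Lk v \<subseteq> {?u}"
    proof
      fix c assume "c \<in> Lk w \<inter> Lk v"
      then have "(c, w) \<in> E" "(v, c) \<in> E" using E_sym by (auto simp: Lk_iff)
      then show "c \<in> {?u}" using base.no_square[OF _ E_sym[OF uw] uv] wv by blast
    qed
  qed
  have L2: "St ?u \<inter> Lk w \<subseteq> {?u}"
  proof
    fix c assume "c \<in> St ?u \<inter> Lk w"
    then show "c \<in> {?u}" using base.no_triangle[of w c ?u] E_sym[OF uw] E_sym[of ?u c] by (auto simp: Lk_iff St_iff)
  qed
  obtain h where h: "h \<in> sg (Lk w)" "g \<otimes> h \<in> snd x" using adj_link_rep[OF x(1) gc] by blast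
  obtain k where k: "k \<in> sg (Lk v)" "g \<otimes> k \<in> snd x" using adj_link_rep[OF x(2) gc] by blast
  obtain a where a: "a \<in> words (Lk w)" "h = cl a" using h unfolding sg_def by blast
  obtain b where b: "b \<in> words (Lk v)" "k = cl b" using k unfolding sg_def by blast
  have "inv (g \<otimes> h) \<otimes> (g \<otimes> k) \<in> sg (St ?u)" using vertex_diff[OF xv h(2) k(2)] .
  then have "cl (winv a @ b) \<in> sg (St ?u)" using a b gc by (simp add: inv_mult_group m_assoc)
  then obtain m where m: "m \<in> words (St ?u)" "cl (winv a @ b) = cl m" unfolding sg_def by blast
  have "cl (restrict_word (Lk w) (winv a @ b)) = cl (restrict_word (Lk w) m)" using cl_restrict[OF m(2)] .
  moreover have "restrict_word (Lk w) (winv a) = winv a" using a by (intro restrict_word_id) simp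
  ultimately have eq: "inv h \<otimes> cl (restrict_word (Lk w) b) = cl (restrict_word (Lk w) m)" using a by simp
  have "restrict_word (Lk w) b \<in> words {?u}" using restrict_word_words[OF b(1), of "Lk w"] L by (simp add: Int_commute)
  moreover have "restrict_word (Lk w) m \<in> words {?u}"
    using restrict_word_words[OF m(1), of "Lk w"] L2 words_mono by blast
  moreover have "inv h = cl (restrict_word (Lk w) m) \<otimes> inv (cl (restrict_word (Lk w) b))"
    unfolding eq[symmetric] using h(1) by (simp add: m_assoc)
  ultimately have "inv h \<in> sg {?u}" using sg_mult sg_inv cl_sg by metis
  moreover have "{?u} \<subseteq> St ?u" by (simp add: St_iff)
  ultimately have "inv h \<in> sg (St ?u)" using sg_mono by blast
  then have "g \<otimes> h \<otimes> inv h \<in> snd x" using vertex_mult[OF xv h(2)] by blast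
  then have "g \<in> snd x" using h(1) gc by (simp add: m_assoc)
  then show "x = (?u, coset ?u g)" using vertex_rep(4)[OF xv] by blast
qed

text \<open>Excludes squares. Take \<open>g\<close> in the coset of \<open>y1\<close> nearest to
  \<open>y2\<close>. Either it is in both cosets, or the first edge towards \<open>y2\<close> yields
  a vertex of \<open>copy g\<close> whose star separates \<open>y1\<close> from \<open>y2\<close>
  and which is therefore adjacent to every common neighbour. Two labels in \<open>copy g\<close>
  then determine that neighbour.\<close>

lemma common_neighbour_unique:
  assumes y: "y1 \<noteq> y2" and x: "(x1, y1) \<in> adj" "(x1, y2) \<in> adj" "(x2, y1) \<in> adj" "(x2, y2) \<in> adj"
  shows "x1 = x2"
proof -
  have V: "y1 \<in> verts" "y2 \<in> verts" using x unfolding adj_def by auto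
  have fin: "x1 = x2" if "g \<in> sg V" "fst y1 \<noteq> v" "y1 = (fst y1, coset (fst y1) g)"
    "(x1, (v, coset v g)) \<in> adj" "(x2, (v, coset v g)) \<in> adj" for g v
  proof -
    have 1: "x1 = (fst x1, coset (fst x1) g)" "Lk (fst y1) \<inter> Lk v = {fst x1}"
      using common_neighbour_in_copy[OF that(1,2), of x1] x that by metis+
    have 2: "x2 = (fst x2, coset (fst x2) g)" "Lk (fst y1) \<inter> Lk v = {fst x2}"
      using common_neighbour_in_copy[OF that(1,2), of x2] x that by metis+
    show ?thesis using 1 2 by (metis singleton_inject)
  qed
  obtain h0 where "h0 \<in> snd y1" using vertex_nonempty[OF V(1)] by blast
  then obtain g where g: "g \<in> snd y1" and min: "\<And>h. h \<in> snd y1 \<Longrightarrow> dist_to g y2 \<le> dist_to h y2"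
    using ex_has_least_nat[of "\<lambda>h. h \<in> snd y1" h0 "\<lambda>h. dist_to h y2"] by blast
  note g1 = vertex_rep[OF V(1) g]
  have gc: "g \<in> carrier G" using g1 by simp
  obtain w where w: "w \<in> words V" "length w = dist_to g y2" "g \<otimes> cl w \<in> snd y2"
    using dist_to_word[OF V(2) g1(3)] by blast
  show ?thesis
  proof (cases w)
    case Nil
    then have g2: "g \<in> snd y2" using w gc by simp
    have "fst y1 \<noteq> fst y2" using vertex_eqI[OF V _ g g2] y by blast
    moreover have "y2 = (fst y2, coset (fst y2) g)" using vertex_rep(4)[OF V(2) g2] .
    ultimately show ?thesis using fin[OF g1(3) _ g1(4), of "fst y2"] x by metis
  next
    case (Cons a u)
    let ?v = "(fst a, coset (fst a) g)"
    have aV: "fst a \<in> V" using w Cons by simp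
    have b: "beyond g a y2" using first_step_beyond[OF V(2) g1(3)] w Cons by metis
    have y2s: "y2 \<notin> closed_star adj ?v" using beyond_off_star[OF V(2) g1(3) b] .
    have aSt: "fst a \<notin> St (fst y1)"
    proof
      assume "fst a \<in> St (fst y1)"
      then have "g \<otimes> gen a \<in> snd y1" using vertex_mult[OF V(1) g gen_sg] by blast
      then show False using min beyond_closer[OF V(2) g1(3) b] by (metis leD)
    qed
    have y1s: "y1 \<notin> closed_star adj ?v"
    proof
      assume "y1 \<in> closed_star adj ?v"
      then have "y1 = ?v \<or> (y1, ?v) \<in> adj" unfolding adj_star_iff .
      then show False using aSt unfolding adj_def by (auto simp: St_iff)
    qed
    have y1b: "\<not> beyond g a y1" using g gc unfolding beyond_def by (auto intro!: bexI[of _ g])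
    have "(xi, ?v) \<in> adj" if "(xi, y1) \<in> adj" "(xi, y2) \<in> adj" for xi
    proof (rule ccontr)
      assume n: "(xi, ?v) \<notin> adj"
      have "xi \<noteq> ?v"
        using that(1) y1s adj_star_iff adj_sym by blast
      then have "xi \<notin> closed_star adj ?v" using n unfolding adj_star_iff by blast
      then have "beyond g a xi" using beyond_adj[OF adj_sym[OF that(2)] _ g1(3) aV b] by blast
      then show False using beyond_adj[OF that(1) y1s g1(3) aV] y1b by blast
    qed
    moreover have "fst y1 \<noteq> fst a" using aSt by (auto simp: St_iff)
    ultimately show ?thesis using fin[OF g1(3) _ g1(4), of "fst a"] x by blast
  qed
qed

sublocale X: girth5_graph verts adj
proof
  show "adj \<subseteq> verts \<times> verts" unfolding adj_def by blast
  show "sym adj" using adj_sym by (rule symI)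
  show "irrefl adj" unfolding irrefl_def adj_def using E_irr by blast
  show "(a, c) \<notin> adj" if "(a, b) \<in> adj" "(b, c) \<in> adj" for a b c
    using that base.no_triangle unfolding adj_def by blast
  show "a = c \<or> b = d" if "(a, b) \<in> adj" "(b, c) \<in> adj" "(c, d) \<in> adj" "(d, a) \<in> adj" for a b c d
    using common_neighbour_unique[of b d a c] that adj_sym by blast
qed

lemma beyond_off_star_path:
  assumes "(y, z) \<in> (X.off_star (fst a, coset (fst a) g))\<^sup>*" "g \<in> sg V" "fst a \<in> V" "beyond g a y"
  shows "beyond g a z"
  using assms(1)
proof induction
  case (step y z)
  then show ?case using beyond_adj[OF _ _ assms(2,3)] unfolding X.off_star_def by blast
qed (rule assms(4))

text \<open>A common element of the cosets is found by minimising the sum of the distances: the first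
  edge of a shortest path towards one coset brings us closer to every coset.\<close>

lemma cosets_helly:
  assumes P: "finite P" "P \<subseteq> verts" "X.unsep P"
  shows "\<exists>g\<in>sg V. P \<subseteq> copy g"
proof -
  obtain g where g: "g \<in> sg V"
    and min: "\<And>h. h \<in> sg V \<Longrightarrow> (\<Sum>y\<in>P. dist_to g y) \<le> (\<Sum>y\<in>P. dist_to h y)"
    using ex_has_least_nat[of "\<lambda>h. h \<in> sg V" \<one> "\<lambda>h. \<Sum>y\<in>P. dist_to h y"] by auto
  have gc: "g \<in> carrier G" using g by simp
  have "g \<in> snd y" if "y \<in> P" for y
  proof (rule ccontr)
    assume n: "g \<notin> snd y"
    have yv: "y \<in> verts" using that P by blast
    obtain w where w: "w \<in> words V" "length w = dist_to g y" "g \<otimes> cl w \<in> snd y"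
      using dist_to_word[OF yv g] by blast
    have "w \<noteq> []" using w(3) n gc by auto
    then obtain a u where au: "w = a # u" by (cases w) auto
    let ?v = "(fst a, coset (fst a) g)"
    have aV: "fst a \<in> V" using w au by simp
    have ga: "g \<otimes> gen a \<in> sg V" using sg_mult[OF g gen_sg[OF aV]] .
    have b: "beyond g a y" using first_step_beyond[OF yv g] w au by metis
    have vv: "?v \<in> verts" using vertexI[OF aV g] .
    \<comment> \<open>The vertex \<open>?v\<close> and its neighbours get no farther. Vertices off
      its star are on the side of \<open>y\<close>, since \<open>P\<close> is unseparated, and get
      closer.\<close>
    have le: "dist_to (g \<otimes> gen a) z \<le> dist_to g z" if z: "z \<in> P" for z
    proof -
      have zv: "z \<in> verts" using z P by blast
      consider "z = ?v" | "(z, ?v) \<in> adj" | "z \<notin> closed_star adj ?v" unfolding adj_star_iff by blast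
      then show ?thesis
      proof cases
        case 1
        then have "g \<in> snd z" using coset_self[OF gc] by simp
        moreover have "gen a \<in> sg (St (fst z))" using 1 by (intro gen_sg) (simp add: St_iff)
        ultimately have "g \<otimes> gen a \<in> snd z" using vertex_mult[OF zv] by blast
        then show ?thesis using dist_to_0[OF zv ga] by simp
      next
        case 2
        then show ?thesis using adj_not_farther[OF _ g] by blast
      next
        case 3
        have "(y, z) \<in> (X.off_star ?v)\<^sup>*"
          using P(3) vv that z 3 beyond_off_star[OF yv g b] \<open>y \<in> P\<close> unfolding X.unsep_def by blast
        then have "beyond g a z" using beyond_off_star_path[OF _ g aV b] by blast
        then show ?thesis using beyond_closer[OF zv g] by (simp add: less_imp_le)
      qed
    qed
    have "(\<Sum>z\<in>P. dist_to (g \<otimes> gen a) z) < (\<Sum>z\<in>P. dist_to g z)"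
      using P(1) le that beyond_closer[OF yv g b] by (intro sum_strict_mono_ex1) auto
    then show False using min[OF ga] by simp
  qed
  then have "P \<subseteq> copy g" using P(2) vertex_rep(1,4) unfolding copy_def by blast
  then show ?thesis using g by blast
qed

section \<open>The translates of the graph as copies\<close>

lemma copy_induced:
  assumes "g \<in> sg V"
  shows "induced_emb V E verts adj (\<lambda>u. (u, coset u g))"
proof -
  have "g \<in> coset u g" for u using assms coset_self by simp
  then show ?thesis unfolding induced_emb_def inj_on_def adj_def using vertexI[OF _ assms] by auto
qed

theorem tiled:
  assumes V: "base.biconn V" "\<And>v. v \<in> V \<Longrightarrow> connected_on (V - closed_star E v) E"
  shows "tiled_graph verts adj (copy ` sg V) (card V)"
proof unfold_locales
  have gb: "girth5_graph V E" and gX: "girth5_graph verts adj" by unfold_locales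
  show "copy ` sg V \<noteq> {}" using sg_one by blast
  fix C assume "C \<in> copy ` sg V"
  then obtain g where g: "g \<in> sg V" "C = copy g" by blast
  note ind = copy_induced[OF g(1)]
  show "C \<subseteq> verts" using vertexI g unfolding copy_def by blast
  show "card C = card V" unfolding g copy_def using ind unfolding induced_emb_def by (simp add: card_image)
  show "X.biconn C" unfolding g copy_def using induced_emb_biconn[OF ind subset_refl V(1) gb gX] .
  show "connected_on (C - closed_star adj v) adj" if "v \<in> C" for v
  proof -
    obtain u where u: "u \<in> V" "v = (u, coset u g)" using \<open>v \<in> C\<close> g unfolding copy_def by blast
    then show ?thesis unfolding g copy_def
      using induced_emb_star_connected[OF ind subset_refl u(1) V(2)[OF u(1)]] by simp
  qed
  show "l = m" if h: "d \<in> verts - C" "l \<in> C" "m \<in> C" "(d, l) \<in> adj" "(d, m) \<in> adj" for d l m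
  proof (rule ccontr)
    assume n: "l \<noteq> m"
    obtain w v where wv: "l = (w, coset w g)" "m = (v, coset v g)" using h g unfolding copy_def by blast
    then have "d = (fst d, coset (fst d) g)"
      using common_neighbour_in_copy(1)[OF g(1), of w v d] n h by metis
    moreover have "fst d \<in> V" using h vertex_nonempty vertex_rep(1) by blast
    ultimately show False using h(1) g unfolding copy_def by blast
  qed
next
  show "\<exists>C\<in>copy ` sg V. P \<subseteq> C" if "finite P" "P \<subseteq> verts" "X.unsep P" for P
    using cosets_helly[OF that] by blast
qed

end

section \<open>Commuting powers of conjugates of generators\<close>

context raag_geometry
begin

lemma gen_pow: "gen l [^] (k::nat) = cl (replicate k l)"
proof (induction k)
  case (Suc k)
  have "gen l [^] Suc k = cl (replicate k l @ [l])" using Suc by simp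
  then show ?case by (simp add: replicate_append_same del: cl_append cl_Cons)
qed simp

lemma gen_pow_sg: "gen l [^] (k::nat) \<in> sg {fst l}"
  unfolding gen_pow by (rule cl_sg) (induction k, auto)

lemma gen_pow_expo: "0 < k \<Longrightarrow> expo (fst l) (gen l [^] (k::nat)) \<noteq> 0"
  unfolding gen_pow using exponent_replicate[of "fst l" k "snd l"] by simp

lemma sg_St_commute: "t \<in> sg (St u) \<Longrightarrow> x \<in> sg {u} \<Longrightarrow> t \<otimes> x = x \<otimes> t"
  by (rule sg_commute[of _ "St u" _ "{u}"]) (auto simp: St_iff E_sym)

text \<open>A path spelling \<open>Z\<close> and then \<open>t\<close> avoids the vertex of
  \<open>a\<close>, so it stays outside \<open>half a\<close>. The last edge is in the hyperplane
  only if \<open>Z\<close> is in the link subgroup, which its exponent forbids.\<close>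

lemma shifted_not_half:
  assumes Z: "Z \<in> sg {u}" "expo u Z \<noteq> 0" and u: "u \<notin> St (fst a)" and t: "t \<in> sg (Lk (fst a))"
  shows "Z \<otimes> t \<otimes> gen a \<notin> half a"
proof
  assume h: "Z \<otimes> t \<otimes> gen a \<in> half a"
  have Zn: "Z \<notin> half a" using half_enter_sg[of \<one> a Z "{u}"] Z u by (auto simp: St_iff)
  then have Ztn: "Z \<otimes> t \<notin> half a" using half_enter_sg[OF _ Zn _ t] Z E_irr by (auto simp: Lk_iff)
  have "Z \<otimes> t \<in> sg (Lk (fst a))" using half_step[of "Z \<otimes> t" a a] h Ztn Z t by auto
  then have "Z \<in> sg (Lk (fst a))" using sg_mult_cancel_right[OF _ t] Z by simp
  then show False using expo_notin[of Z "Lk (fst a)" u] Z u by (auto simp: St_iff Lk_iff)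
qed

text \<open>Let \<open>U q u1\<close> be the last point before the path from \<open>U q\<close> to
  \<open>U\<close> first exits \<open>half a\<close>. By \<open>shifted_not_half\<close> its
  translate \<open>q u1\<close> is outside, so the path from \<open>q\<close> exits earlier, after a
  point \<open>q v1\<close>. By the same lemma \<open>U q v1\<close> is outside, although it
  precedes the first exit.\<close>

lemma half_disjoint:
  assumes U: "U \<in> sg {u}" "expo u U \<noteq> 0" and u: "u \<notin> St (fst a)"
    and q: "q \<in> half a" "U \<otimes> q \<in> half a"
  shows False
proof -
  have c: "U \<in> carrier G" "q \<in> carrier G" using U q half_carrier by auto
  obtain w where w: "q = cl w" using carrier_cl c by blast
  have "U \<otimes> q \<otimes> cl (winv w) = U" using w c by (simp add: m_assoc)
  moreover have "U \<notin> half a" using half_enter_sg[of \<one> a U "{u}"] U u c by (auto simp: St_iff)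
  ultimately obtain u1 u2 where u1: "U \<otimes> q \<otimes> cl u1 \<otimes> inv (gen a) \<in> sg (Lk (fst a))"
    and pre: "\<And>v1 v2. u1 = v1 @ v2 \<Longrightarrow> U \<otimes> q \<otimes> cl v1 \<in> half a"
    using half_exit[OF q(2), of "winv w"] by metis
  let ?t = "U \<otimes> q \<otimes> cl u1 \<otimes> inv (gen a)"
  have "inv U \<otimes> ?t \<otimes> gen a = q \<otimes> cl u1" using c by (simp add: m_assoc)
  moreover have "inv U \<otimes> ?t \<otimes> gen a \<notin> half a"
    using shifted_not_half[OF sg_inv[OF U(1)] _ u u1] U c by simp
  ultimately have "q \<otimes> cl u1 \<notin> half a" by simp
  then obtain v1 v2 where v: "u1 = v1 @ flip a # v2" "q \<otimes> cl v1 \<otimes> inv (gen a) \<in> sg (Lk (fst a))"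
    using half_exit[OF q(1), of u1] by metis
  have "U \<otimes> (q \<otimes> cl v1 \<otimes> inv (gen a)) \<otimes> gen a = U \<otimes> q \<otimes> cl v1" using c by (simp add: m_assoc)
  then show False using shifted_not_half[OF U u v(2)] pre[OF v(1)] by simp
qed

end

context ext_graph
begin

text \<open>Take the element of the star subgroup nearest to \<open>y\<close>. Were it not in
  \<open>y\<close>, the first edge towards \<open>y\<close> would have its label outside the star,
  and its half-space would contain an element together with its translate by
  \<open>U\<close>.\<close>

lemma stabilised_vertex_meets_star:
  assumes y: "y \<in> verts" and u: "u \<in> V" and U: "U \<in> sg {u}" "expo u U \<noteq> 0"
    and stab: "\<And>q. q \<in> snd y \<Longrightarrow> U \<otimes> q \<in> snd y"
  shows "\<exists>h\<in>snd y. h \<in> sg (St u)"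
proof -
  obtain g where g: "g \<in> sg (St u)" and min: "\<And>h. h \<in> sg (St u) \<Longrightarrow> dist_to g y \<le> dist_to h y"
    using ex_has_least_nat[of "\<lambda>h. h \<in> sg (St u)" \<one> "\<lambda>h. dist_to h y"] by auto
  have gV: "g \<in> sg V" using g sg_mono[OF St_sub[OF u]] by blast
  obtain w where w: "w \<in> words V" "length w = dist_to g y" "g \<otimes> cl w \<in> snd y"
    using dist_to_word[OF y gV] by blast
  show ?thesis
  proof (cases w)
    case Nil
    then show ?thesis using w g by auto
  next
    case (Cons a v)
    have b: "beyond g a y" using first_step_beyond[OF y gV] w Cons by metis
    have "fst a \<notin> St u"
    proof
      assume "fst a \<in> St u"
      then have "g \<otimes> gen a \<in> sg (St u)" using sg_mult[OF g gen_sg] by blast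
      then show False using min beyond_closer[OF y gV b] by (metis leD)
    qed
    then have ua: "u \<notin> St (fst a)" using E_sym by (auto simp: St_iff)
    obtain q where q: "q \<in> snd y" using vertex_nonempty[OF y] by blast
    have c: "q \<in> carrier G" "g \<in> carrier G" "U \<in> carrier G" using vertex_carrier[OF y q] g U by auto
    have "inv g \<otimes> U = U \<otimes> inv g" using sg_St_commute[OF sg_inv[OF g] U(1)] .
    then have "inv g \<otimes> (U \<otimes> q) = U \<otimes> (inv g \<otimes> q)" using c by (simp add: m_assoc[symmetric])
    then have "U \<otimes> (inv g \<otimes> q) \<in> half a" "inv g \<otimes> q \<in> half a"
      using b q stab[OF q] unfolding beyond_def by metis+
    then show ?thesis using half_disjoint[OF U ua] by blast
  qed
qed

text \<open>Commuting with \<open>z\<close>, the element \<open>U\<close> stabilises the coset of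
  \<open>z\<close> modulo the star subgroup; that coset meets the star subgroup, hence equals
  it.\<close>

lemma centralizer_gen_pow:
  assumes u: "u \<in> V" and U: "U \<in> sg {u}" "expo u U \<noteq> 0" and z: "z \<in> sg V" "U \<otimes> z = z \<otimes> U"
  shows "z \<in> sg (St u)"
proof -
  have zc: "z \<in> carrier G" and Uc: "U \<in> carrier G" using z U by auto
  have USt: "U \<in> sg (St u)" using U(1) sg_mono[of "{u}" "St u"] by (auto simp: St_iff)
  have comm: "inv z \<otimes> U = U \<otimes> inv z" using commute_inv[OF z(2) Uc zc] .
  have "U \<otimes> q \<in> coset u z" if q: "q \<in> coset u z" for q
  proof -
    have qc: "q \<in> carrier G" "inv z \<otimes> q \<in> sg (St u)" using q by (auto simp: coset_def)
    have "inv z \<otimes> (U \<otimes> q) = U \<otimes> (inv z \<otimes> q)" using comm zc Uc qc by (simp add: m_assoc[symmetric])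
    then show ?thesis using sg_mult[OF USt qc(2)] qc Uc by (simp add: coset_def)
  qed
  then obtain h where h: "h \<in> coset u z" "h \<in> sg (St u)"
    using stabilised_vertex_meets_star[OF vertexI[OF u z(1)] u U] by auto
  then have "inv z \<in> sg (St u)" using sg_mult_cancel_right[OF inv_closed[OF zc] h(2)] by (simp add: coset_def)
  then show ?thesis using sg_inv[of "inv z"] zc by simp
qed

text \<open>All non-trivial powers of the conjugate encoded by \<open>x\<close>: \<open>k\<close> is
  positive and \<open>b\<close> carries the sign.\<close>

definition powers :: "('a \<times> 'a word set set) \<Rightarrow> 'a word set set" where
  "powers x = {g \<otimes> gen (fst x, b) [^] (k::nat) \<otimes> inv g | g b k. g \<in> snd x \<and> 0 < k}"

lemma powers_rep:
  assumes "p \<in> powers x" "x \<in> verts" "q \<in> snd x"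
  obtains b k where "0 < (k::nat)" "p = q \<otimes> gen (fst x, b) [^] k \<otimes> inv q"
proof -
  obtain g b k where g: "g \<in> snd x" "0 < (k::nat)" "p = g \<otimes> gen (fst x, b) [^] k \<otimes> inv g"
    using assms(1) unfolding powers_def by blast
  let ?U = "gen (fst x, b) [^] k"
  have t: "inv q \<otimes> g \<in> sg (St (fst x))" using vertex_diff[OF assms(2,3) g(1)] .
  have c: "g \<in> carrier G" "q \<in> carrier G" using vertex_carrier assms g by auto
  have "(inv q \<otimes> g) \<otimes> ?U = ?U \<otimes> (inv q \<otimes> g)"
    using sg_St_commute[OF t, of ?U] gen_pow_sg[of "(fst x, b)" k] by simp
  then have "q \<otimes> ((inv q \<otimes> g) \<otimes> ?U) \<otimes> inv g = q \<otimes> (?U \<otimes> (inv q \<otimes> g)) \<otimes> inv g" by simp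
  then have "p = q \<otimes> ?U \<otimes> inv q" using c g by (simp add: m_assoc)
  then show ?thesis using that g by blast
qed

lemma powers_sg: "x \<in> verts \<Longrightarrow> p \<in> powers x \<Longrightarrow> p \<in> sg V"
proof -
  assume x: "x \<in> verts" "p \<in> powers x"
  obtain q where q: "q \<in> snd x" using vertex_nonempty x by blast
  obtain b k where "p = q \<otimes> gen (fst x, b) [^] (k::nat) \<otimes> inv q" using powers_rep[OF x(2,1) q] by metis
  moreover have "gen (fst x, b) [^] k \<in> sg V"
    using gen_pow_sg[of "(fst x, b)" k] sg_mono[of "{fst x}" V] vertex_rep(1)[OF x(1) q] by auto
  ultimately show ?thesis using vertex_rep(3)[OF x(1) q] sg_mult sg_inv by metis
qed

lemma conj_commute:
  assumes "g \<in> carrier G" "a \<in> carrier G" "b \<in> carrier G"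
  shows "(g \<otimes> a \<otimes> inv g) \<otimes> (g \<otimes> b \<otimes> inv g) = g \<otimes> (a \<otimes> b) \<otimes> inv g"
  using assms by (simp add: m_assoc)

text \<open>The conjugate \<open>Z\<close> of \<open>U\<close> commutes with \<open>W\<close>, so it
  lies in the star subgroup of \<open>?w\<close>. Hence \<open>U\<close> stabilises the coset of
  \<open>z\<close>, which therefore contains some \<open>f\<close> over the star of
  \<open>?u\<close>. Conjugation by \<open>inv z \<otimes> f\<close> shows that \<open>?u\<close> is
  in the star of \<open>?w\<close>, and \<open>g \<otimes> f\<close> is common to both
  cosets.\<close>

lemma powers_commute_imp:
  assumes x: "x \<in> verts" "p \<in> powers x" and y: "y \<in> verts" "p' \<in> powers y" and pp: "p \<otimes> p' = p' \<otimes> p"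
  shows "x = y \<or> (x, y) \<in> adj"
proof -
  let ?u = "fst x" and ?w = "fst y"
  obtain g where g: "g \<in> snd x" using vertex_nonempty x by blast
  obtain h where h: "h \<in> snd y" using vertex_nonempty y by blast
  obtain b k where k: "0 < (k::nat)" "p = g \<otimes> gen (?u, b) [^] k \<otimes> inv g" using powers_rep[OF x(2,1) g] .
  obtain c m where m: "0 < (m::nat)" "p' = h \<otimes> gen (?w, c) [^] m \<otimes> inv h" using powers_rep[OF y(2,1) h] .
  define U where "U = gen (?u, b) [^] k"
  define W where "W = gen (?w, c) [^] m"
  have U: "U \<in> sg {?u}" "expo ?u U \<noteq> 0"
    unfolding U_def using gen_pow_sg[of "(?u, b)" k] gen_pow_expo[OF k(1), of "(?u, b)"] by auto
  have W: "W \<in> sg {?w}" "expo ?w W \<noteq> 0"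
    unfolding W_def using gen_pow_sg[of "(?w, c)" m] gen_pow_expo[OF m(1), of "(?w, c)"] by auto
  have uV: "?u \<in> V" and wV: "?w \<in> V" using vertex_rep(1) x y g h by auto
  have gV: "g \<in> sg V" and hV: "h \<in> sg V" using vertex_rep(3) x y g h by auto
  define z where "z = inv g \<otimes> h"
  have zV: "z \<in> sg V" unfolding z_def using sg_mult[OF sg_inv[OF gV] hV] .
  have car: "g \<in> carrier G" "h \<in> carrier G" "z \<in> carrier G" "U \<in> carrier G" "W \<in> carrier G"
    using gV hV zV U W by auto
  define Z where "Z = inv z \<otimes> U \<otimes> z"
  have Zc: "Z \<in> carrier G" unfolding Z_def using car by simp
  have ZW: "W \<otimes> Z = Z \<otimes> W"
  proof -
    have hz: "inv h \<otimes> g = inv z" unfolding z_def using car by (simp add: inv_mult_group)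
    have p: "inv h \<otimes> p \<otimes> h = Z"
    proof -
      have "inv h \<otimes> p \<otimes> h = (inv h \<otimes> g) \<otimes> U \<otimes> (inv g \<otimes> h)"
        unfolding k(2) U_def[symmetric] using car by (simp add: m_assoc)
      then show ?thesis unfolding hz Z_def z_def[symmetric] .
    qed
    have p': "inv h \<otimes> p' \<otimes> h = W" unfolding m(2) W_def[symmetric] using car by (simp add: m_assoc)
    have pc: "p \<in> carrier G" "p' \<in> carrier G" using powers_sg[OF x] powers_sg[OF y] by simp_all
    have "W \<otimes> Z = inv h \<otimes> (p' \<otimes> p) \<otimes> h" unfolding p[symmetric] p'[symmetric] using car pc by (simp add: m_assoc)
    also have "\<dots> = inv h \<otimes> (p \<otimes> p') \<otimes> h" using pp by simp
    also have "\<dots> = Z \<otimes> W" unfolding p[symmetric] p'[symmetric] using car pc by (simp add: m_assoc)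
    finally show ?thesis .
  qed
  have "U \<in> sg V" using U(1) sg_mono[of "{?u}" V] uV by auto
  then have "Z \<in> sg V" unfolding Z_def using zV sg_mult sg_inv by metis
  then have ZSt: "Z \<in> sg (St ?w)" using centralizer_gen_pow[OF wV W _ ZW] by blast
  have "U \<otimes> q \<in> coset ?w z" if q: "q \<in> coset ?w z" for q
  proof -
    have qc: "q \<in> carrier G" "inv z \<otimes> q \<in> sg (St ?w)" using q by (auto simp: coset_def)
    have "inv z \<otimes> (U \<otimes> q) = Z \<otimes> (inv z \<otimes> q)" unfolding Z_def using car qc by (simp add: m_assoc)
    then show ?thesis using sg_mult[OF ZSt qc(2)] qc car by (simp add: coset_def)
  qed
  then obtain f where f: "f \<in> coset ?w z" "f \<in> sg (St ?u)"
    using stabilised_vertex_meets_star[OF vertexI[OF wV zV] uV U] by auto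
  have fc: "f \<in> carrier G" "inv z \<otimes> f \<in> sg (St ?w)" using f by (auto simp: coset_def)
  have "inv (inv z \<otimes> f) \<otimes> Z \<otimes> (inv z \<otimes> f) = inv f \<otimes> (U \<otimes> f)"
    unfolding Z_def using car fc by (simp add: inv_mult_group m_assoc)
  also have "\<dots> = U" using sg_St_commute[OF f(2) U(1), symmetric] car fc by simp
  finally have "U \<in> sg (St ?w)" using sg_mult sg_inv fc(2) ZSt by metis
  then have uw: "?u \<in> St ?w" using expo_notin U by blast
  have fx: "g \<otimes> f \<in> snd x" using vertex_mult[OF x(1) g f(2)] .
  have "inv h \<otimes> (g \<otimes> f) = inv z \<otimes> f" unfolding z_def using car fc by (simp add: inv_mult_group m_assoc)
  then have fy: "g \<otimes> f \<in> snd y" using vertex_memI[OF y(1) h, of "g \<otimes> f"] fc car by simp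
  show ?thesis
  proof (cases "?u = ?w")
    case True
    then show ?thesis using vertex_eqI[OF x(1) y(1) _ fx fy] by blast
  next
    case False
    then have "(?u, ?w) \<in> E" using uw E_sym by (auto simp: St_iff)
    then show ?thesis using x(1) y(1) fx fy unfolding adj_def by blast
  qed
qed

lemma powers_commute:
  assumes "p \<in> powers x" "p' \<in> powers y" "x \<in> verts" "y \<in> verts" "x = y \<or> (x, y) \<in> adj"
  shows "p \<otimes> p' = p' \<otimes> p"
proof -
  have E: "fst x = fst y \<or> (fst x, fst y) \<in> E" using assms(5) unfolding adj_def by auto
  obtain q where q: "q \<in> snd x" "q \<in> snd y" using assms vertex_nonempty[of x] unfolding adj_def by auto
  obtain b k where k: "p = q \<otimes> gen (fst x, b) [^] (k::nat) \<otimes> inv q" using powers_rep[OF assms(1,3) q(1)] .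
  obtain c m where m: "p' = q \<otimes> gen (fst y, c) [^] (m::nat) \<otimes> inv q" using powers_rep[OF assms(2,4) q(2)] .
  have qc: "q \<in> carrier G" using vertex_carrier q assms by blast
  have "gen (fst x, b) [^] k \<otimes> gen (fst y, c) [^] m = gen (fst y, c) [^] m \<otimes> gen (fst x, b) [^] k"
    using sg_commute[OF gen_pow_sg gen_pow_sg, of "(fst x, b)" "(fst y, c)" k m] E by auto
  then show ?thesis unfolding k m using qc by (simp add: conj_commute)
qed

text \<open>Equal elements commute, so distinct vertices would be adjacent; then powers of different
  generators would coincide, which exponent sums forbid.\<close>

lemma powers_disjoint:
  assumes "p \<in> powers x" "p \<in> powers y" "x \<in> verts" "y \<in> verts"
  shows "x = y"
proof (rule ccontr)
  assume "x \<noteq> y"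
  then have a: "(x, y) \<in> adj" using powers_commute_imp[OF assms(3,1,4,2)] by blast
  then obtain q where q: "q \<in> snd x" "q \<in> snd y" unfolding adj_def by auto
  obtain b k where k: "0 < k" "p = q \<otimes> gen (fst x, b) [^] (k::nat) \<otimes> inv q" using powers_rep[OF assms(1,3) q(1)] .
  obtain c m where m: "0 < m" "p = q \<otimes> gen (fst y, c) [^] (m::nat) \<otimes> inv q" using powers_rep[OF assms(2,4) q(2)] .
  have qc: "q \<in> carrier G" using vertex_carrier q assms by blast
  have "inv q \<otimes> p \<otimes> q = gen (fst x, b) [^] k" unfolding k(2) using qc by (simp add: m_assoc)
  moreover have "inv q \<otimes> p \<otimes> q = gen (fst y, c) [^] m" unfolding m(2) using qc by (simp add: m_assoc)
  ultimately have "gen (fst x, b) [^] k \<in> sg {fst y}" using gen_pow_sg[of "(fst y, c)" m] by simp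
  moreover have "fst x \<noteq> fst y" using a E_irr unfolding adj_def by auto
  ultimately show False using expo_notin[of _ "{fst y}" "fst x"] gen_pow_expo[OF k(1), of "(fst x, b)"] by auto
qed

lemma conj_pow:
  assumes "q \<in> carrier G" "a \<in> carrier G"
  shows "(q \<otimes> a \<otimes> inv q) [^] (n::nat) = q \<otimes> a [^] n \<otimes> inv q"
  using assms by (induction n) (auto simp: m_assoc)

lemma powers_nonempty: "x \<in> verts \<Longrightarrow> \<exists>p. p \<in> powers x"
proof -
  assume "x \<in> verts"
  then obtain q where "q \<in> snd x" using vertex_nonempty by blast
  then have "q \<otimes> gen (fst x, True) [^] (1::nat) \<otimes> inv q \<in> powers x"
    unfolding powers_def mem_Collect_eq
    by (intro exI[of _ q] exI[of _ True] exI[of _ "1::nat"]) simp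
  then show ?thesis by blast
qed

lemma powers_inv:
  assumes "p \<in> powers x" "x \<in> verts"
  shows "inv p \<in> powers x"
proof -
  obtain q where q: "q \<in> snd x" using assms vertex_nonempty by blast
  have qc: "q \<in> carrier G" using vertex_carrier q assms by blast
  obtain b k where k: "0 < k" "p = q \<otimes> gen (fst x, b) [^] (k::nat) \<otimes> inv q" using powers_rep[OF assms q] .
  have "gen (fst x, \<not> b) = inv (gen (fst x, b))" using gen_flip[of "(fst x, b)"] by (simp add: flip_def)
  then have "inv p = q \<otimes> gen (fst x, \<not> b) [^] k \<otimes> inv q"
    unfolding k(2) using qc by (simp add: nat_pow_inv inv_mult_group m_assoc)
  then show ?thesis unfolding powers_def using q k(1) by blast
qed

lemma powers_pow:
  assumes "p \<in> powers x" "x \<in> verts" "0 < (n::nat)"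
  shows "p [^] n \<in> powers x"
proof -
  obtain q where q: "q \<in> snd x" using assms vertex_nonempty by blast
  obtain b k where k: "0 < k" "p = q \<otimes> gen (fst x, b) [^] (k::nat) \<otimes> inv q" using powers_rep[OF assms(1,2) q] .
  have "p [^] n = q \<otimes> gen (fst x, b) [^] (k * n) \<otimes> inv q"
    unfolding k(2) using conj_pow[of q] vertex_carrier[OF assms(2) q] by (simp add: nat_pow_pow)
  moreover have "0 < k * n" using k assms by simp
  ultimately show ?thesis unfolding powers_def using q by blast
qed

lemma powers_commensurable:
  assumes "p \<in> powers x" "p' \<in> powers x" "x \<in> verts"
  obtains m n where "0 < (m::nat)" "0 < (n::nat)" "p [^] m = p' [^] n \<or> p [^] m = inv (p' [^] n)"
proof -
  obtain q where q: "q \<in> snd x" using assms vertex_nonempty by blast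
  have qc: "q \<in> carrier G" using vertex_carrier q assms by blast
  obtain b k where k: "0 < k" "p = q \<otimes> gen (fst x, b) [^] (k::nat) \<otimes> inv q" using powers_rep[OF assms(1,3) q] .
  obtain c m where m: "0 < m" "p' = q \<otimes> gen (fst x, c) [^] (m::nat) \<otimes> inv q" using powers_rep[OF assms(2,3) q] .
  have 1: "p [^] m = q \<otimes> gen (fst x, b) [^] (k * m) \<otimes> inv q"
    unfolding k(2) using conj_pow[of q] qc by (simp add: nat_pow_pow)
  have 2: "p' [^] k = q \<otimes> gen (fst x, c) [^] (k * m) \<otimes> inv q"
    unfolding m(2) using conj_pow[of q] qc by (simp add: nat_pow_pow mult.commute)
  have "p [^] m = p' [^] k \<or> p [^] m = inv (p' [^] k)"
  proof (cases "b = c")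
    case True
    then show ?thesis using 1 2 by simp
  next
    case False
    then have "(fst x, b) = flip (fst x, c)" by (auto simp: flip_def)
    then have "gen (fst x, b) [^] (k * m) = inv (gen (fst x, c) [^] (k * m))"
      by (simp add: nat_pow_inv)
    then have "p [^] m = inv (p' [^] k)" unfolding 1 2 using qc by (simp add: inv_mult_group m_assoc)
    then show ?thesis by blast
  qed
  then show ?thesis using that[of m k] m k by blast
qed

end

section \<open>Elements with large centralizer\<close>

context raag_geometry
begin

text \<open>The condition between the two letters is on the group element, whatever word spells it;
  \<open>reduced_word_sg\<close> turns it into one on letters.\<close>

definition reduced_word :: "'a word \<Rightarrow> bool" where
  "reduced_word u \<longleftrightarrow> \<not> (\<exists>u1 a u2 u3. u = u1 @ a # u2 @ flip a # u3 \<and> cl u2 \<in> sg (Lk (fst a)))"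

lemma reduced_word_infix:
  assumes "reduced_word (u @ v @ w)"
  shows "reduced_word v"
proof (rule ccontr)
  assume "\<not> reduced_word v"
  then obtain v1 a v2 v3 where "v = v1 @ a # v2 @ flip a # v3" "cl v2 \<in> sg (Lk (fst a))"
    unfolding reduced_word_def by blast
  then have "u @ v @ w = (u @ v1) @ a # v2 @ flip a # (v3 @ w)" "cl v2 \<in> sg (Lk (fst a))" by simp_all
  then show False using assms unfolding reduced_word_def by blast
qed

lemma reduced_word_half:
  assumes "reduced_word (a # u)"
  shows "gen a \<otimes> cl u \<in> half a"
proof (rule ccontr)
  assume "gen a \<otimes> cl u \<notin> half a"
  then obtain u1 u2 where u: "u = u1 @ flip a # u2" "gen a \<otimes> cl u1 \<otimes> inv (gen a) \<in> sg (Lk (fst a))"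
    using half_exit[OF gen_half, of a u] by metis
  then have "cl u1 \<in> sg (Lk (fst a))" using conj_gen_Lk[OF cl_carrier u(2)] by simp
  moreover have "a # u = [] @ a # u1 @ flip a # u2" using u by simp
  ultimately show False using assms unfolding reduced_word_def by blast
qed

text \<open>The mirror image of \<open>reduced_word_half\<close>: seen from the last edge, the start
  of the path is on the near side.\<close>

lemma reduced_word_not_half:
  assumes "reduced_word (v @ [a])"
  shows "inv (cl v) \<notin> half a"
proof
  assume "inv (cl v) \<in> half a"
  then have "\<one> \<otimes> cl (winv v) \<in> half a" by simp
  then obtain t1 t2 where t: "winv v = t1 @ a # t2" "\<one> \<otimes> cl t1 \<in> sg (Lk (fst a))"
    using half_enter[OF one_closed one_not_half] by metis
  have "v = winv (t1 @ a # t2)" using t(1) by (metis winv_simps(4))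
  then have "v @ [a] = winv t2 @ flip a # winv t1 @ flip (flip a) # []" by simp
  moreover have "cl (winv t1) \<in> sg (Lk (fst (flip a)))" using t(2) sg_inv by simp
  ultimately show False using assms unfolding reduced_word_def by blast
qed

text \<open>The hyperplane of each letter separates the ends of the path, so a word over
  \<open>S\<close> with the same ends has to use that letter.\<close>

lemma reduced_word_sg:
  assumes "reduced_word u" "cl u \<in> sg S"
  shows "u \<in> words S"
proof -
  have "fst l \<in> S" if l: "l \<in> set u" for l
  proof -
    obtain v w where u: "u = v @ l # w" using l by (meson split_list)
    have r: "reduced_word (v @ [l])" "reduced_word (l # w)"
      using reduced_word_infix[of "[]" "v @ [l]" w] reduced_word_infix[of v "l # w" "[]"] assms(1) u by auto
    have "inv (cl v) \<otimes> cl u \<in> half l" using reduced_word_half[OF r(2)] u by (simp add: m_assoc)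
    then show ?thesis using half_enter_sg[OF _ reduced_word_not_half[OF r(1)] _ assms(2)] by simp
  qed
  then show ?thesis by (auto simp: words_def mem_Times_iff)
qed

section \<open>Cyclically shortest words and their axes\<close>

definition wpow :: "'a word \<Rightarrow> nat \<Rightarrow> 'a word" where
  "wpow c k = concat (replicate k c)"

lemma wpow_simps [simp]: "wpow c 0 = []" "wpow c (Suc k) = c @ wpow c k"
  by (simp_all add: wpow_def)

lemma wpow_add: "wpow c (j + k) = wpow c j @ wpow c k"
  by (simp add: wpow_def replicate_add)

lemma length_wpow [simp]: "length (wpow c k) = k * length c"
  by (induction k) auto

lemma nth_wpow: "i < k * length c \<Longrightarrow> wpow c k ! i = c ! (i mod length c)"
proof (induction k arbitrary: i)
  case (Suc k)
  show ?case
  proof (cases "i < length c")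
    case False
    then have "i mod length c = (i - length c) mod length c" by (simp add: le_mod_geq)
    then show ?thesis using Suc False by (auto simp: nth_append)
  qed (simp add: nth_append)
qed simp

lemma cl_wpow: "cl (wpow c k) = cl c [^] k"
proof (induction k)
  case (Suc k)
  have "cl (wpow c (Suc k)) = cl c \<otimes> cl c [^] k" using Suc by simp
  then show ?case using nat_pow_Suc2[of "cl c" k] by simp
qed simp

text \<open>Shortest in its conjugacy class in \<open>sg V\<close>, so that all powers are reduced
  and spell an axis.\<close>

definition cyc_min :: "'a set \<Rightarrow> 'a word \<Rightarrow> bool" where
  "cyc_min V c \<longleftrightarrow> c \<in> words V \<and> c \<noteq> [] \<and>
    (\<forall>g\<in>sg V. \<forall>d\<in>words V. cl c = g \<otimes> cl d \<otimes> inv g \<longrightarrow> length c \<le> length d)"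

lemma cyc_min_rotate:
  assumes "cyc_min V (p @ q)"
  shows "cyc_min V (q @ p)"
  unfolding cyc_min_def
proof (intro conjI ballI impI)
  show "q @ p \<in> words V" "q @ p \<noteq> []" using assms unfolding cyc_min_def by auto
  fix g d assume g: "g \<in> sg V" and d: "d \<in> words V" and e: "cl (q @ p) = g \<otimes> cl d \<otimes> inv g"
  have gc: "g \<in> carrier G" using g by simp
  have "cl (p @ q) = cl p \<otimes> cl (q @ p) \<otimes> inv (cl p)" by (simp add: m_assoc)
  also have "\<dots> = (cl p \<otimes> g) \<otimes> cl d \<otimes> inv (cl p \<otimes> g)"
    unfolding e using gc by (simp add: m_assoc inv_mult_group)
  finally have "cl (p @ q) = (cl p \<otimes> g) \<otimes> cl d \<otimes> inv (cl p \<otimes> g)" .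
  moreover have "cl p \<otimes> g \<in> sg V" using assms sg_mult[OF cl_sg g] unfolding cyc_min_def by simp
  ultimately have "length (p @ q) \<le> length d" using assms d unfolding cyc_min_def by blast
  then show "length (q @ p) \<le> length d" by simp
qed

lemma cyc_min_no_cancel:
  assumes "cyc_min V (a # u @ flip a # v)"
  shows "cl u \<notin> sg (Lk (fst a))"
proof
  assume u: "cl u \<in> sg (Lk (fst a))"
  have "gen a \<otimes> cl u = cl u \<otimes> gen a" using sg_Lk_gen_commute[OF u] by simp
  then have "gen a \<otimes> (cl u \<otimes> (inv (gen a) \<otimes> cl v)) = cl u \<otimes> cl v"
    by (metis cancel2 cl_carrier gen_carrier inv_closed m_assoc m_closed)
  then have "cl (a # u @ flip a # v) = \<one> \<otimes> cl (u @ v) \<otimes> inv \<one>" by simp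
  moreover have "u @ v \<in> words V" using assms unfolding cyc_min_def by auto
  ultimately have "length (a # u @ flip a # v) \<le> length (u @ v)"
    using assms sg_one unfolding cyc_min_def by blast
  then show False by simp
qed

text \<open>In a shortest cancellation the letters in between lie in the link of the cancelled letter,
  so it does not contain a full period and is visible in a rotation of \<open>c\<close>.\<close>

lemma cyc_min_reduced:
  assumes c: "cyc_min V c"
  shows "reduced_word (wpow c N)"
proof (rule ccontr)
  let ?W = "wpow c N" and ?n = "length c"
  define P where "P = (\<lambda>(u1, a, u2, u3). ?W = u1 @ a # u2 @ flip a # u3 \<and> cl u2 \<in> sg (Lk (fst a)))"
  assume "\<not> reduced_word ?W"
  then obtain x where "P x" unfolding reduced_word_def P_def by auto
  then obtain y where y: "P y" "\<And>z. P z \<Longrightarrow> length (fst (snd (snd y))) \<le> length (fst (snd (snd z)))"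
    using ex_has_least_nat[of P x "\<lambda>y. length (fst (snd (snd y)))"] by blast
  obtain u1 a u2 u3 where [simp]: "y = (u1, a, u2, u3)" by (cases y)
  have W: "?W = u1 @ a # u2 @ flip a # u3" and u2: "cl u2 \<in> sg (Lk (fst a))" using y(1) unfolding P_def by auto
  have "reduced_word u2"
  proof (rule ccontr)
    assume "\<not> reduced_word u2"
    then obtain v1 b v2 v3 where v: "u2 = v1 @ b # v2 @ flip b # v3" "cl v2 \<in> sg (Lk (fst b))"
      unfolding reduced_word_def by blast
    then have "P (u1 @ a # v1, b, v2, v3 @ flip a # u3)" using W unfolding P_def by simp
    then have "length u2 \<le> length v2" using y(2) by fastforce
    then show False using v by simp
  qed
  then have u2w: "u2 \<in> words (Lk (fst a))" using reduced_word_sg u2 by blast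
  have n0: "0 < ?n" using c unfolding cyc_min_def by simp
  define i where "i = length u1"
  define j where "j = i + 1 + length u2"
  have len: "j < N * ?n" using arg_cong[OF W, of length] unfolding j_def i_def by simp
  have Wi: "?W ! i = a" and Wj: "?W ! j = flip a"
    unfolding W i_def j_def by (simp_all add: nth_append)
  have Wu: "?W ! (i + 1 + k) = u2 ! k" if "k < length u2" for k
    unfolding W i_def using that by (simp add: nth_append)
  show False
  proof (cases "i + ?n \<le> j")
    case True
    then have ain: "?W ! (i + ?n) = a" using nth_wpow[of "i + ?n" N c] nth_wpow[of i N c] len Wi by simp
    then have "i + ?n \<noteq> j" using Wj by auto
    then have "?n - 1 < length u2" "i + 1 + (?n - 1) = i + ?n" using True n0 unfolding j_def by linarith+
    then have "u2 ! (?n - 1) = a" using Wu[of "?n - 1"] ain by metis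
    then have "a \<in> set u2" using \<open>?n - 1 < length u2\<close> nth_mem by metis
    then have "fst a \<in> Lk (fst a)" using u2w by (auto simp: words_def)
    then show False using E_irr by (simp add: Lk_iff)
  next
    case False
    \<comment> \<open>Rotating by \<open>r\<close> starts the period at the letter \<open>a\<close>,
      so that the cancelling pair lies within one period.\<close>
    define r where "r = i mod ?n"
    define d where "d = drop r c @ take r c"
    have d: "cyc_min V d" unfolding d_def using cyc_min_rotate[of V "take r c" "drop r c"] c by simp
    have dn: "d ! k = ?W ! (i + k)" if "k \<le> j - i" for k
    proof -
      have k: "k < ?n" "i + k < N * ?n" using that False len unfolding j_def by auto
      have "d = rotate r c" unfolding d_def r_def by (simp add: rotate_drop_take)
      then have "d ! k = c ! ((r + k) mod ?n)" using nth_rotate[OF k(1)] by simp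
      also have "(r + k) mod ?n = (i + k) mod ?n" unfolding r_def by (simp add: mod_add_left_eq)
      finally show ?thesis using nth_wpow[OF k(2)] by simp
    qed
    have ld: "length d = ?n" unfolding d_def by simp
    have "take (j - i + 1) d = a # u2 @ [flip a]"
    proof (rule nth_equalityI)
      show "length (take (j - i + 1) d) = length (a # u2 @ [flip a])" using ld False unfolding j_def by simp
      fix k assume "k < length (take (j - i + 1) d)"
      then have k: "k \<le> j - i" by simp
      have "(a # u2 @ [flip a]) ! k = ?W ! (i + k)" unfolding W i_def using k unfolding j_def i_def
        by (auto simp: nth_append nth_Cons')
      then show "take (j - i + 1) d ! k = (a # u2 @ [flip a]) ! k" using dn[OF k] k by simp
    qed
    then have "d = a # u2 @ flip a # drop (j - i + 1) d"
      by (metis append.assoc append_Cons append_Nil append_take_drop_id)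
    then show False using cyc_min_no_cancel[of V a u2] d u2 by metis
  qed
qed

lemma take_wpow: "i < k * length c \<Longrightarrow> \<exists>q r. r < length c \<and> take i (wpow c k) = wpow c q @ take r c"
proof (induction k arbitrary: i)
  case (Suc k)
  show ?case
  proof (cases "i < length c")
    case True
    then show ?thesis by (intro exI[of _ 0] exI[of _ i]) simp
  next
    case False
    then have "i - length c < k * length c" using Suc.prems by auto
    then obtain q r where "r < length c" "take (i - length c) (wpow c k) = wpow c q @ take r c"
      using Suc.IH by blast
    then show ?thesis using False by (intro exI[of _ "Suc q"] exI[of _ r]) simp
  qed
qed simp

lemma commute_int_pow:
  assumes "x \<otimes> y = y \<otimes> x" "x \<in> carrier G" "y \<in> carrier G"
  shows "x [^] (i::int) \<otimes> y = y \<otimes> x [^] i"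
proof (cases i rule: int_cases2)
  case (nonneg n)
  then show ?thesis using group_commutes_pow[OF assms] by (simp add: int_pow_int)
next
  case (nonpos n)
  have "x [^] n \<otimes> y = y \<otimes> x [^] n" using group_commutes_pow[OF assms] .
  then show ?thesis using commute_inv[of y "x [^] n"] nonpos assms by (simp add: int_pow_neg_int)
qed

lemma commute_int_pow2:
  assumes "x \<otimes> y = y \<otimes> x" "x \<in> carrier G" "y \<in> carrier G"
  shows "x [^] (i::int) \<otimes> y [^] (j::int) = y [^] j \<otimes> x [^] i"
proof -
  have "y \<otimes> x [^] i = x [^] i \<otimes> y" using commute_int_pow[OF assms] by simp
  then show ?thesis using commute_int_pow[of y "x [^] i" j] assms by simp
qed

definition bipow :: "'a word set \<Rightarrow> 'a word set \<Rightarrow> int \<Rightarrow> int \<Rightarrow> 'a word set" where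
  "bipow x y i j = x [^] i \<otimes> y [^] j"

lemma bipow_closed [simp]: "x \<in> carrier G \<Longrightarrow> y \<in> carrier G \<Longrightarrow> bipow x y i j \<in> carrier G"
  by (simp add: bipow_def)

lemma bipow_mult:
  assumes "x \<otimes> y = y \<otimes> x" "x \<in> carrier G" "y \<in> carrier G"
  shows "bipow x y i j \<otimes> bipow x y k m = bipow x y (i + k) (j + m)"
proof -
  have "bipow x y i j \<otimes> bipow x y k m = x [^] i \<otimes> (y [^] j \<otimes> x [^] k) \<otimes> y [^] m"
    unfolding bipow_def using assms(2,3) by (simp add: m_assoc)
  also have "\<dots> = x [^] i \<otimes> (x [^] k \<otimes> y [^] j) \<otimes> y [^] m" using commute_int_pow2[OF assms, of k j] by simp
  finally show ?thesis unfolding bipow_def using assms(2,3) by (simp add: m_assoc int_pow_mult)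
qed

lemma bipow_inv:
  assumes "x \<otimes> y = y \<otimes> x" "x \<in> carrier G" "y \<in> carrier G"
  shows "inv (bipow x y i j) = bipow x y (- i) (- j)"
proof -
  have "bipow x y (- i) (- j) \<otimes> bipow x y i j = \<one>" using bipow_mult[OF assms] by (simp add: bipow_def)
  then show ?thesis using assms by (intro inv_equality) auto
qed

lemma bipow_pow:
  assumes "x \<otimes> y = y \<otimes> x" "x \<in> carrier G" "y \<in> carrier G"
  shows "bipow x y i j [^] (n::nat) = bipow x y (i * int n) (j * int n)"
proof (induction n)
  case 0
  then show ?case by (simp add: bipow_def)
next
  case (Suc n)
  then show ?case using bipow_mult[OF assms] by (simp add: algebra_simps)
qed

lemma bipow_shift:
  assumes "x \<otimes> y = y \<otimes> x" "x \<in> carrier G" "y \<in> carrier G" "B \<in> carrier G" "T \<in> carrier G"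
  shows "inv (bipow x y i j \<otimes> B) \<otimes> (bipow x y 0 k \<otimes> T) = inv (bipow x y i (j - k) \<otimes> B) \<otimes> T"
proof -
  have "inv (bipow x y i j \<otimes> B) \<otimes> (bipow x y 0 k \<otimes> T) = inv B \<otimes> (inv (bipow x y i j) \<otimes> bipow x y 0 k) \<otimes> T"
    using assms by (simp add: inv_mult_group m_assoc)
  also have "inv (bipow x y i j) \<otimes> bipow x y 0 k = inv (bipow x y i (j - k))"
    unfolding bipow_inv[OF assms(1-3)] bipow_mult[OF assms(1-3)] by simp
  finally show ?thesis using assms by (simp add: inv_mult_group)
qed

text \<open>Two cosets containing \<open>T\<close> coincide, so the quotient of the translations
  stabilises the coset of \<open>B\<close>. For a link \<open>S\<close>, such a coset consists of
  the initial points of the edges of a hyperplane.\<close>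

lemma bipow_quotient:
  assumes xy: "x \<otimes> y = y \<otimes> x" "x \<in> carrier G" "y \<in> carrier G" and c: "B \<in> carrier G" "T \<in> carrier G"
    and L: "inv (bipow x y i j \<otimes> B) \<otimes> T \<in> sg S" "inv (bipow x y i' j' \<otimes> B) \<otimes> T \<in> sg S"
  shows "inv B \<otimes> bipow x y (i' - i) (j' - j) \<otimes> B \<in> sg S"
proof -
  have "(inv (bipow x y i j \<otimes> B) \<otimes> T) \<otimes> inv (inv (bipow x y i' j' \<otimes> B) \<otimes> T)
      = inv B \<otimes> (inv (bipow x y i j) \<otimes> bipow x y i' j') \<otimes> B"
    using xy c by (simp add: inv_mult_group m_assoc)
  also have "inv (bipow x y i j) \<otimes> bipow x y i' j' = bipow x y (i' - i) (j' - j)"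
    unfolding bipow_inv[OF xy] bipow_mult[OF xy] by simp
  finally show ?thesis using sg_mult[OF L(1) sg_inv[OF L(2)]] by simp
qed

lemma not_inj_nat:
  assumes "finite A" "\<And>m::nat. f m \<in> A"
  obtains m n where "m < n" "f m = f n"
proof -
  have "\<not> inj f"
    using assms finite_imageD[of f UNIV] finite_subset[of "range f" A] infinite_UNIV_nat by blast
  then obtain m n where "m \<noteq> n" "f m = f n" unfolding inj_def by blast
  then show ?thesis using that by (metis linorder_neqE_nat)
qed

text \<open>The hyperplane dual to the letter \<open>l\<close> of the axis of \<open>c\<close> is mapped by every element of the
  centralizer of \<open>c\<close> to a hyperplane crossing the axis, and up to powers of \<open>c\<close> there are only
  finitely many of these.\<close>

lemma axis_translate:
  assumes c: "cyc_min V c" and cb: "c = b @ l # r" and z: "z \<in> carrier G" "z \<otimes> cl c = cl c \<otimes> z"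
  shows "\<exists>m>0. \<exists>e. inv (cl b) \<otimes> bipow z (cl c) (int m) e \<otimes> cl b \<in> sg (Lk (fst l))"
proof -
  let ?f = "bipow z (cl c)" and ?B = "cl b" and ?L = "sg (Lk (fst l))" and ?n = "length c"
  note fm = bipow_mult[OF z(2,1) cl_carrier] and fi = bipow_inv[OF z(2,1) cl_carrier]
  note shift = bipow_shift[OF z(2,1) cl_carrier cl_carrier[of b]]
  note quot = bipow_quotient[OF z(2,1) cl_carrier cl_carrier[of b]]
  have fc: "?f i j \<in> carrier G" for i j using z by simp
  have f0: "?f 0 (int q) = cl (wpow c q)" for q by (simp add: bipow_def int_pow_int cl_wpow)
  note red = cyc_min_reduced[OF c]
  \<comment> \<open>The identity is before the \<open>M\<close>-th translate of the hyperplane along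
    the axis; all higher powers of \<open>c\<close> are beyond it.\<close>
  have before: "inv (?f 0 (int M) \<otimes> ?B) \<notin> half l" for M
  proof -
    have "wpow c (M + 1) = [] @ ((wpow c M @ b) @ [l]) @ r" unfolding wpow_add using cb by simp
    then have "reduced_word ((wpow c M @ b) @ [l])" using red[of "M + 1"] reduced_word_infix by metis
    then show ?thesis using reduced_word_not_half f0 by fastforce
  qed
  have after: "inv (?f 0 (int M) \<otimes> ?B) \<otimes> ?f 0 (int (M + Suc K)) \<in> half l" for M K
  proof -
    have w: "wpow c (M + Suc K) = (wpow c M @ b) @ (l # r @ wpow c K) @ []" unfolding wpow_add using cb by simp
    then have "reduced_word (l # r @ wpow c K)" using red[of "M + Suc K"] reduced_word_infix by metis
    then have "gen l \<otimes> cl (r @ wpow c K) \<in> half l" by (rule reduced_word_half)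
    moreover have "inv (?f 0 (int M) \<otimes> ?B) \<otimes> ?f 0 (int (M + Suc K)) = gen l \<otimes> cl (r @ wpow c K)"
      unfolding f0 w by (simp add: inv_mult_group m_assoc)
    ultimately show ?thesis by simp
  qed
  \<comment> \<open>No positive power of \<open>c\<close> maps the hyperplane to itself.\<close>
  have moves: "inv ?B \<otimes> ?f 0 (int (Suc K)) \<otimes> ?B \<notin> ?L" for K
  proof -
    have w: "wpow c (Suc K + 1) = b @ (l # r @ wpow c K @ b) @ (l # r)" unfolding wpow_add using cb by simp
    then have "reduced_word (l # r @ wpow c K @ b)" using red[of "Suc K + 1"] reduced_word_infix by metis
    then have "gen l \<otimes> cl (r @ wpow c K @ b) \<in> half l" by (rule reduced_word_half)
    moreover have "inv ?B \<otimes> ?f 0 (int (Suc K)) \<otimes> ?B = gen l \<otimes> cl (r @ wpow c K @ b)"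
    proof -
      have w2: "wpow c (Suc K) = b @ l # r @ wpow c K" by (simp add: cb)
      show ?thesis unfolding f0 w2 by (simp add: m_assoc)
    qed
    ultimately show ?thesis using sg_not_half by metis
  qed
  \<comment> \<open>For each \<open>i\<close>, some translate of the hyperplane by \<open>z\<close>
    to the \<open>i\<close> times a power of \<open>c\<close> crosses the axis.\<close>
  have step: "\<exists>M q s. s < ?n \<and> inv (?f (int i) M \<otimes> ?B) \<otimes> (?f 0 q \<otimes> cl (take s c)) \<in> ?L" for i
  proof (rule ccontr)
    assume no: "\<not> ?thesis"
    obtain y where y: "?f (int i) 0 = cl y" using carrier_cl fc by blast
    \<comment> \<open>Records a crossing off the axis: \<open>t\<close> tells whether it is on the
      initial or the final leg of the detour \<open>?w\<close> below, \<open>k\<close> is its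
      position on that leg.\<close>
    define bad where "bad M t k \<longleftrightarrow> k < length y \<and>
      inv (?f (int i) (int M) \<otimes> ?B) \<otimes> (if t then ?f (int i) 0 \<otimes> cl (take k (winv y)) else ?f 0 (int (2 * M)) \<otimes> cl (take k y)) \<in> ?L" for M t k
    have ex: "\<exists>t k. bad (Suc m) t k" for m
    proof -
      let ?M = "Suc m"
      let ?H = "?f (int i) (int ?M) \<otimes> ?B"
      \<comment> \<open>A detour from \<open>z^i\<close> to \<open>z^i c^(2M)\<close>: to the
        identity, along the axis and out again. Its ends are on different sides of the
        translate.\<close>
      let ?w = "winv y @ wpow c (2 * ?M) @ y"
      have iy: "cl (winv y) = ?f (- int i) 0" using y fi[of "int i" 0] by simp
      have split: "inv ?H = inv (?f 0 (int ?M) \<otimes> ?B) \<otimes> ?f (- int i) 0"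
      proof -
        have "?f (int i) (int ?M) = ?f (int i) 0 \<otimes> ?f 0 (int ?M)" using fm by simp
        then show ?thesis using fc fi by (simp add: inv_mult_group m_assoc)
      qed
      have start: "inv ?H \<otimes> ?f (int i) 0 = inv (?f 0 (int ?M) \<otimes> ?B)"
      proof -
        have "inv ?H \<otimes> ?f (int i) 0 = inv (?f 0 (int ?M) \<otimes> ?B) \<otimes> (?f (- int i) 0 \<otimes> ?f (int i) 0)"
          unfolding split using fc by (simp add: m_assoc)
        also have "?f (- int i) 0 \<otimes> ?f (int i) 0 = \<one>" unfolding fm by (simp add: bipow_def)
        finally show ?thesis using fc by simp
      qed
      have cw: "cl ?w = ?f 0 (int (2 * ?M))"
      proof -
        have "cl ?w = ?f (- int i) 0 \<otimes> (?f 0 (int (2 * ?M)) \<otimes> ?f (int i) 0)"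
          unfolding cl_append iy f0[symmetric] y[symmetric] ..
        then show ?thesis unfolding fm by simp
      qed
      have e: "2 * ?M = ?M + Suc m" by simp
      have "(inv ?H \<otimes> ?f (int i) 0) \<otimes> cl ?w \<in> half l"
        unfolding start cw unfolding e by (rule after)
      moreover have "inv ?H \<otimes> ?f (int i) 0 \<notin> half l" unfolding start using before[of ?M] .
      ultimately obtain u1 u2 where u: "?w = u1 @ l # u2" "inv ?H \<otimes> ?f (int i) 0 \<otimes> cl u1 \<in> ?L"
        using half_enter[of "inv ?H \<otimes> ?f (int i) 0" l ?w] fc by (metis inv_closed m_closed cl_carrier)
      have uin: "inv ?H \<otimes> (?f (int i) 0 \<otimes> cl u1) \<in> ?L" using u(2) fc by (simp add: m_assoc)
      have gN: "?f (int i) 0 \<otimes> cl (winv y @ wpow c N @ t) = ?f 0 (int N) \<otimes> cl t" for N t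
        unfolding y f0 by simp
      define k where "k = length u1"
      have tk: "u1 = take k ?w" unfolding k_def u(1) by simp
      have kl: "k < length ?w" unfolding k_def u(1) by simp
      consider "k < length y" | "length y \<le> k" "k - length y < 2 * ?M * ?n"
        | "length y \<le> k" "2 * ?M * ?n \<le> k - length y" by linarith
      then show ?thesis
      proof cases
        case 1
        then have "u1 = take k (winv y)" using tk by simp
        then have "bad ?M True k" unfolding bad_def using 1 uin by simp
        then show ?thesis by blast
      next
        case 2
        then obtain q s where qs: "s < ?n" "take (k - length y) (wpow c (2 * ?M)) = wpow c q @ take s c"
          using take_wpow by blast
        have "u1 = winv y @ wpow c q @ take s c" using tk 2 qs by simp
        then have "?f (int i) 0 \<otimes> cl u1 = ?f 0 (int q) \<otimes> cl (take s c)" using gN by metis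
        then show ?thesis using no uin qs(1) by metis
      next
        case 3
        let ?k = "k - length y - 2 * ?M * ?n"
        have tN: "take k (winv y @ wpow c N @ y) = winv y @ wpow c N @ take (k - length y - N * ?n) y"
          if "length y \<le> k" "N * ?n \<le> k - length y" for N using that by simp
        have "u1 = winv y @ wpow c (2 * ?M) @ take ?k y" using tk tN[OF 3] by metis
        then have "?f (int i) 0 \<otimes> cl u1 = ?f 0 (int (2 * ?M)) \<otimes> cl (take ?k y)" using gN by metis
        moreover have "?k < length y" using 3 kl by simp
        ultimately have "bad ?M False ?k" unfolding bad_def using uin by simp
        then show ?thesis by blast
      qed
    qed
    have "\<forall>m. \<exists>tk. bad (Suc m) (fst tk) (snd tk)" using ex by simp
    from choice[OF this] obtain F where F: "\<And>m. bad (Suc m) (fst (F m)) (snd (F m))" by blast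
    \<comment> \<open>Finitely many positions for infinitely many exponents, so two translates are
      crossed at the same position.\<close>
    have "F m \<in> UNIV \<times> {..<length y}" for m using F[of m] unfolding bad_def by (cases "F m") auto
    then obtain m m' where mm: "m < m'" "F m = F m'" using not_inj_nat[of "UNIV \<times> {..<length y}" F] by auto
    define K where "K = m' - m - 1"
    have K: "int (Suc m') - int (Suc m) = int (Suc K)" unfolding K_def using mm by simp
    show False
    proof (cases "fst (F m)")
      case True
      let ?T = "?f (int i) 0 \<otimes> cl (take (snd (F m)) (winv y))"
      have "inv (?f (int i) (int (Suc m)) \<otimes> ?B) \<otimes> ?T \<in> ?L" "inv (?f (int i) (int (Suc m')) \<otimes> ?B) \<otimes> ?T \<in> ?L"
        using F[of m] F[of m'] True mm unfolding bad_def by simp_all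
      then have "inv ?B \<otimes> ?f (int i - int i) (int (Suc m') - int (Suc m)) \<otimes> ?B \<in> ?L"
        by (rule quot[rotated]) (use fc in simp)
      then show False using moves[of K] unfolding K by simp
    next
      case False
      let ?Y = "cl (take (snd (F m)) y)"
      \<comment> \<open>On the final leg the point moves with \<open>M\<close>; shifting by the
        power \<open>2 * M\<close> fixes it at \<open>?Y\<close> and turns the exponent
        \<open>M\<close> into \<open>- M\<close>.\<close>
      have eq: "inv (?f (int i) (int M) \<otimes> ?B) \<otimes> (?f 0 (int (2 * M)) \<otimes> ?Y)
          = inv (?f (int i) (- int M) \<otimes> ?B) \<otimes> ?Y" for M
        using shift[of ?Y "int i" "int M" "int (2 * M)"] by simp
      have badD: "inv (?f (int i) (- int M) \<otimes> ?B) \<otimes> ?Y \<in> ?L" if "bad M False (snd (F m))" for M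
        using that eq[of M] unfolding bad_def by simp
      have "bad (Suc m) False (snd (F m))" "bad (Suc m') False (snd (F m))"
        using F[of m] F[of m'] False mm by simp_all
      then have "inv (?f (int i) (- int (Suc m)) \<otimes> ?B) \<otimes> ?Y \<in> ?L" "inv (?f (int i) (- int (Suc m')) \<otimes> ?B) \<otimes> ?Y \<in> ?L"
        using badD by blast+
      then have "inv ?B \<otimes> ?f (int i - int i) (- int (Suc m) - - int (Suc m')) \<otimes> ?B \<in> ?L"
        by (rule quot[OF cl_carrier, rotated])
      moreover have "- int (Suc m) - - int (Suc m') = int (Suc K)" using K by simp
      ultimately show False using moves[of K] by simp
    qed
  qed
  then obtain M q s where s: "\<And>i. s i < ?n"
    and L: "\<And>i. inv (?f (int i) (M i) \<otimes> ?B) \<otimes> (?f 0 (q i) \<otimes> cl (take (s i) c)) \<in> ?L"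
    by metis
  \<comment> \<open>There are only \<open>length c\<close> positions in a period, so two translates
    meet the axis at the same place up to a power of \<open>c\<close>.\<close>
  obtain i i' where ii: "i < i'" "s i = s i'" using not_inj_nat[of "{..<?n}" s] s by auto
  let ?R = "cl (take (s i) c)"
  have "inv (?f (int i) (M i - q i) \<otimes> ?B) \<otimes> ?R \<in> ?L" "inv (?f (int i') (M i' - q i') \<otimes> ?B) \<otimes> ?R \<in> ?L"
    using L[of i] L[of i'] ii shift[OF cl_carrier] by metis+
  then have "inv ?B \<otimes> ?f (int i' - int i) (M i' - q i' - (M i - q i)) \<otimes> ?B \<in> ?L"
    by (rule quot[OF cl_carrier])
  moreover have "int i' - int i = int (i' - i)" using ii by simp
  ultimately show ?thesis using ii by (intro exI[of _ "i' - i"]) (metis zero_less_diff)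
qed

lemma sg_pow: "x \<in> sg S \<Longrightarrow> x [^] (n::nat) \<in> sg S"
  by (induction n) (auto intro: sg_mult)

text \<open>Every element of this subgroup is the power of the generator given by its exponent
  sum.\<close>

lemma sg_single_trivial:
  assumes "K \<in> sg {s}" "expo s K = 0"
  shows "K = \<one>"
proof -
  obtain w where w: "w \<in> words {s}" "K = cl w" using assms(1) unfolding sg_def by blast
  have "cl w = gen (s, True) [^] exponent s w" using w(1)
  proof (induction w)
    case (Cons l w)
    then have IH: "cl w = gen (s, True) [^] exponent s w" and l: "fst l = s" by auto
    have "gen l = gen (s, True) [^] (if snd l then 1 else - 1 :: int)"
    proof (cases "snd l")
      case True
      then have "l = (s, True)" using l by (simp add: prod_eq_iff)
      then show ?thesis by simp
    next
      case False
      then have "l = flip (s, True)" using l by (simp add: prod_eq_iff)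
      then show ?thesis by (simp add: int_pow_neg)
    qed
    then have "cl (l # w) = gen (s, True) [^] (if snd l then 1 else - 1 :: int) \<otimes> gen (s, True) [^] exponent s w"
      using IH by simp
    also have "\<dots> = gen (s, True) [^] exponent s (l # w)"
      using l int_pow_mult[OF gen_carrier, symmetric] by simp
    finally show ?case .
  qed simp
  moreover have "exponent s w = 0" using assms(2) unfolding w(2) by simp
  ultimately show ?thesis using w(2) by simp
qed

lemma sg_commutator: "x \<in> sg S \<Longrightarrow> y \<in> sg S \<Longrightarrow> (x \<otimes> y) \<otimes> inv (y \<otimes> x) \<in> sg S"
  by (intro sg_mult sg_inv)

lemma commutator_shift:
  assumes "x \<in> carrier G" "y \<in> carrier G" "P \<in> carrier G" "Q \<in> carrier G"
    "P \<otimes> x = x \<otimes> P" "P \<otimes> y = y \<otimes> P" "Q \<otimes> x = x \<otimes> Q" "Q \<otimes> y = y \<otimes> Q" "P \<otimes> Q = Q \<otimes> P"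
  shows "((x \<otimes> P) \<otimes> (y \<otimes> Q)) \<otimes> inv ((y \<otimes> Q) \<otimes> (x \<otimes> P)) = (x \<otimes> y) \<otimes> inv (y \<otimes> x)"
proof -
  have "(x \<otimes> P) \<otimes> (y \<otimes> Q) = x \<otimes> (P \<otimes> y) \<otimes> Q" using assms(1-4) by (simp add: m_assoc)
  then have 1: "(x \<otimes> P) \<otimes> (y \<otimes> Q) = (x \<otimes> y) \<otimes> (P \<otimes> Q)" unfolding assms(6) using assms(1-4) by (simp add: m_assoc)
  have "(y \<otimes> Q) \<otimes> (x \<otimes> P) = y \<otimes> (Q \<otimes> x) \<otimes> P" using assms(1-4) by (simp add: m_assoc)
  then have 2: "(y \<otimes> Q) \<otimes> (x \<otimes> P) = (y \<otimes> x) \<otimes> (P \<otimes> Q)"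
    unfolding assms(7,9) using assms(1-4) by (simp add: m_assoc)
  show ?thesis unfolding 1 2 using assms(1-4) by (simp add: m_assoc inv_mult_group)
qed

lemma commutator_conj:
  assumes "g \<in> carrier G" "x \<in> carrier G" "y \<in> carrier G"
  shows "((inv g \<otimes> x \<otimes> g) \<otimes> (inv g \<otimes> y \<otimes> g)) \<otimes> inv ((inv g \<otimes> y \<otimes> g) \<otimes> (inv g \<otimes> x \<otimes> g))
    = inv g \<otimes> ((x \<otimes> y) \<otimes> inv (y \<otimes> x)) \<otimes> g"
  using assms by (simp add: m_assoc inv_mult_group)

lemma commuteI: "x \<in> carrier G \<Longrightarrow> y \<in> carrier G \<Longrightarrow> (x \<otimes> y) \<otimes> inv (y \<otimes> x) = \<one> \<Longrightarrow> x \<otimes> y = y \<otimes> x"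
  by (metis inv_closed inv_equality inv_inv m_closed)

end

context ext_graph
begin

text \<open>The two exponents of \<open>z\<close> are multiplied to a common one. Those of
  \<open>c\<close> may differ, since powers of \<open>c\<close> drop out of commutators by
  \<open>commutator_shift\<close>.\<close>

lemma axis_translate_two:
  assumes c: "cyc_min V c" "c = l # l' # r" and z: "z \<in> carrier G" "z \<otimes> cl c = cl c \<otimes> z"
  obtains a e e' where "0 < (a::nat)" "bipow z (cl c) (int a) e \<in> sg (Lk (fst l))"
    "inv (gen l) \<otimes> bipow z (cl c) (int a) e' \<otimes> gen l \<in> sg (Lk (fst l'))"
proof -
  obtain m e where m: "0 < (m::nat)" "bipow z (cl c) (int m) e \<in> sg (Lk (fst l))"
    using axis_translate[OF c(1) _ z, of "[]" l "l' # r"] c(2) z by auto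
  obtain m' e' where m': "0 < (m'::nat)" "inv (gen l) \<otimes> bipow z (cl c) (int m') e' \<otimes> gen l \<in> sg (Lk (fst l'))"
    using axis_translate[OF c(1) _ z, of "[l]" l' r] c(2) z by auto
  note bp = bipow_pow[OF z(2,1) cl_carrier]
  have "bipow z (cl c) (int (m * m')) (e * int m') \<in> sg (Lk (fst l))"
    using sg_pow[OF m(2), of m'] unfolding bp by simp
  moreover have "(inv (gen l) \<otimes> bipow z (cl c) (int m') e' \<otimes> gen l) [^] m =
      inv (gen l) \<otimes> bipow z (cl c) (int (m * m')) (e' * int m) \<otimes> gen l"
    using conj_pow[of "inv (gen l)" "bipow z (cl c) (int m') e'" m] z(1) unfolding bp by (simp add: mult.commute)
  then have "inv (gen l) \<otimes> bipow z (cl c) (int (m * m')) (e' * int m) \<otimes> gen l \<in> sg (Lk (fst l'))"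
    using sg_pow[OF m'(2), of m] by simp
  moreover have "0 < m * m'" using m m' by simp
  ultimately show ?thesis using that by blast
qed

text \<open>A commutator of suitable powers of \<open>z1\<close> and \<open>z2\<close> fixes two consecutive hyperplanes on the axis
  of \<open>c\<close>, so it lies in the subgroup generated by the common link of their labels, which has at
  most one vertex.\<close>

lemma centralizer_powers_commute:
  assumes c: "cyc_min V c" "c = l # l' # r" and ll: "fst l \<noteq> fst l'"
    and z1: "z1 \<in> carrier G" "z1 \<otimes> cl c = cl c \<otimes> z1" and z2: "z2 \<in> carrier G" "z2 \<otimes> cl c = cl c \<otimes> z2"
  obtains a1 a2 where "0 < (a1::nat)" "0 < (a2::nat)" "z1 [^] a1 \<otimes> z2 [^] a2 = z2 [^] a2 \<otimes> z1 [^] a1"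
proof -
  let ?C = "cl c"
  obtain a1 e1 f1 where a1: "0 < (a1::nat)" "bipow z1 ?C (int a1) e1 \<in> sg (Lk (fst l))"
    "inv (gen l) \<otimes> bipow z1 ?C (int a1) f1 \<otimes> gen l \<in> sg (Lk (fst l'))" using axis_translate_two[OF c z1] .
  obtain a2 e2 f2 where a2: "0 < (a2::nat)" "bipow z2 ?C (int a2) e2 \<in> sg (Lk (fst l))"
    "inv (gen l) \<otimes> bipow z2 ?C (int a2) f2 \<otimes> gen l \<in> sg (Lk (fst l'))" using axis_translate_two[OF c z2] .
  define x where "x = z1 [^] a1"
  define y where "y = z2 [^] a2"
  have xy: "x \<in> carrier G" "y \<in> carrier G" unfolding x_def y_def using z1 z2 by auto
  have bx: "bipow z1 ?C (int a1) e = x \<otimes> ?C [^] e" and b_y: "bipow z2 ?C (int a2) e = y \<otimes> ?C [^] e" for e :: int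
    unfolding bipow_def x_def y_def by (simp_all add: int_pow_int)
  have Cx: "?C [^] e \<otimes> x = x \<otimes> ?C [^] e" and Cy: "?C [^] e \<otimes> y = y \<otimes> ?C [^] e" for e :: int
    using commute_int_pow2[OF z1(2,1) cl_carrier, of "int a1" e] commute_int_pow2[OF z2(2,1) cl_carrier, of "int a2" e]
    unfolding x_def y_def by (simp_all add: int_pow_int)
  have CC: "?C [^] e \<otimes> ?C [^] f = ?C [^] f \<otimes> ?C [^] e" for e f :: int
    by (simp add: int_pow_mult[symmetric] add.commute)
  let ?K = "(x \<otimes> y) \<otimes> inv (y \<otimes> x)"
  have shift: "((x \<otimes> ?C [^] e) \<otimes> (y \<otimes> ?C [^] f)) \<otimes> inv ((y \<otimes> ?C [^] f) \<otimes> (x \<otimes> ?C [^] e)) = ?K" for e f :: int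
    by (rule commutator_shift) (auto simp: xy Cx Cy CC)
  have Kc: "?K \<in> carrier G" using xy by simp
  have "?K \<in> sg (Lk (fst l))"
    using a1(2) a2(2) unfolding bx b_y shift[of e1 e2, symmetric] by (rule sg_commutator)
  moreover have "inv (gen l) \<otimes> ?K \<otimes> gen l \<in> sg (Lk (fst l'))"
  proof -
    let ?X = "x \<otimes> ?C [^] f1" and ?Y = "y \<otimes> ?C [^] f2"
    have "((inv (gen l) \<otimes> ?X \<otimes> gen l) \<otimes> (inv (gen l) \<otimes> ?Y \<otimes> gen l)) \<otimes>
      inv ((inv (gen l) \<otimes> ?Y \<otimes> gen l) \<otimes> (inv (gen l) \<otimes> ?X \<otimes> gen l)) \<in> sg (Lk (fst l'))"
      using a1(3) a2(3) unfolding bx b_y by (rule sg_commutator)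
    moreover have "?X \<in> carrier G" "?Y \<in> carrier G" using xy by auto
    ultimately show ?thesis using commutator_conj[OF gen_carrier] shift[of f1 f2] by metis
  qed
  \<comment> \<open>The commutator commutes with \<open>gen l\<close>, so both memberships concern
    the same element.\<close>
  moreover have "inv (gen l) \<otimes> ?K \<otimes> gen l = ?K"
  proof -
    have "?K \<otimes> gen l = gen l \<otimes> ?K" using sg_Lk_gen_commute calculation(1) by blast
    then have "inv (gen l) \<otimes> (?K \<otimes> gen l) = ?K" using Kc by simp
    then show ?thesis using Kc by (simp add: m_assoc)
  qed
  ultimately have K: "?K \<in> sg (Lk (fst l) \<inter> Lk (fst l'))" using sg_inter by metis
  have "\<exists>s. Lk (fst l) \<inter> Lk (fst l') \<subseteq> {s}"
  proof (rule ccontr)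
    assume "\<not> ?thesis"
    then obtain s t where st: "s \<in> Lk (fst l) \<inter> Lk (fst l')" "t \<in> Lk (fst l) \<inter> Lk (fst l')" "s \<noteq> t" by blast
    then show False using base.no_square[of s "fst l" t "fst l'"] ll E_sym by (auto simp: Lk_iff)
  qed
  then obtain s where "?K \<in> sg {s}" using K sg_mono by blast
  moreover have "expo s ?K = 0" using xy by simp
  ultimately have "?K = \<one>" by (rule sg_single_trivial)
  then have "x \<otimes> y = y \<otimes> x" using commuteI xy by blast
  then show ?thesis using that a1 a2 unfolding x_def y_def by blast
qed

lemma constant_list:
  assumes "\<And>c1 x y c2. c = c1 @ x # y # c2 \<Longrightarrow> x = y" "c \<noteq> []"
  shows "c = replicate (length c) (hd c)"
  using assms
proof (induction c)
  case (Cons a c)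
  show ?case
  proof (cases c)
    case (Cons b d)
    have "x = y" if "c = c1 @ x # y # c2" for c1 x y c2 using Cons.prems(1)[of "a # c1" x y c2] that by simp
    then have "c = replicate (length c) (hd c)" using Cons.IH Cons by blast
    moreover have "a = b" using Cons.prems(1)[of "[]" a b d] Cons by simp
    ultimately show ?thesis using Cons by (metis length_Cons list.sel(1) replicate_Suc)
  qed simp
qed simp

text \<open>Replace \<open>p\<close> by a shortest conjugate \<open>c\<close>. Consecutive letters
  on one vertex agree, or they would cancel. If two consecutive letters have different vertices, a
  rotation brings them to the front and \<open>centralizer_powers_commute\<close> contradicts
  \<open>nc\<close>; otherwise \<open>c\<close> is a power of one letter.\<close>

theorem large_centralizer_powers:
  assumes p: "p \<in> sg V" "p \<noteq> \<one>"
    and z1: "z1 \<in> carrier G" "z1 \<otimes> p = p \<otimes> z1" and z2: "z2 \<in> carrier G" "z2 \<otimes> p = p \<otimes> z2"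
    and nc: "\<And>m n. 0 < (m::nat) \<Longrightarrow> 0 < (n::nat) \<Longrightarrow> z1 [^] m \<otimes> z2 [^] n \<noteq> z2 [^] n \<otimes> z1 [^] m"
  shows "\<exists>x\<in>verts. p \<in> powers x"
proof -
  define Q where "Q = (\<lambda>(g, c). g \<in> sg V \<and> c \<in> words V \<and> p = g \<otimes> cl c \<otimes> inv g)"
  obtain w where "w \<in> words V" "p = cl w" using p unfolding sg_def by blast
  then have "Q (\<one>, w)" unfolding Q_def by simp
  then obtain gc where gc: "Q gc" "\<And>y. Q y \<Longrightarrow> length (snd gc) \<le> length (snd y)"
    using ex_has_least_nat[of Q "(\<one>, w)" "\<lambda>y. length (snd y)"] by blast
  obtain g c where [simp]: "gc = (g, c)" by (cases gc)
  have g: "g \<in> sg V" "c \<in> words V" "p = g \<otimes> cl c \<otimes> inv g" using gc(1) unfolding Q_def by auto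
  have gcar: "g \<in> carrier G" using g by simp
  have cm: "cyc_min V c"
    unfolding cyc_min_def
  proof (intro conjI ballI impI)
    show "c \<in> words V" using g by simp
    show "c \<noteq> []" using g(3) p(2) gcar by auto
    fix h d assume h: "h \<in> sg V" "d \<in> words V" "cl c = h \<otimes> cl d \<otimes> inv h"
    have "p = (g \<otimes> h) \<otimes> cl d \<otimes> inv (g \<otimes> h)"
      unfolding g(3) h(3) using gcar h(1) by (simp add: m_assoc inv_mult_group)
    then have "Q (g \<otimes> h, d)" unfolding Q_def using h sg_mult[OF g(1)] by simp
    then show "length c \<le> length d" using gc(2) by fastforce
  qed
  have same: "x = y" if "c = c1 @ x # y # c2" "fst x = fst y" for c1 x y c2
  proof (rule ccontr)
    assume "x \<noteq> y"
    then have "y = flip x" using same_vertex_cases[of y x] that(2) by auto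
    moreover have "cyc_min V ((x # y # c2) @ c1)" using cyc_min_rotate[of V c1 "x # y # c2"] cm that(1) by simp
    ultimately have "cyc_min V (x # [] @ flip x # (c2 @ c1))" by simp
    then show False using cyc_min_no_cancel[of V x "[]"] by simp
  qed
  show ?thesis
  proof (cases "\<exists>c1 l l' c2. c = c1 @ l # l' # c2 \<and> fst l \<noteq> fst l'")
    case False
    then have "c = replicate (length c) (hd c)"
      using constant_list[of c] same cm unfolding cyc_min_def by metis
    then obtain k l where kl: "c = replicate k l" "0 < k" using cm unfolding cyc_min_def by (metis length_greater_0_conv)
    have lV: "fst l \<in> V" using kl g(2) by (cases k) auto
    let ?x = "(fst l, coset (fst l) g)"
    have "p = g \<otimes> gen (fst l, snd l) [^] k \<otimes> inv g" using g(3) kl(1) gen_pow by simp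
    moreover have "g \<in> snd ?x" using coset_self[OF gcar] by simp
    ultimately have "p \<in> powers ?x" unfolding powers_def using kl(2) by (metis (mono_tags, lifting) fst_conv mem_Collect_eq)
    then show ?thesis using vertexI[OF lV g(1)] by blast
  next
    case True
    then obtain c1 l l' c2 where c: "c = c1 @ l # l' # c2" "fst l \<noteq> fst l'" by blast
    define d where "d = l # l' # (c2 @ c1)"
    have dm: "cyc_min V d" using cyc_min_rotate[of V c1 "l # l' # c2"] cm c unfolding d_def by simp
    define h where "h = g \<otimes> cl c1"
    have hc: "h \<in> carrier G" unfolding h_def using gcar by simp
    have pd: "p = h \<otimes> cl d \<otimes> inv h"
      unfolding g(3) h_def d_def c(1) using gcar by (simp add: m_assoc inv_mult_group)
    have pc: "p \<in> carrier G" using p by simp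
    have dp: "cl d = inv h \<otimes> p \<otimes> h" unfolding pd using hc by (simp add: m_assoc)
    have conj: "(inv h \<otimes> z \<otimes> h) \<otimes> cl d = cl d \<otimes> (inv h \<otimes> z \<otimes> h)" if "z \<in> carrier G" "z \<otimes> p = p \<otimes> z" for z
    proof -
      have "(inv h \<otimes> z \<otimes> h) \<otimes> cl d = inv h \<otimes> (z \<otimes> p) \<otimes> h" unfolding dp using hc pc that(1) by (simp add: m_assoc)
      also have "\<dots> = cl d \<otimes> (inv h \<otimes> z \<otimes> h)" unfolding dp that(2) using hc pc that(1) by (simp add: m_assoc)
      finally show ?thesis .
    qed
    have zc: "inv h \<otimes> z1 \<otimes> h \<in> carrier G" "inv h \<otimes> z2 \<otimes> h \<in> carrier G" using hc z1 z2 by auto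
    obtain a1 a2 where a: "0 < (a1::nat)" "0 < (a2::nat)"
      "(inv h \<otimes> z1 \<otimes> h) [^] a1 \<otimes> (inv h \<otimes> z2 \<otimes> h) [^] a2 = (inv h \<otimes> z2 \<otimes> h) [^] a2 \<otimes> (inv h \<otimes> z1 \<otimes> h) [^] a1"
      using centralizer_powers_commute[OF dm d_def c(2) zc(1) conj[OF z1] zc(2) conj[OF z2]] .
    have pw: "(inv h \<otimes> z \<otimes> h) [^] (n::nat) = inv h \<otimes> z [^] n \<otimes> h" if "z \<in> carrier G" for z n
      using conj_pow[of "inv h" z n] hc that by simp
    have "inv h \<otimes> (z1 [^] a1 \<otimes> z2 [^] a2) \<otimes> h = inv h \<otimes> (z2 [^] a2 \<otimes> z1 [^] a1) \<otimes> h"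
      using a(3) unfolding pw[OF z1(1)] pw[OF z2(1)] using hc z1 z2 by (simp add: m_assoc)
    then have "h \<otimes> (inv h \<otimes> (z1 [^] a1 \<otimes> z2 [^] a2) \<otimes> h) \<otimes> inv h = h \<otimes> (inv h \<otimes> (z2 [^] a2 \<otimes> z1 [^] a1) \<otimes> h) \<otimes> inv h" by simp
    then have "z1 [^] a1 \<otimes> z2 [^] a2 = z2 [^] a2 \<otimes> z1 [^] a1" using hc z1 z2 by (simp add: m_assoc)
    then show ?thesis using nc a by blast
  qed
qed

end

section \<open>Embeddings and induced subgraphs\<close>

text \<open>A vertex goes to the one whose powers contain the image of a chosen power. Two
  neighbours in one copy supply the elements without commuting powers, and injectivity of
  \<open>h\<close> makes commutation detect adjacency in both directions.\<close>

lemma embedding_induces: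
  fixes G :: "'a word set monoid" and H :: "'b word set monoid"
  assumes A: "ext_graph V E G" and B: "ext_graph W F H"
    and deg: "\<And>v. v \<in> V \<Longrightarrow> \<exists>l m. l \<noteq> m \<and> (v, l) \<in> E \<and> (v, m) \<in> E"
    and h_sg: "\<And>x. x \<in> raag_geometry.sg E V \<Longrightarrow> h x \<in> raag_geometry.sg F W"
    and h_mult: "\<And>x y. x \<in> raag_geometry.sg E V \<Longrightarrow> y \<in> raag_geometry.sg E V \<Longrightarrow>
      h (x \<otimes>\<^bsub>G\<^esub> y) = h x \<otimes>\<^bsub>H\<^esub> h y"
    and h_inj: "inj_on h (raag_geometry.sg E V)"
  shows "\<exists>f. induced_emb (ext_graph.verts V E G) (ext_graph.adj V E G)
    (ext_graph.verts W F H) (ext_graph.adj W F H) f"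
proof -
  interpret A: ext_graph V E G by fact
  interpret B: ext_graph W F H by fact
  have h_comm: "x \<otimes>\<^bsub>G\<^esub> y = y \<otimes>\<^bsub>G\<^esub> x \<longleftrightarrow> h x \<otimes>\<^bsub>H\<^esub> h y = h y \<otimes>\<^bsub>H\<^esub> h x"
    if "x \<in> A.sg V" "y \<in> A.sg V" for x y
    using that h_mult A.sg_mult inj_onD[OF h_inj, of "x \<otimes>\<^bsub>G\<^esub> y" "y \<otimes>\<^bsub>G\<^esub> x"] by metis
  have h_one: "h \<one>\<^bsub>G\<^esub> = \<one>\<^bsub>H\<^esub>"
  proof -
    have c: "h \<one>\<^bsub>G\<^esub> \<in> carrier H" using h_sg[OF A.sg_one] by simp
    have "h \<one>\<^bsub>G\<^esub> \<otimes>\<^bsub>H\<^esub> h \<one>\<^bsub>G\<^esub> = h \<one>\<^bsub>G\<^esub>" using h_mult[OF A.sg_one A.sg_one] by simp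
    then show ?thesis using B.l_cancel_one c by simp
  qed
  have h_pow: "h (x [^]\<^bsub>G\<^esub> (n::nat)) = h x [^]\<^bsub>H\<^esub> n" if "x \<in> A.sg V" for x n
  proof (induction n)
    case (Suc n)
    then show ?case using h_mult[OF A.sg_pow[OF that, of n] that] by simp
  qed (simp add: h_one)
  have h_inv: "h (inv\<^bsub>G\<^esub> x) = inv\<^bsub>H\<^esub> (h x)" if "x \<in> A.sg V" for x
  proof -
    have "h (inv\<^bsub>G\<^esub> x) \<otimes>\<^bsub>H\<^esub> h x = \<one>\<^bsub>H\<^esub>"
      using h_mult[OF A.sg_inv[OF that] that] that h_one by simp
    then show ?thesis using B.inv_equality h_sg[OF that] h_sg[OF A.sg_inv[OF that]] by (metis B.sg_carrier)
  qed
  define P where "P x = (SOME p. p \<in> A.powers x)" for x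
  have P: "P x \<in> A.powers x" if "x \<in> A.verts" for x
    unfolding P_def using someI_ex[OF A.powers_nonempty[OF that]] .
  have Psg: "P x \<in> A.sg V" if "x \<in> A.verts" for x using A.powers_sg[OF that P[OF that]] .
  have ex: "\<exists>y. y \<in> B.verts \<and> h (P x) \<in> B.powers y" if x: "x \<in> A.verts" for x
  proof -
    obtain g where g: "g \<in> snd x" using A.vertex_nonempty[OF x] by blast
    note gr = A.vertex_rep[OF x g]
    obtain l m where lm: "l \<noteq> m" "(fst x, l) \<in> E" "(fst x, m) \<in> E" using deg[OF gr(1)] by blast
    have lmV: "l \<in> V" "m \<in> V" using lm A.base.R_sub by blast+
    let ?y = "(l, A.coset l g)" and ?z = "(m, A.coset m g)"
    have yz: "?y \<in> A.verts" "?z \<in> A.verts" using A.vertexI lmV gr by auto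
    have gin: "g \<in> A.coset u g" for u using A.coset_self gr(3) by simp
    have adj: "(?y, x) \<in> A.adj" "(?z, x) \<in> A.adj"
      unfolding A.adj_def using x yz lm A.E_sym g gin by auto
    have comm: "h (P v) \<otimes>\<^bsub>H\<^esub> h (P x) = h (P x) \<otimes>\<^bsub>H\<^esub> h (P v)" if "v \<in> A.verts" "(v, x) \<in> A.adj" for v
      using A.powers_commute[OF P[OF that(1)] P[OF x] that(1) x] that(2) h_comm[OF Psg[OF that(1)] Psg[OF x]] by blast
    have pne: "P x \<noteq> \<one>\<^bsub>G\<^esub>"
    proof
      assume one: "P x = \<one>\<^bsub>G\<^esub>"
      obtain b k where k: "0 < (k::nat)" "P x = g \<otimes>\<^bsub>G\<^esub> A.gen (fst x, b) [^]\<^bsub>G\<^esub> k \<otimes>\<^bsub>G\<^esub> inv\<^bsub>G\<^esub> g"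
        using A.powers_rep[OF P[OF x] x g] .
      have "A.expo (fst x) (P x) = A.expo (fst x) (A.gen (fst x, b) [^]\<^bsub>G\<^esub> k)"
        unfolding k(2) using gr(3) by simp
      moreover have "A.expo (fst x) \<one>\<^bsub>G\<^esub> = 0" using A.expo_cl[of "fst x" "[]"] by simp
      ultimately show False using A.gen_pow_expo[OF k(1), of "(fst x, b)"] one by simp
    qed
    \<comment> \<open>\<open>l\<close> and \<open>m\<close> are distinct and, there being no
      triangle, not adjacent.\<close>
    have "h (P ?y) [^]\<^bsub>H\<^esub> i \<otimes>\<^bsub>H\<^esub> h (P ?z) [^]\<^bsub>H\<^esub> j \<noteq> h (P ?z) [^]\<^bsub>H\<^esub> j \<otimes>\<^bsub>H\<^esub> h (P ?y) [^]\<^bsub>H\<^esub> i"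
      if ij: "0 < (i::nat)" "0 < (j::nat)" for i j
    proof
      assume "h (P ?y) [^]\<^bsub>H\<^esub> i \<otimes>\<^bsub>H\<^esub> h (P ?z) [^]\<^bsub>H\<^esub> j = h (P ?z) [^]\<^bsub>H\<^esub> j \<otimes>\<^bsub>H\<^esub> h (P ?y) [^]\<^bsub>H\<^esub> i"
      then have "P ?y [^]\<^bsub>G\<^esub> i \<otimes>\<^bsub>G\<^esub> P ?z [^]\<^bsub>G\<^esub> j = P ?z [^]\<^bsub>G\<^esub> j \<otimes>\<^bsub>G\<^esub> P ?y [^]\<^bsub>G\<^esub> i"
        using h_comm[OF A.sg_pow[OF Psg[OF yz(1)]] A.sg_pow[OF Psg[OF yz(2)]]]
          h_pow[OF Psg[OF yz(1)]] h_pow[OF Psg[OF yz(2)]] by simp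
      then have "?y = ?z \<or> (?y, ?z) \<in> A.adj"
        using A.powers_commute_imp[OF yz(1) A.powers_pow[OF P[OF yz(1)] yz(1) ij(1)] yz(2)
            A.powers_pow[OF P[OF yz(2)] yz(2) ij(2)]] by blast
      then have "l = m \<or> (l, m) \<in> E" unfolding A.adj_def by auto
      then show False using lm A.base.no_triangle[of "fst x" l m] by blast
    qed
    moreover have "h (P x) \<noteq> \<one>\<^bsub>H\<^esub>" using pne h_one inj_onD[OF h_inj _ Psg[OF x] A.sg_one] by metis
    ultimately show ?thesis
      using B.large_centralizer_powers[OF h_sg[OF Psg[OF x]] _ _ comm[OF yz(1) adj(1)] _ comm[OF yz(2) adj(2)]]
        h_sg[OF Psg[OF yz(1)]] h_sg[OF Psg[OF yz(2)]] B.sg_carrier by metis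
  qed
  define f where "f x = (SOME y. y \<in> B.verts \<and> h (P x) \<in> B.powers y)" for x
  have f: "f x \<in> B.verts" "h (P x) \<in> B.powers (f x)" if "x \<in> A.verts" for x
    using someI_ex[OF ex[OF that]] unfolding f_def by auto
  have inj: "inj_on f A.verts"
  proof (rule inj_onI)
    \<comment> \<open>The images have a common power up to sign, which injectivity of
      \<open>h\<close> pulls back to a common power for \<open>x\<close> and
      \<open>y\<close>.\<close>
    fix x y assume x: "x \<in> A.verts" and y: "y \<in> A.verts" and e: "f x = f y"
    obtain m n where mn: "0 < (m::nat)" "0 < (n::nat)"
      "h (P x) [^]\<^bsub>H\<^esub> m = h (P y) [^]\<^bsub>H\<^esub> n \<or> h (P x) [^]\<^bsub>H\<^esub> m = inv\<^bsub>H\<^esub> (h (P y) [^]\<^bsub>H\<^esub> n)"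
      using B.powers_commensurable[OF f(2)[OF x] _ f(1)[OF x], of "h (P y)"] f(2)[OF y] e by metis
    let ?p = "P x [^]\<^bsub>G\<^esub> m" and ?q = "P y [^]\<^bsub>G\<^esub> n"
    have sg: "?p \<in> A.sg V" "?q \<in> A.sg V" using A.sg_pow Psg x y by auto
    have "h ?p = h ?q \<or> h ?p = h (inv\<^bsub>G\<^esub> ?q)"
      using mn(3) h_pow[OF Psg[OF x]] h_pow[OF Psg[OF y]] h_inv[OF sg(2)] by simp
    then have "?p = ?q \<or> ?p = inv\<^bsub>G\<^esub> ?q"
      using inj_onD[OF h_inj _ sg] inj_onD[OF h_inj _ sg(1) A.sg_inv[OF sg(2)]] by blast
    moreover have "?q \<in> A.powers y" "inv\<^bsub>G\<^esub> ?q \<in> A.powers y"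
      using A.powers_pow[OF P[OF y] y mn(2)] A.powers_inv[OF _ y] by blast+
    ultimately have "?p \<in> A.powers y" by metis
    then show "x = y" using A.powers_disjoint[OF A.powers_pow[OF P[OF x] x mn(1)] _ x y] by blast
  qed
  have "induced_emb A.verts A.adj B.verts B.adj f"
    unfolding induced_emb_def
  proof (intro conjI ballI)
    show "f ` A.verts \<subseteq> B.verts" using f by blast
    show "inj_on f A.verts" using inj .
    fix x y assume x: "x \<in> A.verts" and y: "y \<in> A.verts"
    show "(x, y) \<in> A.adj \<longleftrightarrow> (f x, f y) \<in> B.adj"
    proof
      assume a: "(x, y) \<in> A.adj"
      have "h (P x) \<otimes>\<^bsub>H\<^esub> h (P y) = h (P y) \<otimes>\<^bsub>H\<^esub> h (P x)"
        using A.powers_commute[OF P[OF x] P[OF y] x y] a h_comm[OF Psg[OF x] Psg[OF y]] by blast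
      then have "f x = f y \<or> (f x, f y) \<in> B.adj" using B.powers_commute_imp[OF f[OF x] f[OF y]] by blast
      moreover have "x \<noteq> y" using a A.X.Rirr by blast
      ultimately show "(f x, f y) \<in> B.adj" using inj_onD[OF inj _ x y] by blast
    next
      assume a: "(f x, f y) \<in> B.adj"
      have "h (P x) \<otimes>\<^bsub>H\<^esub> h (P y) = h (P y) \<otimes>\<^bsub>H\<^esub> h (P x)"
        using B.powers_commute[OF f(2)[OF x] f(2)[OF y] f(1)[OF x] f(1)[OF y]] a by blast
      then have "P x \<otimes>\<^bsub>G\<^esub> P y = P y \<otimes>\<^bsub>G\<^esub> P x" using h_comm[OF Psg[OF x] Psg[OF y]] by blast
      then have "x = y \<or> (x, y) \<in> A.adj" using A.powers_commute_imp[OF x P[OF x] y P[OF y]] by blast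
      then show "(x, y) \<in> A.adj" using a B.X.Rirr by blast
    qed
  qed
  then show ?thesis by blast
qed

text \<open>A derivation over the full type restricts to one over \<open>V\<close>, so the
  additional generators identify nothing new.\<close>

lemma (in raag_geometry) raag_class_eq_cl_iff:
  assumes "E \<subseteq> V \<times> V" "u \<in> words V" "v \<in> words V"
  shows "raag_class V E u = raag_class V E v \<longleftrightarrow> cl u = cl v"
proof -
  have "raag_eq UNIV E u v" if "raag_eq V E u v" using that by (rule raag_eq_mono) auto
  moreover have "raag_eq V E u v" if "raag_eq UNIV E u v"
    using raag_eq_restrict[OF that, of V V] assms restrict_word_id[OF assms(2)] restrict_word_id[OF assms(3)]
    by (simp add: Int_absorb2)
  ultimately show ?thesis using raag_class_eq_iff[OF assms(2,3), of E] cl_eq_iff by blast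
qed

lemma embeds_sg_map:
  assumes emb: "embeds (raag V E) (raag W F)" and E: "E \<subseteq> V \<times> V" and F: "F \<subseteq> W \<times> W"
    and A: "raag_geometry E G" and B: "raag_geometry F H"
  obtains h where "\<And>x. x \<in> raag_geometry.sg E V \<Longrightarrow> h x \<in> raag_geometry.sg F W"
    "\<And>x y. x \<in> raag_geometry.sg E V \<Longrightarrow> y \<in> raag_geometry.sg E V \<Longrightarrow> h (x \<otimes>\<^bsub>G\<^esub> y) = h x \<otimes>\<^bsub>H\<^esub> h y"
    "inj_on h (raag_geometry.sg E V)"
proof -
  interpret A: raag_geometry E G by fact
  interpret B: raag_geometry F H by fact
  obtain f where f: "f \<in> hom (raag V E) (raag W F)" "inj_on f (carrier (raag V E))"
    using emb unfolding embeds_def mon_def by blast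
  have "\<exists>w. w \<in> words W \<and> f (raag_class V E u) = raag_class W F w" if "u \<in> words V" for u
    using f(1) that unfolding hom_def raag_carrier by blast
  then obtain k where k: "\<And>u. u \<in> words V \<Longrightarrow> k u \<in> words W \<and> f (raag_class V E u) = raag_class W F (k u)"
    by metis
  have k_eq: "B.cl (k u) = B.cl (k v) \<longleftrightarrow> A.cl u = A.cl v" if uv: "u \<in> words V" "v \<in> words V" for u v
  proof -
    have "B.cl (k u) = B.cl (k v) \<longleftrightarrow> f (raag_class V E u) = f (raag_class V E v)"
      using B.raag_class_eq_cl_iff[OF F, of "k u" "k v"] k uv by simp
    also have "\<dots> \<longleftrightarrow> raag_class V E u = raag_class V E v"
      using inj_on_eq_iff[OF f(2)] uv by (simp add: raag_carrier)
    finally show ?thesis using A.raag_class_eq_cl_iff[OF E uv] by simp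
  qed
  have k_app: "B.cl (k (u @ v)) = B.cl (k u) \<otimes>\<^bsub>H\<^esub> B.cl (k v)" if uv: "u \<in> words V" "v \<in> words V" for u v
  proof -
    have "raag_class W F (k (u @ v)) = f (raag_class V E u \<otimes>\<^bsub>raag V E\<^esub> raag_class V E v)"
      using k[of "u @ v"] uv raag_mult[OF uv E] by simp
    also have "\<dots> = f (raag_class V E u) \<otimes>\<^bsub>raag W F\<^esub> f (raag_class V E v)"
      using hom_mult[OF f(1)] uv by (simp add: raag_carrier)
    also have "\<dots> = raag_class W F (k u @ k v)" using k uv raag_mult[OF _ _ F] by simp
    finally have "B.cl (k (u @ v)) = B.cl (k u @ k v)"
      using B.raag_class_eq_cl_iff[OF F] k uv by simp
    then show ?thesis by simp
  qed
  define w where "w x = (SOME u. u \<in> words V \<and> A.cl u = x)" for x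
  have w: "w x \<in> words V" "A.cl (w x) = x" if "x \<in> A.sg V" for x
  proof -
    have "\<exists>u. u \<in> words V \<and> A.cl u = x" using that unfolding A.sg_def by blast
    then show "w x \<in> words V" "A.cl (w x) = x" unfolding w_def by (metis (mono_tags, lifting) someI_ex)+
  qed
  define h where "h x = B.cl (k (w x))" for x
  show ?thesis
  proof (rule that[of h])
    show "h x \<in> B.sg W" if "x \<in> A.sg V" for x unfolding h_def using B.cl_sg k w that by blast
    show "h (x \<otimes>\<^bsub>G\<^esub> y) = h x \<otimes>\<^bsub>H\<^esub> h y" if "x \<in> A.sg V" "y \<in> A.sg V" for x y
    proof -
      have xy: "x \<otimes>\<^bsub>G\<^esub> y \<in> A.sg V" using that A.sg_mult by blast
      have "A.cl (w (x \<otimes>\<^bsub>G\<^esub> y)) = A.cl (w x @ w y)" using w[OF xy] w[OF that(1)] w[OF that(2)] by simp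
      then have "h (x \<otimes>\<^bsub>G\<^esub> y) = B.cl (k (w x @ w y))"
        unfolding h_def using k_eq[of "w (x \<otimes>\<^bsub>G\<^esub> y)" "w x @ w y"] w xy that by simp
      then show ?thesis unfolding h_def using k_app w that by simp
    qed
    show "inj_on h (A.sg V)"
    proof (rule inj_onI)
      fix x y assume "x \<in> A.sg V" "y \<in> A.sg V" "h x = h y"
      then show "x = y" unfolding h_def using k_eq[of "w x" "w y"] w by metis
    qed
  qed
qed

lemma graph_iso_sym:
  assumes "graph_iso V E W F"
  shows "graph_iso W F V E"
proof -
  obtain f where f: "bij_betw f V W" "\<And>x y. x \<in> V \<Longrightarrow> y \<in> V \<Longrightarrow> (x, y) \<in> E \<longleftrightarrow> (f x, f y) \<in> F"
    using assms unfolding graph_iso_def by blast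
  let ?g = "inv_into V f"
  have g: "bij_betw ?g W V" using bij_betw_inv_into[OF f(1)] .
  have "(x, y) \<in> F \<longleftrightarrow> (?g x, ?g y) \<in> E" if "x \<in> W" "y \<in> W" for x y
    using f(2)[of "?g x" "?g y"] that bij_betw_inv_into_right[OF f(1)] bij_betwE[OF g] by simp
  then show ?thesis unfolding graph_iso_def using g by blast
qed

lemma raag_eq_map:
  assumes "raag_eq V E u v" "f ` V \<subseteq> W" "\<And>x y. (x, y) \<in> E \<Longrightarrow> (f x, f y) \<in> F"
  shows "raag_eq W F (map (apfst f) u) (map (apfst f) v)"
proof -
  have w: "map (apfst f) w \<in> words W" if "w \<in> words V" for w
    using that assms(2) by (induction w) auto
  show ?thesis using assms(1)
  proof induction
    case (cancel xs ys x b)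
    then show ?case using raag_eq.cancel[OF w w, of xs ys "f x" F b] assms(2) by auto
  next
    case (commute xs ys u v)
    then show ?case using raag_eq.commute[OF w w, of xs ys "f u" "f v" F] assms(3) by auto
  qed (auto intro: raag_eq.refl raag_eq.sym raag_eq.trans w)
qed

lemma graph_iso_embeds:
  assumes iso: "graph_iso V E W F" and E: "E \<subseteq> V \<times> V" and F: "F \<subseteq> W \<times> W"
  shows "embeds (raag V E) (raag W F)"
proof -
  obtain f where f: "bij_betw f V W" "\<And>x y. x \<in> V \<Longrightarrow> y \<in> V \<Longrightarrow> (x, y) \<in> E \<longleftrightarrow> (f x, f y) \<in> F"
    using iso unfolding graph_iso_def by blast
  let ?g = "inv_into V f"
  let ?m = "map (apfst f)"
  have fV: "f ` V \<subseteq> W" and gW: "?g ` W \<subseteq> V" using f(1) bij_betw_inv_into[OF f(1)] by (auto simp: bij_betw_def)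
  have mw: "?m w \<in> words W" if "w \<in> words V" for w using that fV by (induction w) auto
  have gm: "map (apfst ?g) (?m w) = w" if "w \<in> words V" for w
    using that bij_betw_inv_into_left[OF f(1)] by (induction w) (auto simp: apfst_def map_prod_def split: prod.splits)
  have eq: "raag_eq V E u v \<longleftrightarrow> raag_eq W F (?m u) (?m v)" if uv: "u \<in> words V" "v \<in> words V" for u v
  proof
    show "raag_eq V E u v \<Longrightarrow> raag_eq W F (?m u) (?m v)"
      using raag_eq_map[of V E u v f W F] fV f(2) E by blast
    assume "raag_eq W F (?m u) (?m v)"
    moreover have "(?g x, ?g y) \<in> E" if "(x, y) \<in> F" for x y
    proof -
      have xy: "x \<in> W" "y \<in> W" using that F by auto
      then have "?g x \<in> V" "?g y \<in> V" "f (?g x) = x" "f (?g y) = y"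
        using gW bij_betw_inv_into_right[OF f(1)] by auto
      then show ?thesis using f(2)[of "?g x" "?g y"] that by simp
    qed
    ultimately have "raag_eq V E (map (apfst ?g) (?m u)) (map (apfst ?g) (?m v))"
      using raag_eq_map[of W F "?m u" "?m v" ?g V E] gW by blast
    then show "raag_eq V E u v" using gm uv by simp
  qed
  define \<phi> where "\<phi> A = raag_class W F (?m (SOME w. w \<in> words V \<and> raag_class V E w = A))" for A
  have phi: "\<phi> (raag_class V E w) = raag_class W F (?m w)" if "w \<in> words V" for w
  proof -
    let ?u = "SOME u. u \<in> words V \<and> raag_class V E u = raag_class V E w"
    have u: "?u \<in> words V \<and> raag_class V E ?u = raag_class V E w"
      by (rule someI[of _ w]) (use that in simp)
    then have "raag_eq W F (?m ?u) (?m w)" using eq that raag_class_eq_iff[of ?u V w E] by blast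
    then show ?thesis unfolding \<phi>_def using raag_class_eq_iff[of "?m ?u" W "?m w" F] mw u that by blast
  qed
  have "\<phi> \<in> hom (raag V E) (raag W F)"
  proof (rule homI)
    show "\<phi> x \<in> carrier (raag W F)" if "x \<in> carrier (raag V E)" for x
      using that phi mw by (auto simp: raag_carrier)
    show "\<phi> (x \<otimes>\<^bsub>raag V E\<^esub> y) = \<phi> x \<otimes>\<^bsub>raag W F\<^esub> \<phi> y"
      if "x \<in> carrier (raag V E)" "y \<in> carrier (raag V E)" for x y
    proof -
      obtain u v where uv: "u \<in> words V" "v \<in> words V" "x = raag_class V E u" "y = raag_class V E v"
        using \<open>x \<in> carrier (raag V E)\<close> \<open>y \<in> carrier (raag V E)\<close> unfolding raag_carrier by blast
      then show ?thesis using phi[of "u @ v"] phi[of u] phi[of v] raag_mult[OF _ _ E] raag_mult[OF mw mw F] by simp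
    qed
  qed
  moreover have "inj_on \<phi> (carrier (raag V E))"
  proof (rule inj_onI)
    fix x y assume "x \<in> carrier (raag V E)" "y \<in> carrier (raag V E)" and e: "\<phi> x = \<phi> y"
    then obtain u v where uv: "u \<in> words V" "v \<in> words V" "x = raag_class V E u" "y = raag_class V E v"
      unfolding raag_carrier by blast
    then have "raag_eq V E u v"
      using e phi eq raag_class_eq_iff[OF mw mw, of u v] by simp
    then show "x = y" using uv raag_class_eq_iff[of u V v E] by simp
  qed
  ultimately show ?thesis unfolding embeds_def mon_def by blast
qed

section \<open>Atomic graphs\<close>

lemma atomic_girth5:
  assumes "atomic V E"
  shows "girth5_graph V E"
proof
  have s: "simple_graph V E" and cyc: "\<not> has_cycle_of_length V E 3" "\<not> has_cycle_of_length V E 4"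
    using assms unfolding atomic_def by auto
  show E: "E \<subseteq> V \<times> V" and sE: "sym E" and iE: "irrefl E" using s unfolding simple_graph_def by auto
  have ne: "x \<noteq> y" if "(x, y) \<in> E" for x y using that iE by (auto simp: irrefl_def)
  have sym: "(y, x) \<in> E" if "(x, y) \<in> E" for x y using that sE by (meson symD)
  show "(a, c) \<notin> E" if h: "(a, b) \<in> E" "(b, c) \<in> E" for a b c
  proof
    assume ac: "(a, c) \<in> E"
    let ?cs = "[a, b, c]"
    have "\<forall>i<3. (?cs ! i, ?cs ! ((i + 1) mod 3)) \<in> E"
    proof (intro allI impI)
      fix i :: nat assume "i < 3"
      then consider "i = 0" | "i = 1" | "i = 2" by linarith
      then show "(?cs ! i, ?cs ! ((i + 1) mod 3)) \<in> E" using h sym[OF ac] by cases auto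
    qed
    moreover have "distinct ?cs" "set ?cs \<subseteq> V" "length ?cs = 3" using h ac ne E by auto
    ultimately have "has_cycle_of_length V E 3" unfolding has_cycle_of_length_def by blast
    then show False using cyc by blast
  qed
  show "a = c \<or> b = d" if h: "(a, b) \<in> E" "(b, c) \<in> E" "(c, d) \<in> E" "(d, a) \<in> E" for a b c d
  proof (rule ccontr)
    assume n: "\<not> (a = c \<or> b = d)"
    let ?cs = "[a, b, c, d]"
    have "\<forall>i<4. (?cs ! i, ?cs ! ((i + 1) mod 4)) \<in> E"
    proof (intro allI impI)
      fix i :: nat assume "i < 4"
      then consider "i = 0" | "i = 1" | "i = 2" | "i = 3" by linarith
      then show "(?cs ! i, ?cs ! ((i + 1) mod 4)) \<in> E" using h by cases auto
    qed
    moreover have "distinct ?cs" "set ?cs \<subseteq> V" "length ?cs = 4" using h n ne E by auto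
    moreover have "(3::nat) \<le> 4" by simp
    ultimately have "has_cycle_of_length V E 4" unfolding has_cycle_of_length_def by blast
    then show False using cyc by blast
  qed
qed

text \<open>Valence one is excluded by definition, valence zero by connectedness once there is a
  second vertex.\<close>

lemma atomic_degree:
  assumes at: "atomic V E" and ns: "\<nexists>v. V = {v}" and v: "v \<in> V"
  shows "\<exists>l m. l \<noteq> m \<and> (v, l) \<in> E \<and> (v, m) \<in> E"
proof -
  interpret girth5_graph V E using atomic_girth5[OF at] .
  have conn: "connected_on V E" and fin: "finite V" and deg: "card (neighbours E v) \<noteq> 1"
    using at v unfolding atomic_def connected_graph_def simple_graph_def by auto
  have "\<exists>w\<in>V. w \<noteq> v"
  proof (rule ccontr)
    assume "\<not> ?thesis"
    then have "V = {v}" using v by blast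
    then show False using ns by blast
  qed
  then obtain w where w: "w \<in> V" "w \<noteq> v" by blast
  then obtain l where l: "(v, l) \<in> E" using connected_on_leave[OF conn v w(1), of "{v}"] by auto
  show ?thesis
  proof (rule ccontr)
    assume "\<not> ?thesis"
    then have "neighbours E v = {l}" using l unfolding neighbours_def by blast
    then show False using deg by simp
  qed
qed

text \<open>Every neighbour of \<open>x\<close> has a second neighbour, which lies outside the star of \<open>x\<close>.\<close>

lemma atomic_biconn:
  assumes at: "atomic V E" and ns: "\<nexists>v. V = {v}"
  shows "girth5_graph.biconn E V"
proof -
  interpret girth5_graph V E using atomic_girth5[OF at] .
  have conn: "connected_on V E" and fin: "finite V" and ne: "V \<noteq> {}"
    using at unfolding atomic_def connected_graph_def simple_graph_def by auto
  obtain v where v: "v \<in> V" using ne by blast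
  obtain l m where lm: "l \<noteq> m" "(v, l) \<in> E" "(v, m) \<in> E" using atomic_degree[OF at ns v] by blast
  then have "card {l, m} \<le> card V" using R_sub fin by (intro card_mono) auto
  then have card2: "2 \<le> card V" using lm by simp
  have "connected_on (V - {x}) E" for x
  proof (cases "x \<in> V")
    case False
    then show ?thesis using conn by simp
  next
    case xV: True
    let ?T = "V - closed_star E x" and ?r = "E \<inter> (V - {x}) \<times> (V - {x})"
    have star: "connected_on ?T E" using at xV unfolding atomic_def by blast
    have into: "\<exists>t\<in>?T. (y, t) \<in> ?r\<^sup>*" if y: "y \<in> V - {x}" for y
    proof (cases "y \<in> closed_star E x")
      case False
      then show ?thesis using y by blast
    next
      case True
      then have xy: "(x, y) \<in> E" using y by (auto simp: in_star)
      obtain l m where "l \<noteq> m" "(y, l) \<in> E" "(y, m) \<in> E" using atomic_degree[OF at ns, of y] y by blast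
      then obtain t where t: "t \<noteq> x" "(y, t) \<in> E" by metis
      have "t \<in> ?T" using t xy no_triangle[OF xy t(2)] R_sub by (auto simp: in_star)
      moreover have "(y, t) \<in> ?r" using t y R_sub by blast
      ultimately show ?thesis by blast
    qed
    have sym: "(b, a) \<in> ?r\<^sup>*" if "(a, b) \<in> ?r\<^sup>*" for a b
    proof -
      have "sym ?r" using R_sym by (auto simp: sym_def)
      then show ?thesis using that sym_rtrancl by (meson symD)
    qed
    have sub: "E \<inter> ?T \<times> ?T \<subseteq> ?r" by (auto simp: in_star)
    show ?thesis
      unfolding connected_on_def
    proof (intro ballI)
      fix a b assume ab: "a \<in> V - {x}" "b \<in> V - {x}"
      obtain s where s: "s \<in> ?T" "(a, s) \<in> ?r\<^sup>*" using into[OF ab(1)] by blast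
      obtain t where t: "t \<in> ?T" "(b, t) \<in> ?r\<^sup>*" using into[OF ab(2)] by blast
      have "(s, t) \<in> (E \<inter> ?T \<times> ?T)\<^sup>*" using star s t unfolding connected_on_def by blast
      then have "(s, t) \<in> ?r\<^sup>*" using rtrancl_mono[OF sub] by blast
      then show "(a, b) \<in> ?r\<^sup>*" using s(2) sym[OF t(2)] by (meson rtrancl_trans)
    qed
  qed
  then show ?thesis unfolding biconn_def using conn fin card2 by blast
qed

lemma atomic_ext_graph: "atomic V E \<Longrightarrow> ext_graph V E (raag UNIV E)"
  using atomic_girth5 unfolding ext_graph_def raag_geometry_def girth5_graph_def by metis

text \<open>One generator gives an abelian group, whereas two neighbours of a vertex are not
  adjacent and do not commute.\<close>

lemma not_embeds_single_vertex:
  assumes at: "atomic V E" and ns: "\<nexists>v. V = {v}" and single: "F \<subseteq> {w} \<times> {w}" "sym F" "irrefl F"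
  shows "\<not> embeds (raag V E) (raag {w} F)"
proof
  assume emb: "embeds (raag V E) (raag {w} F)"
  interpret A: ext_graph V E "raag UNIV E" using atomic_ext_graph[OF at] .
  interpret B: raag_geometry F "raag UNIV F" using single by unfold_locales auto
  obtain h where h: "\<And>x. x \<in> A.sg V \<Longrightarrow> h x \<in> B.sg {w}"
    "\<And>x y. x \<in> A.sg V \<Longrightarrow> y \<in> A.sg V \<Longrightarrow> h (x \<otimes>\<^bsub>raag UNIV E\<^esub> y) = h x \<otimes>\<^bsub>raag UNIV F\<^esub> h y"
    "inj_on h (A.sg V)"
    by (rule embeds_sg_map[OF emb A.base.R_sub single(1) A.raag_geometry_axioms B.raag_geometry_axioms]) (rule that, blast+)
  have comm: "x \<otimes>\<^bsub>raag UNIV E\<^esub> y = y \<otimes>\<^bsub>raag UNIV E\<^esub> x" if "x \<in> A.sg V" "y \<in> A.sg V" for x y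
  proof -
    have "h x \<otimes>\<^bsub>raag UNIV F\<^esub> h y = h y \<otimes>\<^bsub>raag UNIV F\<^esub> h x"
      using B.sg_commute[OF h(1)[OF that(1)] h(1)[OF that(2)]] by blast
    then show ?thesis using h(2) that inj_onD[OF h(3)] A.sg_mult by metis
  qed
  obtain v where v: "v \<in> V" using at unfolding atomic_def connected_graph_def by blast
  obtain l m where lm: "l \<noteq> m" "(v, l) \<in> E" "(v, m) \<in> E" using atomic_degree[OF at ns v] by blast
  have lmV: "l \<in> V" "m \<in> V" using lm A.base.R_sub by auto
  let ?x = "(l, A.coset l \<one>\<^bsub>raag UNIV E\<^esub>)" and ?y = "(m, A.coset m \<one>\<^bsub>raag UNIV E\<^esub>)"
  have xy: "?x \<in> A.verts" "?y \<in> A.verts" using A.vertexI lmV A.sg_one by auto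
  obtain p q where pq: "p \<in> A.powers ?x" "q \<in> A.powers ?y" using A.powers_nonempty xy by blast
  have "?x = ?y \<or> (?x, ?y) \<in> A.adj"
    using A.powers_commute_imp[OF xy(1) pq(1) xy(2) pq(2)] comm A.powers_sg[OF xy(1) pq(1)] A.powers_sg[OF xy(2) pq(2)]
    by blast
  then have "l = m \<or> (l, m) \<in> E" unfolding A.adj_def by auto
  then show False using lm A.base.no_triangle[OF lm(2)] by blast
qed

text \<open>Some copy goes into one copy; as copies are induced, reading off the labels gives the
  map of graphs.\<close>

lemma embeds_induced_subgraph:
  assumes V: "atomic V E" "\<nexists>v. V = {v}" and W: "atomic W F" "\<nexists>w. W = {w}"
    and emb: "embeds (raag V E) (raag W F)" "embeds (raag W F) (raag V E)"
  shows "\<exists>f. induced_emb V E W F f"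
proof -
  interpret A: ext_graph V E "raag UNIV E" using atomic_ext_graph[OF V(1)] .
  interpret B: ext_graph W F "raag UNIV F" using atomic_ext_graph[OF W(1)] .
  have tA: "tiled_graph A.verts A.adj (A.copy ` A.sg V) (card V)"
    using A.tiled[OF atomic_biconn[OF V]] V(1) unfolding atomic_def by blast
  have tB: "tiled_graph B.verts B.adj (B.copy ` B.sg W) (card W)"
    using B.tiled[OF atomic_biconn[OF W]] W(1) unfolding atomic_def by blast
  obtain h where h: "\<And>x. x \<in> A.sg V \<Longrightarrow> h x \<in> B.sg W"
    "\<And>x y. x \<in> A.sg V \<Longrightarrow> y \<in> A.sg V \<Longrightarrow> h (x \<otimes>\<^bsub>raag UNIV E\<^esub> y) = h x \<otimes>\<^bsub>raag UNIV F\<^esub> h y"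
    "inj_on h (A.sg V)"
    by (rule embeds_sg_map[OF emb(1) A.base.R_sub B.base.R_sub A.raag_geometry_axioms B.raag_geometry_axioms]) (rule that, blast+)
  obtain k where k: "\<And>x. x \<in> B.sg W \<Longrightarrow> k x \<in> A.sg V"
    "\<And>x y. x \<in> B.sg W \<Longrightarrow> y \<in> B.sg W \<Longrightarrow> k (x \<otimes>\<^bsub>raag UNIV F\<^esub> y) = k x \<otimes>\<^bsub>raag UNIV E\<^esub> k y"
    "inj_on k (B.sg W)"
    by (rule embeds_sg_map[OF emb(2) B.base.R_sub A.base.R_sub B.raag_geometry_axioms A.raag_geometry_axioms]) (rule that, blast+)
  obtain f where f: "induced_emb A.verts A.adj B.verts B.adj f"
    using embedding_induces[OF A.ext_graph_axioms B.ext_graph_axioms atomic_degree[OF V] h] by blast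
  obtain g where g: "induced_emb B.verts B.adj A.verts A.adj g"
    using embedding_induces[OF B.ext_graph_axioms A.ext_graph_axioms atomic_degree[OF W] k] by blast
  obtain a b where a: "a \<in> A.sg V" and b: "b \<in> B.sg W" and sub: "f ` A.copy a \<subseteq> B.copy b"
    using tiled_graph_copy_into_copy[OF tA tB f g] by blast
  define \<psi> where "\<psi> u = fst (f (u, A.coset u a))" for u
  have i: "induced_emb V E B.verts B.adj (\<lambda>u. f (u, A.coset u a))"
    using induced_emb_comp[OF A.copy_induced[OF a] f] by (simp add: comp_def)
  have psi: "\<psi> u \<in> W" "f (u, A.coset u a) = (\<psi> u, B.coset (\<psi> u) b)" if "u \<in> V" for u
    using sub that unfolding A.copy_def B.copy_def \<psi>_def by fastforce+
  note c = B.copy_induced[OF b]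
  have "induced_emb V E W F \<psi>"
    unfolding induced_emb_def
  proof (intro conjI ballI)
    show "\<psi> ` V \<subseteq> W" using psi by blast
    show "inj_on \<psi> V"
    proof (rule inj_onI)
      fix x y assume xy: "x \<in> V" "y \<in> V" "\<psi> x = \<psi> y"
      then have "f (x, A.coset x a) = f (y, A.coset y a)" using psi(2) by simp
      then show "x = y" using i xy unfolding induced_emb_def inj_on_def by blast
    qed
    fix x y assume xy: "x \<in> V" "y \<in> V"
    have "(x, y) \<in> E \<longleftrightarrow> (f (x, A.coset x a), f (y, A.coset y a)) \<in> B.adj"
      using i xy unfolding induced_emb_def by blast
    also have "\<dots> \<longleftrightarrow> (\<psi> x, \<psi> y) \<in> F"
      using c psi[OF xy(1)] psi[OF xy(2)] unfolding induced_emb_def by simp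
    finally show "(x, y) \<in> E \<longleftrightarrow> (\<psi> x, \<psi> y) \<in> F" .
  qed
  then show ?thesis by blast
qed

theorem mainTheorem8:
  fixes V :: "'a set" and E :: "('a \<times> 'a) set"
    and W :: "'b set" and F :: "('b \<times> 'b) set"
  assumes "atomic V E" and "atomic W F"
  shows "(embeds (raag V E) (raag W F) \<and> embeds (raag W F) (raag V E))
           \<longleftrightarrow> graph_iso V E W F"
proof
  have E: "E \<subseteq> V \<times> V" "sym E" "irrefl E" "finite V" and F: "F \<subseteq> W \<times> W" "sym F" "irrefl F" "finite W"
    using assms unfolding atomic_def simple_graph_def by auto
  {
    assume "graph_iso V E W F"
    then show "embeds (raag V E) (raag W F) \<and> embeds (raag W F) (raag V E)"
      using graph_iso_embeds E F graph_iso_sym by metis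
  }
  assume emb: "embeds (raag V E) (raag W F) \<and> embeds (raag W F) (raag V E)"
  \<comment> \<open>A single vertex is atomic with valence zero, outside the reach of
    \<open>atomic_degree\<close>.\<close>
  consider "\<exists>v. V = {v}" "\<exists>w. W = {w}" | "\<exists>v. V = {v}" "\<nexists>w. W = {w}"
    | "\<nexists>v. V = {v}" "\<exists>w. W = {w}" | "\<nexists>v. V = {v}" "\<nexists>w. W = {w}" by blast
  then show "graph_iso V E W F"
  proof cases
    case 1
    then obtain v w where vw: "V = {v}" "W = {w}" by blast
    then have "E = {}" "F = {}" using E F by (auto simp: irrefl_def)
    then show ?thesis unfolding graph_iso_def vw by (intro exI[of _ "\<lambda>_. w"]) (simp add: bij_betw_def)
  next
    case 2
    then show ?thesis using not_embeds_single_vertex[OF assms(2) 2(2), of E] E emb by blast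
  next
    case 3
    then show ?thesis using not_embeds_single_vertex[OF assms(1) 3(1), of F] F emb by blast
  next
    case 4
    obtain f where f: "induced_emb V E W F f"
      using embeds_induced_subgraph[OF assms(1) 4(1) assms(2) 4(2)] emb by blast
    obtain g where g: "induced_emb W F V E g"
      using embeds_induced_subgraph[OF assms(2) 4(2) assms(1) 4(1)] emb by blast
    have fi: "f ` V \<subseteq> W" "inj_on f V" and gi: "g ` W \<subseteq> V" "inj_on g W"
      using f g unfolding induced_emb_def by auto
    \<comment> \<open>Induced embeddings both ways force equal sizes, and a surjective induced
      embedding is an isomorphism.\<close>
    have "card V \<le> card W" using card_inj_on_le[OF fi(2,1) F(4)] .
    moreover have "card W \<le> card V" using card_inj_on_le[OF gi(2,1) E(4)] .
    ultimately have "f ` V = W" using card_subset_eq[OF F(4) fi(1)] card_image[OF fi(2)] by simp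
    then show ?thesis using f unfolding induced_emb_def graph_iso_def bij_betw_def by blast
  qed
qed

end
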